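(* Let $p$ be a prime and $r\ge 0$ an integer, both fixed. Then, as the rank $m$ tends to infinity, $$\dim L_m(\omega_r)\sim\dim\Delta_m(\omega_r)\sim\frac{2^r}{r!}m^r .$$
   Context: $K$ is an algebraically closed field of characteristic $p$. For $m\ge \max(r,1)$, $L_m(\omega_r)$ and $\Delta_m(\omega_r)$ are respectively the simple rational module and the Weyl module with highest weight $\omega_r$ for the symplectic group $\mathrm{Sp}(2m)$ of rank $m$ over $K$, where $\omega_1,\dots,\omega_m$ are the fundamental weights in the usual numbering ($\omega_1$ is the highest weight of the natural module, $\omega_r$ that of its $r$-th exterior power) and $\omega_0=0$. The notation $a_m\sim b_m$ means $a_m/b_m\to 1$. *)

theory Defs
  imports
    "HOL-Algebra.Group"
    "HOL-Computational_Algebra.Polynomial"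
    "HOL-Library.Function_Algebras"
    "HOL-Library.Landau_Symbols"
    "Jordan_Normal_Form.Matrix"
begin

section \<open>The symplectic group\<close>

text \<open>Indices start at 0. With this antidiagonal Gram matrix of the alternating form, the
  diagonal matrices in \<^term>\<open>Sp m\<close>, which are the
  diag(t_1, ..., t_m, 1/t_m, ..., 1/t_1), form a maximal torus, and the upper triangular ones
  form a Borel subgroup containing it.\<close>

definition symp_form :: "nat \<Rightarrow> 'k::field mat" where
  "symp_form m = mat (2 * m) (2 * m)
     (\<lambda>(i, j). if i + j + 1 = 2 * m then (if i < m then 1 else - 1) else 0)"

definition Sp :: "nat \<Rightarrow> 'k::field mat monoid" where
  "Sp m = \<lparr>carrier = {A \<in> carrier_mat (2 * m) (2 * m).
                        transpose_mat A * symp_form m * A = symp_form m},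
           mult = (*), one = 1\<^sub>m (2 * m)\<rparr>"

definition borel_Sp :: "nat \<Rightarrow> 'k::field mat set" where
  "borel_Sp m = {b \<in> carrier (Sp m). upper_triangular b}"

text \<open>The integral weight with coordinates \<open>\<mu> 0, ..., \<mu> (m - 1)\<close> in the standard basis of the
  character lattice of the torus, extended to a character of the Borel subgroup.
  The fundamental weight number r is the sum of the first r basis elements.\<close>

definition weight_char :: "nat \<Rightarrow> (nat \<Rightarrow> int) \<Rightarrow> 'k::field mat \<Rightarrow> 'k" where
  "weight_char m \<mu> b = (\<Prod>i<m. (b $$ (i, i)) powi \<mu> i)"

definition fund_weight :: "nat \<Rightarrow> nat \<Rightarrow> int" where
  "fund_weight r = (\<lambda>i. if i < r then 1 else 0)"


section \<open>Regular functions\<close>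

inductive_set entry_polys :: "nat \<Rightarrow> ('k::field mat \<Rightarrow> 'k) set" for n :: nat where
  const: "(\<lambda>_. c) \<in> entry_polys n"
| entry: "i < n \<Longrightarrow> j < n \<Longrightarrow> (\<lambda>A. A $$ (i, j)) \<in> entry_polys n"
| add: "f \<in> entry_polys n \<Longrightarrow> g \<in> entry_polys n \<Longrightarrow> (\<lambda>A. f A + g A) \<in> entry_polys n"
| mult: "f \<in> entry_polys n \<Longrightarrow> g \<in> entry_polys n \<Longrightarrow> (\<lambda>A. f A * g A) \<in> entry_polys n"

text \<open>\<^term>\<open>Sp m\<close> is Zariski closed in the space of matrices, so its regular functions are the
  restrictions of polynomial functions (here extended by zero).\<close>

definition coord_ring :: "nat \<Rightarrow> ('k::field mat \<Rightarrow> 'k) set" where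
  "coord_ring m = {f. (\<exists>q \<in> entry_polys (2 * m). \<forall>g \<in> carrier (Sp m). f g = q g)
                      \<and> (\<forall>g. g \<notin> carrier (Sp m) \<longrightarrow> f g = 0)}"


section \<open>Rational modules\<close>

text \<open>All modules are realised on subspaces of function spaces \<^typ>\<open>'i \<Rightarrow> 'k\<close>.\<close>

definition fscale :: "'k::field \<Rightarrow> ('i \<Rightarrow> 'k) \<Rightarrow> 'i \<Rightarrow> 'k" where
  "fscale c f = (\<lambda>x. c * f x)"

global_interpretation fun_vs: vector_space "fscale :: 'k::field \<Rightarrow> ('i \<Rightarrow> 'k) \<Rightarrow> 'i \<Rightarrow> 'k"
  by unfold_locales (auto simp: fscale_def fun_eq_iff algebra_simps)

record ('k, 'i) gmodule =
  mspace :: "('i \<Rightarrow> 'k) set"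
  maction :: "'k mat \<Rightarrow> ('i \<Rightarrow> 'k) \<Rightarrow> ('i \<Rightarrow> 'k)"

abbreviation mdim :: "('k::field, 'i) gmodule \<Rightarrow> nat" where
  "mdim M \<equiv> fun_vs.dim (mspace M)"

text \<open>Linear functionals on a subspace, extended by zero.\<close>

definition dual_space :: "('i \<Rightarrow> 'k::field) set \<Rightarrow> (('i \<Rightarrow> 'k) \<Rightarrow> 'k) set" where
  "dual_space V = {\<phi>. (\<forall>u \<in> V. \<forall>v \<in> V. \<phi> (u + v) = \<phi> u + \<phi> v)
                     \<and> (\<forall>c. \<forall>v \<in> V. \<phi> (fscale c v) = c * \<phi> v)
                     \<and> (\<forall>v. v \<notin> V \<longrightarrow> \<phi> v = 0)}"

definition rational_module :: "nat \<Rightarrow> ('k::field, 'i) gmodule \<Rightarrow> bool" where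
  "rational_module m M \<longleftrightarrow>
     fun_vs.subspace (mspace M) \<and>
     (\<exists>B. finite B \<and> mspace M = fun_vs.span B) \<and>
     (\<forall>g \<in> carrier (Sp m). \<forall>v \<in> mspace M. maction M g v \<in> mspace M) \<and>
     (\<forall>g \<in> carrier (Sp m). \<forall>u \<in> mspace M. \<forall>v \<in> mspace M.
        maction M g (u + v) = maction M g u + maction M g v) \<and>
     (\<forall>g \<in> carrier (Sp m). \<forall>c. \<forall>v \<in> mspace M.
        maction M g (fscale c v) = fscale c (maction M g v)) \<and>
     (\<forall>v \<in> mspace M. maction M \<one>\<^bsub>Sp m\<^esub> v = v) \<and>
     (\<forall>g \<in> carrier (Sp m). \<forall>h \<in> carrier (Sp m). \<forall>v \<in> mspace M.
        maction M (g \<otimes>\<^bsub>Sp m\<^esub> h) v = maction M g (maction M h v)) \<and>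
     (\<forall>\<phi> \<in> dual_space (mspace M). \<forall>v \<in> mspace M.
        (\<lambda>g. if g \<in> carrier (Sp m) then \<phi> (maction M g v) else 0) \<in> coord_ring m)"

definition simple_module :: "nat \<Rightarrow> ('k::field, 'i) gmodule \<Rightarrow> bool" where
  "simple_module m M \<longleftrightarrow> rational_module m M \<and> mspace M \<noteq> {0} \<and>
     (\<forall>W \<subseteq> mspace M. fun_vs.subspace W \<and>
        (\<forall>g \<in> carrier (Sp m). \<forall>v \<in> W. maction M g v \<in> W) \<longrightarrow> W = {0} \<or> W = mspace M)"

text \<open>A simple rational module has a unique line stable under the Borel subgroup; the weight of
  that line is its highest weight.\<close>

definition has_highest_weight :: "nat \<Rightarrow> (nat \<Rightarrow> int) \<Rightarrow> ('k::field, 'i) gmodule \<Rightarrow> bool" where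
  "has_highest_weight m \<mu> M \<longleftrightarrow>
     (\<exists>v \<in> mspace M. v \<noteq> 0 \<and> (\<forall>b \<in> borel_Sp m. maction M b v = fscale (weight_char m \<mu> b) v))"

text \<open>A representative of the isomorphism class of simple modules of highest weight \<open>\<mu>\<close>. As these
  are finite-dimensional, one exists on a subspace of \<^typ>\<open>nat \<Rightarrow> 'k\<close> whenever \<open>\<mu>\<close> is dominant.\<close>

definition L_module :: "nat \<Rightarrow> (nat \<Rightarrow> int) \<Rightarrow> ('k::field, nat) gmodule" where
  "L_module m \<mu> = (SOME M. simple_module m M \<and> has_highest_weight m \<mu> M)"


section \<open>Weyl modules\<close>

definition dual_module :: "nat \<Rightarrow> ('k::field, 'i) gmodule \<Rightarrow> ('k, 'i \<Rightarrow> 'k) gmodule" where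
  "dual_module m M = \<lparr>mspace = dual_space (mspace M),
     maction = (\<lambda>g \<phi> v. if v \<in> mspace M then \<phi> (maction M (inv\<^bsub>Sp m\<^esub> g) v) else 0)\<rparr>"

text \<open>The module induced from a character of the Borel subgroup, i.e. the global sections of a line
  bundle on the flag variety. Relative to the usual convention \<open>f (g b) = \<chi> b\<^sup>-\<^sup>1 f g\<close> this is
  induced from \<open>-\<mu>\<close> on the positive Borel subgroup, which is isomorphic to the module induced
  from \<open>-w\<^sub>0 \<mu>\<close> on the negative one.\<close>

definition induced_module :: "nat \<Rightarrow> (nat \<Rightarrow> int) \<Rightarrow> ('k::field, 'k mat) gmodule" where
  "induced_module m \<mu> = \<lparr>mspace = {f \<in> coord_ring m. \<forall>g \<in> carrier (Sp m). \<forall>b \<in> borel_Sp m.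
                                     f (g \<otimes>\<^bsub>Sp m\<^esub> b) = weight_char m \<mu> b * f g},
     maction = (\<lambda>g f x. if x \<in> carrier (Sp m) then f (inv\<^bsub>Sp m\<^esub> g \<otimes>\<^bsub>Sp m\<^esub> x) else 0)\<rparr>"

text \<open>The Weyl module of highest weight \<open>\<mu>\<close> is the dual of the induced module; its highest weight
  vector is the evaluation at the identity.\<close>

definition Weyl_module :: "nat \<Rightarrow> (nat \<Rightarrow> int) \<Rightarrow> ('k::field, 'k mat \<Rightarrow> 'k) gmodule" where
  "Weyl_module m \<mu> = dual_module m (induced_module m \<mu>)"

end

theory Submission
  imports Defs "Jordan_Normal_Form.Determinant"
begin

text \<open>Write \<open>\<omega>\<close> for the fundamental weight number \<open>r\<close> and \<open>H\<close> for the module induced from it. The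
  proof sandwiches both dimensions:
  \<open>2^r (m choose r) \<le> dim L \<le> dim H = dim \<Delta> \<le> 2^r (m choose r) + O(m^(r - 1))\<close>.

  The lower bound counts the Weyl group conjugates of the highest weight. The middle inequality
  sends a functional \<open>\<phi>\<close> on \<open>L\<close> to the function \<open>g \<mapsto> \<phi> (g v)\<close> in \<open>H\<close>, where \<open>v\<close> is a highest weight
  vector. For the upper bound, an element of \<open>H\<close> is determined by its restriction to the
  lower unitriangular matrices whose middle block of size \<open>2 (m - r)\<close> is trivial. A vector of weight
  \<open>\<nu>\<close> restricts to a combination of those monomials in the entries which have weight \<open>\<nu> - \<omega>\<close> under
  conjugation by the torus. So, up to the Weyl group, \<open>\<nu>\<close> is the fundamental weight number \<open>j\<close> for
  some \<open>j \<le> r\<close>; its multiplicity is 1 if \<open>j = r\<close>, and \<open>O(m^((r - j) div 2))\<close> in general because every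
  index beyond \<open>r\<close> that occurs in such a monomial has to occur twice.

  As \<open>L\<close> is only given by a choice, its existence has to be shown as well: the leading minor of order
  \<open>r\<close> spans the \<open>\<omega>\<close>-weight space of \<open>H\<close>, and every nonzero submodule of \<open>H\<close> contains it.\<close>

section \<open>Separation of characters of a torus\<close>

text \<open>The dimension of \<open>L\<close> varies with p, so orders of growth are compared rather
  than exact values. The Weyl orbit of the fundamental weight number j has size of order m^j; with
  the multiplicity bound its share of \<open>H\<close> has order at most j + (r - j) div 2, and this
  is at most r - 1 when j < r. Hence the top orbit has to be counted exactly, while everything below
  it may be counted wastefully. The middle block can be taken trivial because the weight vanishes on
  its coordinates: after r steps of an induction on the rank, what is left is a function on the
  smaller group that is invariant under its Borel subgroup, and such a function is constant. Density
  of the big cell and independence of characters both come down to one variable over an infinite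
  field: the former through a curve of transvections that leaves the complement of the cell, the
  latter through powers of one torus element that separates finitely many weights. Translates by the
  same powers cut weight components out of a submodule.\<close>

lemma infinite_UNIV_alg_closed_field: "infinite (UNIV :: 'k::alg_closed_field set)"
proof
  assume fin: "finite (UNIV :: 'k set)"
  \<comment> \<open>As in Euclid's proof: the product of all X - a is 0 everywhere, so adding 1
    gives a polynomial without roots.\<close>
  define q :: "'k poly" where "q = (\<Prod>a\<in>UNIV. [:-a, 1:])"
  have "degree q = card (UNIV :: 'k set)"
    unfolding q_def by (subst degree_prod_eq_sum_degree) (auto simp: fin)
  moreover have "card (UNIV :: 'k set) > 0"
    using fin by (simp add: card_gt_0_iff)
  ultimately have "degree (q + 1) > 0"
    by (subst degree_add_eq_left) auto
  then obtain x where "poly (q + 1) x = 0"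
    using alg_closed_imp_poly_has_root by blast
  moreover have "poly q x = 0"
    unfolding q_def by (simp add: poly_prod fin)
  ultimately show False by simp
qed

text \<open>Lagrange interpolation: up to normalisation, \<open>c\<close> consists of the
  coefficients of the polynomial that vanishes at all nodes except \<open>x i\<close>. It does not
  depend on \<open>a\<close>, which matters when \<open>a\<close> later runs through the values of
  weight components at a varying group element.\<close>

lemma exists_power_sum_coeffs:
  fixes x :: "'a \<Rightarrow> 'k::field"
  assumes fin: "finite I" and inj: "inj_on x I" and i: "i \<in> I"
  obtains n c where "\<And>a. (\<Sum>k\<le>n. c k * (\<Sum>j\<in>I. a j * x j ^ k)) = a i"
proof -
  define q where "q = (\<Prod>j\<in>I - {i}. [:- x j, 1:])"
  have 0: "poly q (x j) = 0" if "j \<in> I - {i}" for j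
    unfolding q_def poly_prod using that fin by (intro prod_zero) auto
  have nz: "poly q (x i) \<noteq> 0"
    unfolding q_def poly_prod using fin inj i by (auto simp: inj_on_def)
  have comb: "(\<Sum>k\<le>degree q. coeff q k / poly q (x i) * (\<Sum>j\<in>I. a j * x j ^ k)) = a i" for a
  proof -
    have "(\<Sum>k\<le>degree q. coeff q k / poly q (x i) * (\<Sum>j\<in>I. a j * x j ^ k))
        = (\<Sum>k\<le>degree q. \<Sum>j\<in>I. a j / poly q (x i) * (coeff q k * x j ^ k))"
      by (simp add: sum_distrib_left mult_ac divide_inverse)
    also have "\<dots> = (\<Sum>j\<in>I. a j / poly q (x i) * poly q (x j))"
      by (subst sum.swap) (simp add: poly_altdef sum_distrib_left)
    also have "\<dots> = (\<Sum>j\<in>I. if j = i then a i else 0)"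
      using 0 nz by (intro sum.cong refl) auto
    finally show ?thesis using fin i by simp
  qed
  show ?thesis by (rule that) (rule comb)
qed

lemma power_sums_zero_imp_coeffs_zero:
  fixes x a :: "'a \<Rightarrow> 'k::field"
  assumes fin: "finite I" and inj: "inj_on x I"
    and eq: "\<And>k. (\<Sum>i\<in>I. a i * x i ^ k) = 0" and i: "i \<in> I"
  shows "a i = 0"
proof -
  obtain n c where "\<And>a. (\<Sum>k\<le>n. c k * (\<Sum>j\<in>I. a j * x j ^ k)) = a i"
    using exists_power_sum_coeffs[OF fin inj i] by blast
  from this[of a] show ?thesis by (simp add: eq)
qed

definition tchar :: "nat \<Rightarrow> (nat \<Rightarrow> int) \<Rightarrow> (nat \<Rightarrow> 'k::field) \<Rightarrow> 'k" where
  "tchar m \<nu> t = (\<Prod>i<m. t i powi \<nu> i)"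

text \<open>Vanishing from \<open>m\<close> on makes equality of weights the same as equality of the
  exponents that \<open>tchar m\<close> sees.\<close>

definition weights :: "nat \<Rightarrow> (nat \<Rightarrow> int) set" where
  "weights m = {\<nu>. \<forall>i\<ge>m. \<nu> i = 0}"

lemma finite_roots_powi:
  fixes c :: "'k::field"
  assumes "k \<noteq> 0"
  shows "finite {z. z powi k = c}"
proof -
  define n where "n = nat \<bar>k\<bar>"
  have fin: "finite {z::'k. z ^ n = d}" for d
  proof -
    have "monom 1 n - [:d:] \<noteq> (0 :: 'k poly)"
    proof
      assume "monom 1 n - [:d:] = (0 :: 'k poly)"
      then have "coeff (monom 1 n - [:d:]) n = 0" by simp
      then show False using assms by (simp add: n_def coeff_pCons split: nat.splits)
    qed
    then have "finite {z. poly (monom 1 n - [:d:]) z = 0}"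
      by (rule poly_roots_finite)
    then show ?thesis by (simp add: poly_monom)
  qed
  show ?thesis
  proof (cases "k \<ge> 0")
    case True
    then show ?thesis using fin[of c] by (simp add: power_int_def n_def)
  next
    case False
    have "{z. z powi k = c} \<subseteq> {z. z ^ n = inverse c}"
      using False by (auto simp: power_int_def n_def power_inverse)
    then show ?thesis using fin finite_subset by blast
  qed
qed

text \<open>The coordinates of \<open>t\<close> are chosen one at a time. Two weights that differ in
  the new coordinate give the same character only if the new entry z satisfies an equation z powi k
  = c with k nonzero, which excludes finitely many values.\<close>

lemma exists_separating_torus_element:
  assumes inf: "infinite (UNIV :: 'k::field set)" and fin: "finite \<Lambda>"
  shows "\<exists>t::nat \<Rightarrow> 'k. (\<forall>i. t i \<noteq> 0) \<and>
           (\<forall>\<mu>\<in>\<Lambda>. \<forall>\<nu>\<in>\<Lambda>. tchar m \<mu> t = tchar m \<nu> t \<longrightarrow> (\<forall>i<m. \<mu> i = \<nu> i))"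
proof (induction m)
  case 0
  show ?case by (auto intro: exI[of _ "\<lambda>_. 1"])
next
  case (Suc m)
  then obtain t :: "nat \<Rightarrow> 'k" where t0: "\<And>i. t i \<noteq> 0"
    and t: "\<And>\<mu> \<nu> i. \<mu> \<in> \<Lambda> \<Longrightarrow> \<nu> \<in> \<Lambda> \<Longrightarrow> tchar m \<mu> t = tchar m \<nu> t \<Longrightarrow> i < m \<Longrightarrow> \<mu> i = \<nu> i"
    by blast
  define bad where "bad = (\<Union>\<mu>\<in>\<Lambda>. \<Union>\<nu>\<in>{\<nu>\<in>\<Lambda>. \<mu> m \<noteq> \<nu> m}.
    {z. z powi (\<mu> m - \<nu> m) = tchar m \<nu> t / tchar m \<mu> t})"
  have "finite bad"
    unfolding bad_def using fin by (intro finite_UN_I finite_roots_powi) auto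
  then obtain z where z: "z \<notin> insert 0 bad"
    using ex_new_if_finite[OF inf] by (metis finite_insert)
  define t' where "t' = t(m := z)"
  have tchar': "tchar (Suc m) \<mu> t' = tchar m \<mu> t * z powi \<mu> m" for \<mu>
    unfolding tchar_def t'_def by (simp add: mult.commute)
  have nz: "tchar m \<mu> t \<noteq> 0" for \<mu>
    unfolding tchar_def using t0 by (simp add: power_int_eq_0_iff)
  have "\<mu> i = \<nu> i" if \<mu>: "\<mu> \<in> \<Lambda>" and \<nu>: "\<nu> \<in> \<Lambda>"
    and eq: "tchar (Suc m) \<mu> t' = tchar (Suc m) \<nu> t'" and i: "i < Suc m" for \<mu> \<nu> i
  proof -
    have "\<mu> m = \<nu> m"
    proof (rule ccontr)
      assume neq: "\<mu> m \<noteq> \<nu> m"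
      have "z powi (\<mu> m - \<nu> m) = tchar m \<nu> t / tchar m \<mu> t"
        using eq z nz[of \<mu>] unfolding tchar' by (simp add: power_int_diff field_simps)
      then have "z \<in> bad" using \<mu> \<nu> neq unfolding bad_def by blast
      then show False using z by simp
    qed
    moreover from this have "tchar m \<mu> t = tchar m \<nu> t"
      using eq z unfolding tchar' by (simp add: power_int_eq_0_iff)
    ultimately show ?thesis using t[OF \<mu> \<nu>] i by (cases "i = m") auto
  qed
  moreover have "t' i \<noteq> 0" for i using t0 z by (auto simp: t'_def)
  ultimately show ?case by blast
qed

lemma tchar_power: "tchar m \<nu> (\<lambda>i. t i ^ k) = tchar m \<nu> t ^ k"
proof -
  have "(t i ^ k) powi \<nu> i = (t i powi \<nu> i) ^ k" for i
    by (metis mult.commute power_int_mult power_int_of_nat)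
  then show ?thesis by (simp add: tchar_def prod_power_distrib)
qed

lemma weights_eqI: "\<mu> \<in> weights m \<Longrightarrow> \<nu> \<in> weights m \<Longrightarrow> (\<And>i. i < m \<Longrightarrow> \<mu> i = \<nu> i) \<Longrightarrow> \<mu> = \<nu>"
  unfolding weights_def by (auto simp: fun_eq_iff) (metis not_le)

lemma exists_separating_torus_element_weights:
  assumes inf: "infinite (UNIV :: 'k::field set)" and fin: "finite \<Lambda>" and w: "\<Lambda> \<subseteq> weights m"
  obtains t :: "nat \<Rightarrow> 'k::field" where "\<And>i. t i \<noteq> 0" "inj_on (\<lambda>\<nu>. tchar m \<nu> t) \<Lambda>"
proof -
  obtain t :: "nat \<Rightarrow> 'k" where t: "\<forall>i. t i \<noteq> 0"
      "\<forall>\<mu>\<in>\<Lambda>. \<forall>\<nu>\<in>\<Lambda>. tchar m \<mu> t = tchar m \<nu> t \<longrightarrow> (\<forall>i<m. \<mu> i = \<nu> i)"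
    using exists_separating_torus_element[OF inf fin, of m] by blast
  then have "inj_on (\<lambda>\<nu>. tchar m \<nu> t) \<Lambda>"
    using w by (intro inj_onI weights_eqI[of _ m]) auto
  then show ?thesis using t that by blast
qed

text \<open>Evaluated at the powers of a single separating torus element, the relation becomes a
  Vandermonde system for the coefficients.\<close>

lemma characters_independent:
  fixes a :: "(nat \<Rightarrow> int) \<Rightarrow> 'k::field"
  assumes inf: "infinite (UNIV :: 'k set)" and fin: "finite \<Lambda>" and w: "\<Lambda> \<subseteq> weights m"
    and eq: "\<And>t. (\<And>i. t i \<noteq> 0) \<Longrightarrow> (\<Sum>\<nu>\<in>\<Lambda>. a \<nu> * tchar m \<nu> t) = 0"
    and \<nu>: "\<nu> \<in> \<Lambda>"
  shows "a \<nu> = 0"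
proof -
  obtain t :: "nat \<Rightarrow> 'k" where t: "\<And>i. t i \<noteq> 0" "inj_on (\<lambda>\<nu>. tchar m \<nu> t) \<Lambda>"
    using exists_separating_torus_element_weights[OF inf fin w] by blast
  have "(\<Sum>\<nu>\<in>\<Lambda>. a \<nu> * tchar m \<nu> t ^ k) = 0" for k
    using eq[of "\<lambda>i. t i ^ k"] t by (simp add: tchar_power)
  then show ?thesis
    by (rule power_sums_zero_imp_coeffs_zero[OF fin t(2) _ \<nu>])
qed

section \<open>Subspaces of function spaces\<close>

lemma sum_fun_apply: "(\<Sum>i\<in>I. f i) x = (\<Sum>i\<in>I. f i x :: 'b::comm_monoid_add)"
  by (induction I rule: infinite_finite_induct) auto

lemma fscale_apply [simp]: "fscale c f x = c * f x"
  by (simp add: fscale_def)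

lemma fun_subspaceD:
  assumes "fun_vs.subspace V"
  shows "0 \<in> V" "u \<in> V \<Longrightarrow> v \<in> V \<Longrightarrow> u + v \<in> V" "v \<in> V \<Longrightarrow> fscale c v \<in> V"
    "u \<in> V \<Longrightarrow> v \<in> V \<Longrightarrow> u - v \<in> V"
  using assms fun_vs.subspace_0 fun_vs.subspace_add fun_vs.subspace_scale fun_vs.subspace_diff
  by blast+

text \<open>\<open>V\<close> is not known to be finite-dimensional beforehand: a basis of
  \<open>V\<close> stays independent under \<open>T\<close>, and its size is then bounded inside the
  span of \<open>C\<close>. Weight spaces and submodules obtain their finite bases in this
  way.\<close>

lemma finite_span_if_injective:
  fixes T :: "('i \<Rightarrow> 'k::field) \<Rightarrow> 'j \<Rightarrow> 'k"
  assumes V: "fun_vs.subspace V" and T: "Vector_Spaces.linear fscale fscale T"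
    and inj: "\<And>v. v \<in> V \<Longrightarrow> T v = 0 \<Longrightarrow> v = 0"
    and C: "finite C" "T ` V \<subseteq> fun_vs.span C"
  obtains B where "finite B" "card B \<le> card C" "B \<subseteq> V" "fun_vs.independent B" "V = fun_vs.span B"
proof -
  interpret T: Vector_Spaces.linear fscale fscale T by (rule T)
  obtain B where B: "B \<subseteq> V" "fun_vs.independent B" "V \<subseteq> fun_vs.span B"
    using fun_vs.maximal_independent_subset[of V] by blast
  have VB: "V = fun_vs.span B"
    using B V fun_vs.span_minimal by blast
  have injB: "inj_on T (fun_vs.span B)"
    unfolding VB[symmetric]
  proof (rule inj_onI)
    fix u v assume "u \<in> V" "v \<in> V" "T u = T v"
    then have "u - v \<in> V" "T (u - v) = 0"
      using fun_subspaceD(4)[OF V] by (auto simp: T.diff)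
    then show "u = v" using inj by fastforce
  qed
  have "fun_vs.independent (T ` B)"
    by (rule T.independent_injective_image[OF B(2) injB])
  moreover have "T ` B \<subseteq> fun_vs.span C" using C B by blast
  ultimately have "finite (T ` B)" "card (T ` B) \<le> card C"
    using fun_vs.independent_span_bound[OF C(1)] by auto
  moreover have injB': "inj_on T B"
    using injB fun_vs.span_superset inj_on_subset by blast
  ultimately have "finite B" "card B \<le> card C"
    unfolding finite_image_iff[OF injB'] card_image[OF injB'] by blast+
  then show ?thesis using that B VB by blast
qed

lemma dual_spaceD:
  assumes "\<phi> \<in> dual_space V"
  shows "u \<in> V \<Longrightarrow> v \<in> V \<Longrightarrow> \<phi> (u + v) = \<phi> u + \<phi> v" "v \<in> V \<Longrightarrow> \<phi> (fscale c v) = c * \<phi> v"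
    "v \<notin> V \<Longrightarrow> \<phi> v = 0"
  using assms unfolding dual_space_def by blast+

text \<open>The coordinate functionals of a basis, extended by zero, form a basis of the dual.
  Members of \<open>dual_space V\<close> are linear on \<open>V\<close> only, so the expansion is
  checked separately on and off \<open>V\<close>.\<close>

lemma dual_space_dim:
  fixes V :: "('i \<Rightarrow> 'k::field) set"
  assumes V: "fun_vs.subspace V" and fin: "finite C" "V = fun_vs.span C"
  shows "fun_vs.dim (dual_space V) = fun_vs.dim V"
    and "\<exists>D. finite D \<and> dual_space V = fun_vs.span D"
proof -
  obtain B where B: "B \<subseteq> V" "fun_vs.independent B" "V \<subseteq> fun_vs.span B"
    using fun_vs.maximal_independent_subset[of V] by blast
  have finB: "finite B"
    using fun_vs.independent_span_bound[OF fin(1) B(2)] B(1) fin(2) by blast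
  have VB: "V = fun_vs.span B"
    using B V fun_vs.span_minimal by blast
  define d where "d b v = (if v \<in> V then fun_vs.representation B v b else 0)" for b v
  have dd: "d b c = (if b = c then 1 else 0)" if "c \<in> B" for b c
    using that B fun_vs.representation_basis[OF B(2) that] by (auto simp: d_def)
  have d_dual: "d b \<in> dual_space V" if "b \<in> B" for b
    unfolding dual_space_def d_def
    using V B(2,3) by (auto simp: VB fun_vs.representation_add fun_vs.representation_scale
        fun_vs.span_add fun_vs.span_scale)
  have dual_sum: "\<phi> (\<Sum>b\<in>A. fscale (c b) b) = (\<Sum>b\<in>A. c b * \<phi> b)"
    if \<phi>: "\<phi> \<in> dual_space V" and A: "finite A" "A \<subseteq> B" for \<phi> c A
    using A
  proof (induction A)
    case empty
    have "\<phi> (fscale 0 0) = 0 * \<phi> 0"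
      using \<phi> fun_subspaceD(1)[OF V] unfolding dual_space_def by blast
    then show ?case by (simp add: zero_fun_def fscale_def)
  next
    case (insert x A)
    have "fscale (c x) x \<in> V" using insert B fun_subspaceD(3)[OF V] by blast
    moreover have "(\<Sum>b\<in>A. fscale (c b) b) \<in> V"
      using insert B V by (intro fun_vs.subspace_sum) (auto intro!: fun_subspaceD(3))
    moreover have "x \<in> V" using insert B by blast
    ultimately have "\<phi> (fscale (c x) x + (\<Sum>b\<in>A. fscale (c b) b)) = c x * \<phi> x + \<phi> (\<Sum>b\<in>A. fscale (c b) b)"
      by (simp only: dual_spaceD(1)[OF \<phi>] dual_spaceD(2)[OF \<phi>])
    moreover have "\<phi> (\<Sum>b\<in>A. fscale (c b) b) = (\<Sum>b\<in>A. c b * \<phi> b)"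
      using insert by blast
    ultimately show ?case
      unfolding sum.insert[OF insert.hyps] by (simp only:)
  qed
  have expand: "\<phi> = (\<Sum>b\<in>B. fscale (\<phi> b) (d b))" if \<phi>: "\<phi> \<in> dual_space V" for \<phi>
  proof
    fix v show "\<phi> v = (\<Sum>b\<in>B. fscale (\<phi> b) (d b)) v"
    proof (cases "v \<in> V")
      case True
      have "v = (\<Sum>b\<in>B. fscale (fun_vs.representation B v b) b)"
        using fun_vs.sum_representation_eq[OF B(2) _ finB order_refl, of v] True VB by simp
      then have "\<phi> v = \<phi> (\<Sum>b\<in>B. fscale (fun_vs.representation B v b) b)" by (rule arg_cong)
      also have "\<dots> = (\<Sum>b\<in>B. fun_vs.representation B v b * \<phi> b)"
        by (rule dual_sum[OF \<phi> finB order_refl])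
      finally show ?thesis using True by (simp add: sum_fun_apply d_def mult.commute)
    next
      case False
      then show ?thesis using \<phi> by (simp add: sum_fun_apply d_def dual_space_def)
    qed
  qed
  have sub: "fun_vs.subspace (dual_space V)"
    unfolding fun_vs.subspace_def dual_space_def
    by (auto simp: algebra_simps)
  have inj: "inj_on d B"
    by (rule inj_onI) (metis dd zero_neq_one)
  have span: "dual_space V = fun_vs.span (d ` B)"
  proof
    show "dual_space V \<subseteq> fun_vs.span (d ` B)"
    proof
      fix \<phi> assume "\<phi> \<in> dual_space V"
      then have "\<phi> = (\<Sum>b\<in>B. fscale (\<phi> b) (d b))" by (rule expand)
      moreover have "(\<Sum>b\<in>B. fscale (\<phi> b) (d b)) \<in> fun_vs.span (d ` B)"
        by (intro fun_vs.span_sum fun_vs.span_scale fun_vs.span_base imageI)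
      ultimately show "\<phi> \<in> fun_vs.span (d ` B)" by metis
    qed
    show "fun_vs.span (d ` B) \<subseteq> dual_space V"
      by (rule fun_vs.span_minimal) (use sub d_dual in auto)
  qed
  have scalars: "f x = 0" if eq: "(\<Sum>x\<in>d ` B. fscale (f x) x) = 0" and x: "x \<in> d ` B" for f x
  proof -
    obtain c where c: "c \<in> B" "x = d c" using x by blast
    have "0 = (\<Sum>b\<in>B. fscale (f (d b)) (d b)) c"
      using eq unfolding sum.reindex[OF inj] comp_def by simp
    also have "\<dots> = (\<Sum>b\<in>B. if b = c then f (d b) else 0)"
      unfolding sum_fun_apply fscale_apply by (intro sum.cong refl) (simp add: dd[OF c(1)])
    finally show ?thesis using c finB by simp
  qed
  have "fun_vs.independent (d ` B)"
  proof
    assume "fun_vs.dependent (d ` B)"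
    then have "\<exists>f. (\<exists>x\<in>d ` B. f x \<noteq> 0) \<and> (\<Sum>x\<in>d ` B. fscale (f x) x) = 0"
      by (rule iffD1[OF fun_vs.dependent_finite[OF finite_imageI[OF finB]]])
    then obtain f x where "x \<in> d ` B" "f x \<noteq> 0" "(\<Sum>x\<in>d ` B. fscale (f x) x) = 0"
      by (elim exE conjE bexE)
    then show False using scalars by blast
  qed
  then have "fun_vs.dim (dual_space V) = card (d ` B)"
    unfolding span by (rule fun_vs.dim_span_eq_card_independent)
  also have "\<dots> = card B" using inj by (rule card_image)
  also have "\<dots> = fun_vs.dim V" using B by (intro fun_vs.basis_card_eq_dim) auto
  finally show "fun_vs.dim (dual_space V) = fun_vs.dim V" .
  show "\<exists>D. finite D \<and> dual_space V = fun_vs.span D"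
    using span finB by blast
qed

lemma dim_le_if_injective:
  fixes T :: "('i \<Rightarrow> 'k::field) \<Rightarrow> 'j \<Rightarrow> 'k"
  assumes V: "fun_vs.subspace V" and T: "Vector_Spaces.linear fscale fscale T"
    and inj: "\<And>v. v \<in> V \<Longrightarrow> T v = 0 \<Longrightarrow> v = 0"
    and C: "finite C" "T ` V \<subseteq> fun_vs.span C"
  shows "fun_vs.dim V \<le> fun_vs.dim (fun_vs.span C)"
proof -
  obtain C' where C': "C' \<subseteq> C" "fun_vs.independent C'" "C \<subseteq> fun_vs.span C'"
    using fun_vs.maximal_independent_subset[of C] by blast
  then have span: "fun_vs.span C' = fun_vs.span C"
    by (metis fun_vs.span_mono fun_vs.span_span subset_antisym)
  have finC': "finite C'" using C' C finite_subset by blast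
  obtain B where "finite B" "card B \<le> card C'" "V = fun_vs.span B"
    using finite_span_if_injective[OF V T inj finC'] C span by metis
  then have "fun_vs.dim V \<le> card C'"
    by (metis fun_vs.dim_le_card fun_vs.dim_span fun_vs.span_superset le_trans order_refl)
  also have "\<dots> = fun_vs.dim (fun_vs.span C)"
    using C' span by (metis fun_vs.dim_span_eq_card_independent)
  finally show ?thesis .
qed

lemma fscale_linearI:
  assumes "\<And>u v. T (u + v) = T u + T v" "\<And>c v. T (fscale c v) = fscale c (T v)"
  shows "Vector_Spaces.linear fscale fscale T"
  using assms by unfold_locales auto

section \<open>Polynomial functions in the matrix entries\<close>

lemma entry_polys_sum: "(\<And>i. i \<in> I \<Longrightarrow> f i \<in> entry_polys n) \<Longrightarrow> (\<lambda>A. \<Sum>i\<in>I. f i A) \<in> entry_polys n"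
  by (induction I rule: infinite_finite_induct) (auto intro: entry_polys.intros)

lemma entry_polys_prod: "(\<And>i. i \<in> I \<Longrightarrow> f i \<in> entry_polys n) \<Longrightarrow> (\<lambda>A. \<Prod>i\<in>I. f i A) \<in> entry_polys n"
  by (induction I rule: infinite_finite_induct) (auto intro: entry_polys.intros)

lemma entry_polys_cmult: "f \<in> entry_polys n \<Longrightarrow> (\<lambda>A. c * f A) \<in> entry_polys n"
  by (intro entry_polys.mult entry_polys.const)

text \<open>The ring \<open>R\<close> is left arbitrary because the substitution principle is used
  for three kinds of functions: polynomials in the entries of another matrix, polynomials along a
  curve, and sums of products in two matrix variables. The set \<open>X\<close> is there because
  product formulas for entries need matrices of the right size.\<close>

lemma entry_polys_subst:
  assumes q: "q \<in> entry_polys n"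
    and const: "\<And>c. (\<lambda>_. c) \<in> R"
    and add: "\<And>f g. f \<in> R \<Longrightarrow> g \<in> R \<Longrightarrow> (\<lambda>x. f x + g x) \<in> R"
    and mult: "\<And>f g. f \<in> R \<Longrightarrow> g \<in> R \<Longrightarrow> (\<lambda>x. f x * g x) \<in> R"
    and entry: "\<And>i j. i < n \<Longrightarrow> j < n \<Longrightarrow> \<exists>p\<in>R. \<forall>x\<in>X. \<phi> x $$ (i, j) = p x"
  shows "\<exists>p\<in>R. \<forall>x\<in>X. q (\<phi> x) = p x"
  using q
proof induction
  case (const c)
  show ?case by (rule bexI[OF _ assms(2)[of c]]) simp
next
  case (entry i j)
  then show ?case using assms(5) by blast
next
  case (add f g)
  then obtain p p' where "p \<in> R" "p' \<in> R" "\<forall>x\<in>X. f (\<phi> x) = p x" "\<forall>x\<in>X. g (\<phi> x) = p' x"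
    by blast
  then show ?case using assms(3)[of p p'] by (intro bexI[of _ "\<lambda>x. p x + p' x"]) auto
next
  case (mult f g)
  then obtain p p' where "p \<in> R" "p' \<in> R" "\<forall>x\<in>X. f (\<phi> x) = p x" "\<forall>x\<in>X. g (\<phi> x) = p' x"
    by blast
  then show ?case using assms(4)[of p p'] by (intro bexI[of _ "\<lambda>x. p x * p' x"]) auto
qed

lemma entry_polys_subst_entry_polys:
  assumes "q \<in> entry_polys n"
    and "\<And>i j. i < n \<Longrightarrow> j < n \<Longrightarrow> \<exists>p\<in>entry_polys n'. \<forall>x\<in>X. \<phi> x $$ (i, j) = p x"
  shows "\<exists>p\<in>entry_polys n'. \<forall>x\<in>X. q (\<phi> x) = p x"
  using assms(1)
proof (rule entry_polys_subst)
  show "(\<lambda>_. c) \<in> entry_polys n'" for c by (rule entry_polys.const)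
qed (use assms(2) in \<open>auto intro: entry_polys.add entry_polys.mult\<close>)

lemma entry_polys_subst_poly:
  fixes q :: "'k::field mat \<Rightarrow> 'k"
  assumes "q \<in> entry_polys n"
    and "\<And>i j. i < n \<Longrightarrow> j < n \<Longrightarrow> \<exists>p. \<forall>s. \<phi> s $$ (i, j) = poly p s"
  shows "\<exists>p. \<forall>s. q (\<phi> s) = poly p s"
proof -
  have "\<exists>p\<in>range poly. \<forall>s\<in>UNIV. q (\<phi> s) = p s"
  proof (rule entry_polys_subst[OF assms(1)])
    fix c :: 'k show "(\<lambda>_. c) \<in> range poly" by (intro image_eqI[of _ _ "[:c:]"]) auto
  next
    fix f g :: "'k \<Rightarrow> 'k" assume "f \<in> range poly" "g \<in> range poly"
    then obtain p p' where "f = poly p" "g = poly p'" by blast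
    then have "(\<lambda>x. f x + g x) = poly (p + p')" "(\<lambda>x. f x * g x) = poly (p * p')"
      by auto
    then show "(\<lambda>x. f x + g x) \<in> range poly" "(\<lambda>x. f x * g x) \<in> range poly"
      by blast+
  qed (use assms(2) in blast)
  then show ?thesis by auto
qed

text \<open>A monomial is encoded by the list of its positions. Different lists may give the same
  function; this only overcounts, and only upper bounds are drawn from counting lists.\<close>

definition monom_fun :: "(nat \<times> nat) list \<Rightarrow> 'k::field mat \<Rightarrow> 'k" where
  "monom_fun xs A = (\<Prod>p\<leftarrow>xs. A $$ p)"

definition terms_fun :: "('k \<times> (nat \<times> nat) list) list \<Rightarrow> 'k::field mat \<Rightarrow> 'k" where
  "terms_fun l A = (\<Sum>(c, xs)\<leftarrow>l. c * monom_fun xs A)"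

lemma terms_fun_simps [simp]:
  "terms_fun [] A = 0" "terms_fun ((c, xs) # l) A = c * monom_fun xs A + terms_fun l A"
  "terms_fun (l @ l') A = terms_fun l A + terms_fun l' A"
  by (simp_all add: terms_fun_def)

lemma terms_fun_mult:
  "terms_fun l A * terms_fun l' A = terms_fun [(c * d, xs @ ys). (c, xs) \<leftarrow> l, (d, ys) \<leftarrow> l'] A"
proof (induction l)
  case (Cons p l)
  obtain c xs where p: "p = (c, xs)" by force
  have "c * monom_fun xs A * terms_fun l' A = terms_fun [(c * d, xs @ ys). (d, ys) \<leftarrow> l'] A"
    by (induction l') (auto simp: algebra_simps monom_fun_def)
  then show ?case using Cons by (simp add: p distrib_right)
qed auto

lemma entry_polys_imp_terms:
  assumes "q \<in> entry_polys n"
  shows "\<exists>l. (\<forall>(c, xs)\<in>set l. set xs \<subseteq> {..<n} \<times> {..<n}) \<and> (\<forall>A. q A = terms_fun l A)"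
  using assms
proof induction
  case (const c)
  then show ?case by (intro exI[of _ "[(c, [])]"]) (auto simp: monom_fun_def)
next
  case (entry i j)
  then show ?case by (intro exI[of _ "[(1, [(i, j)])]"]) (auto simp: monom_fun_def)
next
  case (add f g)
  then obtain l l' where "(\<forall>(c, xs)\<in>set l. set xs \<subseteq> {..<n} \<times> {..<n}) \<and> (\<forall>A. f A = terms_fun l A)"
    "(\<forall>(c, xs)\<in>set l'. set xs \<subseteq> {..<n} \<times> {..<n}) \<and> (\<forall>A. g A = terms_fun l' A)" by blast
  then show ?case by (intro exI[of _ "l @ l'"]) auto
next
  case (mult f g)
  then obtain l l' where "(\<forall>(c, xs)\<in>set l. set xs \<subseteq> {..<n} \<times> {..<n}) \<and> (\<forall>A. f A = terms_fun l A)"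
    "(\<forall>(c, xs)\<in>set l'. set xs \<subseteq> {..<n} \<times> {..<n}) \<and> (\<forall>A. g A = terms_fun l' A)" by blast
  then show ?case
    by (intro exI[of _ "[(c * d, xs @ ys). (c, xs) \<leftarrow> l, (d, ys) \<leftarrow> l']"])
      (fastforce simp: terms_fun_mult)
qed

lemma monom_fun_entry_polys:
  "set xs \<subseteq> {..<n} \<times> {..<n} \<Longrightarrow> (monom_fun xs :: 'k::field mat \<Rightarrow> 'k) \<in> entry_polys n"
proof (induction xs)
  case Nil
  then show ?case unfolding monom_fun_def by (auto intro: entry_polys.intros)
next
  case (Cons p xs)
  obtain i j where "p = (i, j)" by force
  moreover have "monom_fun (p # xs) = (\<lambda>A :: 'k mat. A $$ p * monom_fun xs A)"
    by (auto simp: monom_fun_def)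
  moreover have "(\<lambda>A :: 'k mat. A $$ p) \<in> entry_polys n"
    using Cons calculation(1) by (auto intro: entry_polys.entry)
  moreover have "(monom_fun xs :: 'k mat \<Rightarrow> 'k) \<in> entry_polys n"
    using Cons by simp
  ultimately show ?case using entry_polys.mult by simp
qed

lemma terms_fun_entry_polys:
  "\<forall>(c, xs)\<in>set l. set xs \<subseteq> {..<n} \<times> {..<n} \<Longrightarrow> terms_fun l \<in> entry_polys n"
proof (induction l)
  case Nil
  then show ?case unfolding terms_fun_def by (auto intro: entry_polys.intros)
next
  case (Cons p l)
  obtain c xs where p: "p = (c, xs)" by force
  have "terms_fun (p # l) = (\<lambda>A. c * monom_fun xs A + terms_fun l A)"
    by (auto simp: p)
  then show ?case
    using Cons by (auto simp: p intro!: entry_polys.add entry_polys_cmult monom_fun_entry_polys)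
qed

section \<open>Elements of the symplectic group\<close>

definition opp :: "nat \<Rightarrow> nat \<Rightarrow> nat" where
  "opp m i = 2 * m - 1 - i"

definition ssgn :: "nat \<Rightarrow> nat \<Rightarrow> 'k::field" where
  "ssgn m i = (if i < m then 1 else - 1)"

text \<open>Vectors are functions of which only the first \<open>2 * m\<close> values count
  (\<open>bform_cong\<close>), so matrix columns can be paired directly and may be replaced by
  multiples of unit vectors.\<close>

definition bform :: "nat \<Rightarrow> (nat \<Rightarrow> 'k::field) \<Rightarrow> (nat \<Rightarrow> 'k) \<Rightarrow> 'k" where
  "bform m x y = (\<Sum>k<m. x k * y (opp m k) - x (opp m k) * y k)"

definition unit_fun :: "nat \<Rightarrow> nat \<Rightarrow> 'k::field" where
  "unit_fun i = (\<lambda>k. if k = i then 1 else 0)"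

lemma unit_fun_apply: "unit_fun i k = (if k = i then 1 else 0)"
  by (simp add: unit_fun_def)

abbreviation (input) mcol :: "'k mat \<Rightarrow> nat \<Rightarrow> nat \<Rightarrow> 'k" where
  "mcol A j \<equiv> (\<lambda>k. A $$ (k, j))"

lemma opp_less [simp]: "i < 2 * m \<Longrightarrow> opp m i < 2 * m"
  and opp_opp [simp]: "i < 2 * m \<Longrightarrow> opp m (opp m i) = i"
  by (auto simp: opp_def)

lemma opp_ge_iff [simp]: "i < 2 * m \<Longrightarrow> opp m i < m \<longleftrightarrow> \<not> i < m"
  by (auto simp: opp_def)

lemma opp_less_half: "i < 2 * m \<Longrightarrow> \<not> i < m \<Longrightarrow> opp m i < m"
  by simp

lemma opp_neq [simp]: "i < 2 * m \<Longrightarrow> opp m i \<noteq> i"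
  by (auto simp: opp_def) presburger

lemma opp_eq_iff: "i < 2 * m \<Longrightarrow> j < 2 * m \<Longrightarrow> opp m i = j \<longleftrightarrow> i = opp m j"
  by (auto simp: opp_def)

lemma ssgn_opp [simp]: "i < 2 * m \<Longrightarrow> ssgn m (opp m i) = - ssgn m i"
  by (auto simp: ssgn_def)

lemma ssgn_square [simp]: "ssgn m i * ssgn m i = 1"
  by (auto simp: ssgn_def)

lemma ssgn_nz [simp]: "ssgn m i \<noteq> 0"
  by (auto simp: ssgn_def)

lemma sum_opp:
  fixes f :: "nat \<Rightarrow> 'b::comm_monoid_add"
  shows "(\<Sum>k<2*m. f k) = (\<Sum>k<m. f k + f (opp m k))"
proof -
  have "{..<2*m} = {..<m} \<union> opp m ` {..<m}"
  proof -
    have "x \<in> opp m ` {..<m}" if "x < 2 * m" "\<not> x < m" for x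
      using that by (intro image_eqI[of _ _ "opp m x"]) auto
    then show ?thesis by auto
  qed
  moreover have "{..<m} \<inter> opp m ` {..<m} = {}"
    by auto
  moreover have "inj_on (opp m) {..<m}"
    by (auto simp: inj_on_def opp_def)
  ultimately show ?thesis
    by (simp add: sum.union_disjoint sum.reindex sum.distrib)
qed

lemma bform_alt: "bform m x y = (\<Sum>k<2*m. ssgn m k * x k * y (opp m k))"
  unfolding bform_def by (subst sum_opp) (auto simp: ssgn_def intro!: sum.cong)

lemma bform_cong:
  assumes "\<And>k. k < 2 * m \<Longrightarrow> x k = x' k" "\<And>k. k < 2 * m \<Longrightarrow> y k = y' k"
  shows "bform m x y = bform m x' y'"
  unfolding bform_alt using assms by (intro sum.cong) auto

lemma bform_linear:
  "bform m (\<lambda>k. x k + x' k) y = bform m x y + bform m x' y"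
  "bform m x (\<lambda>k. y k + y' k) = bform m x y + bform m x y'"
  "bform m (\<lambda>k. c * x k) y = c * bform m x y"
  "bform m x (\<lambda>k. c * y k) = c * bform m x y"
  unfolding bform_def sum_distrib_left sum.distrib[symmetric]
  by (auto intro!: sum.cong simp: algebra_simps)

lemma bform_self [simp]: "bform m x x = 0"
  by (simp add: bform_def)

lemma bform_flip: "bform m y x = - bform m x y"
  unfolding bform_def sum_negf[symmetric] by (auto intro!: sum.cong simp: algebra_simps)

lemma bform_unit_left: "a < 2 * m \<Longrightarrow> bform m (unit_fun a) y = ssgn m a * y (opp m a)"
  unfolding bform_alt unit_fun_def by (simp add: if_distrib if_distribR cong: if_cong)

lemma bform_unit_right: "a < 2 * m \<Longrightarrow> bform m y (unit_fun a) = - ssgn m a * y (opp m a)"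
  by (subst bform_flip) (simp add: bform_unit_left)

lemma symp_form_index:
  "i < 2 * m \<Longrightarrow> j < 2 * m \<Longrightarrow> symp_form m $$ (i, j) = (if j = opp m i then ssgn m i else 0)"
  by (auto simp: symp_form_def opp_def ssgn_def)

lemma symp_form_carrier [simp]: "symp_form m \<in> carrier_mat (2 * m) (2 * m)"
  by (simp add: symp_form_def)

lemma bform_unit_unit:
  "i < 2 * m \<Longrightarrow> j < 2 * m \<Longrightarrow> bform m (unit_fun i) (unit_fun j) = symp_form m $$ (i, j)"
  by (subst bform_unit_left) (auto simp: symp_form_index unit_fun_def opp_eq_iff)

lemma mult_mat_index:
  assumes "A \<in> carrier_mat n k" "B \<in> carrier_mat k l" "i < n" "j < l"
  shows "(A * B) $$ (i, j) = (\<Sum>a<k. A $$ (i, a) * B $$ (a, j))"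
  using assms by (simp add: scalar_prod_def atLeast0LessThan)

lemma symp_form_dim [simp]: "dim_row (symp_form m) = 2 * m" "dim_col (symp_form m) = 2 * m"
  by (simp_all add: symp_form_def)

lemma symp_conjugate_index:
  assumes A: "A \<in> carrier_mat (2 * m) (2 * m)" and ij: "i < 2 * m" "j < 2 * m"
  shows "(transpose_mat A * symp_form m * A) $$ (i, j) = bform m (mcol A i) (mcol A j)"
proof -
  have 1: "(transpose_mat A * symp_form m) $$ (i, l) = - ssgn m l * A $$ (opp m l, i)"
    if l: "l < 2 * m" for l
  proof -
    have "(transpose_mat A * symp_form m) $$ (i, l)
        = (\<Sum>k<2*m. transpose_mat A $$ (i, k) * symp_form m $$ (k, l))"
      using A l ij by (intro mult_mat_index) auto
    also have "\<dots> = (\<Sum>k<2*m. if k = opp m l then A $$ (k, i) * ssgn m k else 0)"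
      using A l ij by (intro sum.cong) (auto simp: symp_form_index)
    finally show ?thesis using l by simp
  qed
  have "(transpose_mat A * symp_form m * A) $$ (i, j)
      = (\<Sum>l<2*m. (transpose_mat A * symp_form m) $$ (i, l) * A $$ (l, j))"
    using A ij by (intro mult_mat_index) auto
  also have "\<dots> = - bform m (mcol A j) (mcol A i)"
    unfolding bform_alt sum_negf[symmetric] by (intro sum.cong) (auto simp: 1)
  finally show ?thesis by (subst bform_flip)
qed

section \<open>Membership and inverses in the symplectic group\<close>

lemma Sp_carrier_mat: "A \<in> carrier (Sp m) \<Longrightarrow> A \<in> carrier_mat (2 * m) (2 * m)"
  by (simp add: Sp_def)

lemma mult_Sp [simp]: "A \<otimes>\<^bsub>Sp m\<^esub> B = A * B"
  and one_Sp [simp]: "\<one>\<^bsub>Sp m\<^esub> = 1\<^sub>m (2 * m)"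
  by (simp_all add: Sp_def)

text \<open>Entry (i, j) of the conjugated Gram matrix pairs columns i and j. All explicit families
  below are recognised as symplectic by this test on pairs of columns.\<close>

lemma Sp_iff:
  "A \<in> carrier (Sp m) \<longleftrightarrow> A \<in> carrier_mat (2 * m) (2 * m) \<and>
     (\<forall>i<2*m. \<forall>j<2*m. bform m (mcol A i) (mcol A j) = symp_form m $$ (i, j))"
proof (cases "A \<in> carrier_mat (2 * m) (2 * m)")
  case True
  then have "transpose_mat A * symp_form m * A \<in> carrier_mat (2 * m) (2 * m)"
    by (intro mult_carrier_mat) auto
  then have "transpose_mat A * symp_form m * A = symp_form m \<longleftrightarrow>
    (\<forall>i<2*m. \<forall>j<2*m. (transpose_mat A * symp_form m * A) $$ (i, j) = symp_form m $$ (i, j))"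
    using symp_form_carrier by (intro iffI eq_matI) (simp, auto)
  also have "\<dots> \<longleftrightarrow> (\<forall>i<2*m. \<forall>j<2*m. bform m (mcol A i) (mcol A j) = symp_form m $$ (i, j))"
    by (simp only: symp_conjugate_index[OF True] cong: conj_cong imp_cong)
  finally show ?thesis using True by (simp add: Sp_def)
next
  case False
  then show ?thesis by (simp add: Sp_def)
qed

text \<open>The entries of \<open>J^-1 * A^T * J\<close> for the Gram matrix \<open>J\<close>. They
  are linear in those of \<open>A\<close>, so inversion is a polynomial map on the group.\<close>

definition symp_inverse :: "nat \<Rightarrow> 'k::field mat \<Rightarrow> 'k mat" where
  "symp_inverse m A = mat (2 * m) (2 * m) (\<lambda>(i, j). ssgn m i * ssgn m j * A $$ (opp m j, opp m i))"

lemma symp_inverse_carrier: "symp_inverse m A \<in> carrier_mat (2 * m) (2 * m)"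
  by (simp add: symp_inverse_def)

lemma symp_inverse_left:
  assumes "A \<in> carrier (Sp m)"
  shows "symp_inverse m A * A = 1\<^sub>m (2 * m)"
proof (rule eq_matI)
  note A = assms[unfolded Sp_iff]
  fix i j assume "i < dim_row (1\<^sub>m (2 * m) :: 'a mat)" "j < dim_col (1\<^sub>m (2 * m) :: 'a mat)"
  then have ij: "i < 2 * m" "j < 2 * m" by auto
  have "(symp_inverse m A * A) $$ (i, j) = (\<Sum>k<2*m. symp_inverse m A $$ (i, k) * A $$ (k, j))"
    using A ij symp_inverse_carrier by (intro mult_mat_index) auto
  also have "\<dots> = ssgn m i * bform m (mcol A j) (mcol A (opp m i))"
    unfolding bform_alt sum_distrib_left
    using ij by (intro sum.cong) (auto simp: symp_inverse_def)
  also have "\<dots> = 1\<^sub>m (2 * m) $$ (i, j)"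
    using A ij by (auto simp: symp_form_index opp_eq_iff)
  finally show "(symp_inverse m A * A) $$ (i, j) = 1\<^sub>m (2 * m) $$ (i, j)" .
qed (use assms in \<open>auto simp: Sp_def symp_inverse_def\<close>)

lemma Sp_mult_closed:
  assumes "A \<in> carrier (Sp m)" "B \<in> carrier (Sp m)"
  shows "A * B \<in> carrier (Sp m)"
proof -
  let ?J = "symp_form m :: 'a mat"
  have c: "A \<in> carrier_mat (2*m) (2*m)" "B \<in> carrier_mat (2*m) (2*m)" "?J \<in> carrier_mat (2*m) (2*m)"
    using assms by (auto simp: Sp_def)
  have "transpose_mat (A * B) * ?J * (A * B) = transpose_mat B * transpose_mat A * ?J * (A * B)"
    using c by (simp add: transpose_mult)
  also have "\<dots> = transpose_mat B * (transpose_mat A * ?J * A) * B"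
    using c by (simp add: assoc_mult_mat[of _ "2*m" "2*m" _ "2*m" _ "2*m"] mult_carrier_mat[of _ "2*m" "2*m" _ "2*m"])
  also have "\<dots> = ?J" using assms by (simp add: Sp_def)
  finally show ?thesis using c by (simp add: Sp_def)
qed

lemma symp_inverse_closed:
  fixes A :: "'k::field mat"
  assumes A: "A \<in> carrier (Sp m)"
  shows "symp_inverse m A \<in> carrier (Sp m)" and "A * symp_inverse m A = 1\<^sub>m (2 * m)"
proof -
  let ?J = "symp_form m :: 'k mat" and ?B = "symp_inverse m A"
  have c: "A \<in> carrier_mat (2*m) (2*m)" "?B \<in> carrier_mat (2*m) (2*m)" "?J \<in> carrier_mat (2*m) (2*m)"
    using Sp_carrier_mat[OF A] symp_inverse_carrier symp_form_carrier by blast+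
  show AB: "A * ?B = 1\<^sub>m (2 * m)"
    by (rule mat_mult_left_right_inverse[OF c(2,1) symp_inverse_left[OF A]])
  have J: "transpose_mat A * ?J * A = ?J" using A by (simp add: Sp_def)
  have "transpose_mat ?B * ?J * ?B = transpose_mat ?B * (transpose_mat A * ?J * A) * ?B"
    unfolding J ..
  also have "\<dots> = transpose_mat (A * ?B) * ?J * (A * ?B)"
    using c by (simp add: transpose_mult assoc_mult_mat[of _ "2*m" "2*m" _ "2*m" _ "2*m"]
        mult_carrier_mat[of _ "2*m" "2*m" _ "2*m"])
  also have "\<dots> = ?J"
    unfolding AB transpose_one left_mult_one_mat[OF c(3)] right_mult_one_mat[OF c(3)] ..
  finally show "?B \<in> carrier (Sp m)"
    using c by (simp add: Sp_def del: assoc_mult_mat)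
qed

lemma one_Sp_closed [simp]: "1\<^sub>m (2 * m) \<in> carrier (Sp m)"
  by (simp add: Sp_def)

lemma Sp_group: "group (Sp m)"
proof (rule groupI)
  fix x y z :: "'a mat" assume "x \<in> carrier (Sp m)" "y \<in> carrier (Sp m)" "z \<in> carrier (Sp m)"
  then show "x \<otimes>\<^bsub>Sp m\<^esub> y \<otimes>\<^bsub>Sp m\<^esub> z = x \<otimes>\<^bsub>Sp m\<^esub> (y \<otimes>\<^bsub>Sp m\<^esub> z)"
    by (simp add: Sp_def assoc_mult_mat[of _ "2*m" "2*m" _ "2*m" _ "2*m"] mult_carrier_mat[of _ "2*m" "2*m" _ "2*m"])
next
  fix x :: "'a mat" assume "x \<in> carrier (Sp m)"
  then show "\<exists>y\<in>carrier (Sp m). y \<otimes>\<^bsub>Sp m\<^esub> x = \<one>\<^bsub>Sp m\<^esub>"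
    using symp_inverse_left symp_inverse_closed by (intro bexI[of _ "symp_inverse m x"]) auto
qed (auto simp: Sp_mult_closed dest!: Sp_carrier_mat)

lemma Sp_inv: "A \<in> carrier (Sp m) \<Longrightarrow> inv\<^bsub>Sp m\<^esub> A = symp_inverse m A"
  by (intro group.inv_equality[OF Sp_group]) (auto simp: symp_inverse_left symp_inverse_closed)

lemma Sp_mult_index:
  "A \<in> carrier (Sp m) \<Longrightarrow> B \<in> carrier (Sp m) \<Longrightarrow> i < 2 * m \<Longrightarrow> j < 2 * m \<Longrightarrow>
    (A * B) $$ (i, j) = (\<Sum>k<2*m. A $$ (i, k) * B $$ (k, j))"
  by (auto intro!: mult_mat_index dest!: Sp_carrier_mat)

lemma Sp_assoc:
  "A \<in> carrier (Sp m) \<Longrightarrow> B \<in> carrier (Sp m) \<Longrightarrow> C \<in> carrier (Sp m) \<Longrightarrow> A * B * C = A * (B * C)"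
  by (intro assoc_mult_mat[of _ "2*m" "2*m" _ "2*m" _ "2*m"]) (auto dest: Sp_carrier_mat)

section \<open>The maximal torus\<close>

definition tor_entry :: "nat \<Rightarrow> (nat \<Rightarrow> 'k::field) \<Rightarrow> nat \<Rightarrow> 'k" where
  "tor_entry m t i = (if i < m then t i else inverse (t (opp m i)))"

definition torus_mat :: "nat \<Rightarrow> (nat \<Rightarrow> 'k::field) \<Rightarrow> 'k mat" where
  "torus_mat m t = mat (2 * m) (2 * m) (\<lambda>(i, j). if i = j then tor_entry m t i else 0)"

lemma SpI:
  assumes "A \<in> carrier_mat (2 * m) (2 * m)"
    and "\<And>i j. i < 2 * m \<Longrightarrow> j < 2 * m \<Longrightarrow> bform m (mcol A i) (mcol A j) = symp_form m $$ (i, j)"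
  shows "A \<in> carrier (Sp m)"
  using assms by (simp add: Sp_iff)

lemma bform_cmult_unit:
  assumes "i < 2 * m" "j < 2 * m"
  shows "bform m (\<lambda>k. c * unit_fun i k) (\<lambda>k. d * unit_fun j k) = c * d * symp_form m $$ (i, j)"
  using assms by (simp add: bform_linear bform_unit_unit)

lemma torus_mat_closed:
  assumes "\<And>i. t i \<noteq> 0"
  shows "torus_mat m t \<in> carrier (Sp m)"
proof (rule SpI)
  fix i j assume ij: "i < 2 * m" "j < 2 * m"
  have "bform m (mcol (torus_mat m t) i) (mcol (torus_mat m t) j)
      = bform m (\<lambda>k. tor_entry m t i * unit_fun i k) (\<lambda>k. tor_entry m t j * unit_fun j k)"
    using ij by (intro bform_cong) (auto simp: torus_mat_def unit_fun_def)
  also have "\<dots> = symp_form m $$ (i, j)"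
    using assms ij by (auto simp: bform_cmult_unit symp_form_index tor_entry_def)
  finally show "bform m (mcol (torus_mat m t) i) (mcol (torus_mat m t) j) = symp_form m $$ (i, j)" .
qed (simp add: torus_mat_def)

lemma torus_mat_borel: "(\<And>i. t i \<noteq> 0) \<Longrightarrow> torus_mat m t \<in> borel_Sp m"
  by (simp add: borel_Sp_def torus_mat_closed) (auto simp: torus_mat_def)

lemma torus_mat_carrier: "torus_mat m t \<in> carrier_mat (2 * m) (2 * m)"
  by (simp add: torus_mat_def)

lemma torus_mat_left:
  assumes "g \<in> carrier_mat (2 * m) (2 * m)" "i < 2 * m" "j < 2 * m"
  shows "(torus_mat m t * g) $$ (i, j) = tor_entry m t i * g $$ (i, j)"
proof -
  have "(torus_mat m t * g) $$ (i, j) = (\<Sum>k<2*m. torus_mat m t $$ (i, k) * g $$ (k, j))"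
    using assms torus_mat_carrier by (intro mult_mat_index)
  also have "\<dots> = (\<Sum>k<2*m. if k = i then tor_entry m t i * g $$ (i, j) else 0)"
    using assms by (intro sum.cong) (auto simp: torus_mat_def)
  finally show ?thesis using assms by simp
qed

lemma torus_mat_right:
  assumes "g \<in> carrier_mat (2 * m) (2 * m)" "i < 2 * m" "j < 2 * m"
  shows "(g * torus_mat m t) $$ (i, j) = g $$ (i, j) * tor_entry m t j"
proof -
  have "(g * torus_mat m t) $$ (i, j) = (\<Sum>k<2*m. g $$ (i, k) * torus_mat m t $$ (k, j))"
    using assms torus_mat_carrier by (intro mult_mat_index)
  also have "\<dots> = (\<Sum>k<2*m. if k = j then g $$ (i, j) * tor_entry m t j else 0)"
    using assms by (intro sum.cong) (auto simp: torus_mat_def)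
  finally show ?thesis using assms by simp
qed

lemma weight_char_torus_mat: "weight_char m \<mu> (torus_mat m t) = tchar m \<mu> t"
  by (auto simp: weight_char_def tchar_def torus_mat_def tor_entry_def intro!: prod.cong)

lemma tchar_nz: "(\<And>i. t i \<noteq> 0) \<Longrightarrow> tchar m \<nu> t \<noteq> 0"
  by (simp add: tchar_def power_int_eq_0_iff)

section \<open>Monomial matrices representing the Weyl group\<close>

definition signed_perm :: "nat \<Rightarrow> (nat \<Rightarrow> nat) \<Rightarrow> nat set \<Rightarrow> nat \<Rightarrow> nat" where
  "signed_perm m \<pi> P i =
    (if i < m then if i \<in> P then opp m (\<pi> i) else \<pi> i
     else if opp m i \<in> P then \<pi> (opp m i) else opp m (\<pi> (opp m i)))"

text \<open>The data \<open>\<pi>\<close>, \<open>P\<close> stand for an element of the Weyl group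
  of type C: \<open>\<pi>\<close> permutes the pairs {i, opp i}, and \<open>P\<close> marks the
  pairs that are interchanged. The bare permutation matrix may change signs of the form; this is
  repaired in the columns of the second half.\<close>

definition sperm_mat :: "nat \<Rightarrow> (nat \<Rightarrow> nat) \<Rightarrow> nat set \<Rightarrow> 'k::field mat" where
  "sperm_mat m \<pi> P = mat (2 * m) (2 * m) (\<lambda>(i, j). if i = signed_perm m \<pi> P j
     then if j < m then 1 else ssgn m (signed_perm m \<pi> P (opp m j)) else 0)"

context
  fixes m :: nat and \<pi> :: "nat \<Rightarrow> nat" and P :: "nat set"
  assumes perm: "bij_betw \<pi> {..<m} {..<m}"
begin

lemma perm_less: "i < m \<Longrightarrow> \<pi> i < m"
  using perm by (auto simp: bij_betw_def)

lemma perm_less2: "i < m \<Longrightarrow> \<pi> i < 2 * m"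
  using perm_less[of i] by simp

lemma signed_perm_less: "i < 2 * m \<Longrightarrow> signed_perm m \<pi> P i < 2 * m"
  using perm_less[of i] perm_less[of "opp m i"] by (auto simp: signed_perm_def)

lemma signed_perm_opp: "i < 2 * m \<Longrightarrow> signed_perm m \<pi> P (opp m i) = opp m (signed_perm m \<pi> P i)"
  using perm_less2[of i] perm_less2[of "opp m i"] by (auto simp: signed_perm_def)

lemma signed_perm_inj:
  assumes "i < 2 * m" "j < 2 * m" "signed_perm m \<pi> P i = signed_perm m \<pi> P j"
  shows "i = j"
proof -
  have *: "i = j" if "i < m" "signed_perm m \<pi> P i = signed_perm m \<pi> P j" "j < 2 * m" for i j
  proof -
    define j' where "j' = (if j < m then j else opp m j)"
    have j': "j' < m" using that unfolding j'_def by auto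
    have cases: "signed_perm m \<pi> P i = \<pi> i \<or> signed_perm m \<pi> P i = opp m (\<pi> i)"
      "signed_perm m \<pi> P j = \<pi> j' \<or> signed_perm m \<pi> P j = opp m (\<pi> j')"
      using that(1) by (simp_all add: signed_perm_def j'_def)
    have "\<pi> i = \<pi> j'"
      using cases that(2) perm_less[OF that(1)] perm_less[OF j'] by (auto simp: opp_def)
    then have ij: "i = j'"
      using perm that(1) j' by (auto simp: bij_betw_def inj_on_def)
    show ?thesis
    proof (cases "j < m")
      case True then show ?thesis using ij by (simp add: j'_def)
    next
      case False
      then have "j = opp m i" "i < 2 * m" using ij that by (auto simp: j'_def)
      then have "signed_perm m \<pi> P j = opp m (signed_perm m \<pi> P i)"
        using signed_perm_opp by simp
      then show ?thesis
        using that(2) signed_perm_less[OF \<open>i < 2 * m\<close>] opp_neq[of "signed_perm m \<pi> P i" m] by metis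
    qed
  qed
  consider "i < m" | "\<not> i < m" by blast
  then show ?thesis
  proof cases
    case 1 then show ?thesis using *[OF _ assms(3,2)] by simp
  next
    case 2
    have "opp m i = opp m j"
    proof (rule *)
      show "opp m i < m" using assms(1) 2 by (rule opp_less_half)
      show "opp m j < 2 * m" using assms(2) by (rule opp_less)
      show "signed_perm m \<pi> P (opp m i) = signed_perm m \<pi> P (opp m j)"
        using assms by (simp only: signed_perm_opp)
    qed
    then have "opp m (opp m i) = opp m (opp m j)" by (rule arg_cong)
    then show ?thesis unfolding opp_opp[OF assms(1)] opp_opp[OF assms(2)] .
  qed
qed

lemma sperm_mat_closed: "sperm_mat m \<pi> P \<in> carrier (Sp m)"
proof (rule SpI)
  fix i j assume ij: "i < 2 * m" "j < 2 * m"
  let ?N = "sperm_mat m \<pi> P :: 'a mat" and ?\<sigma> = "signed_perm m \<pi> P"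
  define s :: "nat \<Rightarrow> 'a" where "s j = (if j < m then 1 else ssgn m (?\<sigma> (opp m j)))" for j
  have "bform m (mcol ?N i) (mcol ?N j) = bform m (\<lambda>k. s i * unit_fun (?\<sigma> i) k) (\<lambda>k. s j * unit_fun (?\<sigma> j) k)"
    using ij by (intro bform_cong) (auto simp: sperm_mat_def unit_fun_def s_def)
  also have "\<dots> = s i * s j * symp_form m $$ (?\<sigma> i, ?\<sigma> j)"
    using ij signed_perm_less by (intro bform_cmult_unit) auto
  also have "\<dots> = symp_form m $$ (i, j)"
  proof (cases "j = opp m i")
    case True
    then show ?thesis
      using ij signed_perm_less signed_perm_opp by (auto simp: symp_form_index s_def ssgn_def[of m i])
  next
    case False
    then have "?\<sigma> j \<noteq> opp m (?\<sigma> i)"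
      using ij signed_perm_inj[of j "opp m i"] by (auto simp flip: signed_perm_opp)
    then show ?thesis using False ij signed_perm_less by (auto simp: symp_form_index)
  qed
  finally show "bform m (mcol ?N i) (mcol ?N j) = symp_form m $$ (i, j)" .
qed (simp add: sperm_mat_def)

lemma torus_mat_sperm_mat:
  "torus_mat m t * sperm_mat m \<pi> P
    = sperm_mat m \<pi> P * torus_mat m (\<lambda>i. if i \<in> P then inverse (t (\<pi> i)) else t (\<pi> i))"
  (is "?T * ?N = _ * ?T'")
proof (rule eq_matI)
  fix i j assume "i < dim_row (?N * ?T')" "j < dim_col (?N * ?T')"
  then have ij: "i < 2 * m" "j < 2 * m" by (auto simp: sperm_mat_def torus_mat_def)
  have N: "?N \<in> carrier_mat (2 * m) (2 * m)" by (simp add: sperm_mat_def)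
  have "tor_entry m t (signed_perm m \<pi> P j)
      = tor_entry m (\<lambda>i. if i \<in> P then inverse (t (\<pi> i)) else t (\<pi> i)) j"
    using ij perm_less[of j] perm_less[of "opp m j"] perm_less2[of j] perm_less2[of "opp m j"]
    by (auto simp: tor_entry_def signed_perm_def)
  then show "(?T * ?N) $$ (i, j) = (?N * ?T') $$ (i, j)"
    unfolding torus_mat_left[OF N ij] torus_mat_right[OF N ij] using ij by (simp add: sperm_mat_def)
qed (auto simp: sperm_mat_def torus_mat_def)

lemma tchar_signed_perm:
  "tchar m (\<lambda>i. if i < m then if i \<in> P then - \<nu> (\<pi> i) else \<nu> (\<pi> i) else 0)
     (\<lambda>i. if i \<in> P then inverse (t (\<pi> i)) else t (\<pi> i)) = tchar m \<nu> t"
proof -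
  have 1: "tchar m \<nu> t = (\<Prod>i<m. t (\<pi> i) powi \<nu> (\<pi> i))"
    unfolding tchar_def by (rule prod.reindex_bij_betw[OF perm, symmetric])
  have inv: "inverse a powi (- b) = a powi b" for a :: 'a and b
    by (simp only: power_int_minus power_int_inverse inverse_inverse_eq)
  have "(if i \<in> P then inverse (t (\<pi> i)) else t (\<pi> i)) powi
      (if i < m then if i \<in> P then - \<nu> (\<pi> i) else \<nu> (\<pi> i) else 0) = t (\<pi> i) powi \<nu> (\<pi> i)"
    if "i < m" for i
    by (cases "i \<in> P") (simp_all only: that if_True if_False inv)
  then have "tchar m (\<lambda>i. if i < m then if i \<in> P then - \<nu> (\<pi> i) else \<nu> (\<pi> i) else 0)
     (\<lambda>i. if i \<in> P then inverse (t (\<pi> i)) else t (\<pi> i)) = (\<Prod>i<m. t (\<pi> i) powi \<nu> (\<pi> i))"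
    unfolding tchar_def by (intro prod.cong refl) (simp only: lessThan_iff)
  then show ?thesis using 1 by simp
qed

end

section \<open>Embedding the group of smaller rank, and elementary unipotent elements\<close>

lemma sum_Suc_middle:
  fixes f :: "nat \<Rightarrow> 'b::comm_monoid_add"
  shows "(\<Sum>k<2 * Suc m. f k) = f 0 + ((\<Sum>k<2*m. f (Suc k)) + f (Suc (2 * m)))"
proof -
  have "(\<Sum>k<2 * Suc m. f k) = (\<Sum>k<Suc (Suc (2*m)). f k)" by simp
  also have "\<dots> = f 0 + (\<Sum>k<Suc (2*m). f (Suc k))" by (rule sum.lessThan_Suc_shift)
  finally show ?thesis by simp
qed

lemma index_cases:
  assumes "i < 2 * Suc m"
  obtains "i = 0" | i' where "i = Suc i'" "i' < 2 * m" | "i = Suc (2 * m)"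
  using assms by (cases i) (auto, metis Suc_lessI less_Suc_eq)

lemma opp_Suc: "k < 2 * m \<Longrightarrow> opp (Suc m) (Suc k) = Suc (opp m k)"
  "opp (Suc m) 0 = Suc (2 * m)" "opp (Suc m) (Suc (2 * m)) = 0"
  by (auto simp: opp_def)

lemma opp_neq_bound [simp]: "i < 2 * m \<Longrightarrow> opp m i \<noteq> 2 * m" "i < 2 * m \<Longrightarrow> 2 * m \<noteq> opp m i"
  by (auto simp: opp_def)

lemma bform_Suc:
  "bform (Suc m) x y = x 0 * y (Suc (2*m)) - x (Suc (2*m)) * y 0 + bform m (\<lambda>k. x (Suc k)) (\<lambda>k. y (Suc k))"
  unfolding bform_def by (subst sum.lessThan_Suc_shift) (auto simp: opp_Suc)

lemma symp_form_Suc: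
  "i < 2 * m \<Longrightarrow> j < 2 * m \<Longrightarrow> symp_form (Suc m) $$ (Suc i, Suc j) = symp_form m $$ (i, j)"
  by (simp add: symp_form_index opp_Suc ssgn_def)

lemma symp_form_edges:
  "j < 2 * Suc m \<Longrightarrow> symp_form (Suc m) $$ (0, j) = (if j = Suc (2 * m) then 1 else 0)"
  "i < 2 * Suc m \<Longrightarrow> symp_form (Suc m) $$ (i, 0) = (if i = Suc (2 * m) then - 1 else 0)"
  "j < 2 * Suc m \<Longrightarrow> symp_form (Suc m) $$ (Suc (2 * m), j) = (if j = 0 then - 1 else 0)"
  "i < 2 * Suc m \<Longrightarrow> symp_form (Suc m) $$ (i, Suc (2 * m)) = (if i = 0 then 1 else 0)"
  by (auto simp: symp_form_def)

text \<open>For symplectic \<open>h\<close> these matrices, together with a torus of rank one, make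
  up the Levi factor of the stabiliser of the first coordinate line.\<close>

definition embed :: "nat \<Rightarrow> 'k::field mat \<Rightarrow> 'k mat" where
  "embed m h = mat (2 * Suc m) (2 * Suc m) (\<lambda>(i, j).
     if 0 < i \<and> i \<le> 2 * m \<and> 0 < j \<and> j \<le> 2 * m then h $$ (i - 1, j - 1) else if i = j then 1 else 0)"

lemma embed_index [simp]:
  "i < 2 * m \<Longrightarrow> j < 2 * m \<Longrightarrow> embed m h $$ (Suc i, Suc j) = h $$ (i, j)"
  "j < 2 * Suc m \<Longrightarrow> embed m h $$ (0, j) = (if j = 0 then 1 else 0)"
  "i < 2 * Suc m \<Longrightarrow> embed m h $$ (i, 0) = (if i = 0 then 1 else 0)"
  "j < 2 * Suc m \<Longrightarrow> embed m h $$ (Suc (2 * m), j) = (if j = Suc (2 * m) then 1 else 0)"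
  "i < 2 * Suc m \<Longrightarrow> embed m h $$ (i, Suc (2 * m)) = (if i = Suc (2 * m) then 1 else 0)"
  by (auto simp: embed_def)

lemma embed_carrier: "embed m h \<in> carrier_mat (2 * Suc m) (2 * Suc m)"
  by (simp add: embed_def)

lemma embed_closed:
  assumes h: "h \<in> carrier (Sp m)"
  shows "embed m h \<in> carrier (Sp (Suc m))"
proof (rule SpI[OF embed_carrier])
  have eq: "bform m (\<lambda>k. embed m h $$ (Suc k, Suc j)) (\<lambda>k. embed m h $$ (Suc k, Suc i))
      = bform m (mcol h j) (mcol h i)" if "i < 2 * m" "j < 2 * m" for i j
    using that by (intro bform_cong) auto
  have z0: "embed m h $$ (Suc (opp m k), 0) = 0" "embed m h $$ (Suc (opp m k), Suc (2*m)) = 0"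
    if "k < 2 * m" for k
    using opp_less[OF that] by auto
  have z: "bform m (\<lambda>k. embed m h $$ (Suc k, 0)) y = 0" "bform m x (\<lambda>k. embed m h $$ (Suc k, 0)) = 0"
    "bform m (\<lambda>k. embed m h $$ (Suc k, Suc (2*m))) y = 0"
    "bform m x (\<lambda>k. embed m h $$ (Suc k, Suc (2*m))) = 0" for x y
    by (auto simp: bform_alt z0)
  fix i j assume i: "i < 2 * Suc m" and j: "j < 2 * Suc m"
  have iso: "bform m (mcol h i) (mcol h j) = symp_form m $$ (i, j)" if "i < 2 * m" "j < 2 * m" for i j
    using h that by (simp add: Sp_iff)
  from i show "bform (Suc m) (mcol (embed m h) i) (mcol (embed m h) j) = symp_form (Suc m) $$ (i, j)"
    by (cases rule: index_cases; use j in \<open>cases rule: index_cases\<close>)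
      (simp_all add: bform_Suc z eq iso symp_form_Suc symp_form_edges)
qed

lemma embed_mult:
  assumes "g \<in> carrier (Sp m)" "h \<in> carrier (Sp m)"
  shows "embed m (g * h) = embed m g * embed m h"
proof (rule eq_matI)
  fix i j assume "i < dim_row (embed m g * embed m h)" "j < dim_col (embed m g * embed m h)"
  then have i: "i < 2 * Suc m" and j: "j < 2 * Suc m" by (auto simp: embed_def)
  have eq: "(embed m g * embed m h) $$ (i, j)
      = embed m g $$ (i, 0) * embed m h $$ (0, j)
        + ((\<Sum>k<2*m. embed m g $$ (i, Suc k) * embed m h $$ (Suc k, j))
        + embed m g $$ (i, Suc (2 * m)) * embed m h $$ (Suc (2 * m), j))"
    using mult_mat_index[OF embed_carrier embed_carrier i j] by (simp only: sum_Suc_middle)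
  from i show "embed m (g * h) $$ (i, j) = (embed m g * embed m h) $$ (i, j)"
    unfolding eq
    by (cases rule: index_cases; use j in \<open>cases rule: index_cases\<close>)
      (use assms in \<open>auto simp: Sp_mult_index\<close>)
qed (auto simp: embed_def)

lemma embed_one: "embed m (1\<^sub>m (2 * m)) = 1\<^sub>m (2 * Suc m)"
proof (rule eq_matI)
  fix i j assume "i < dim_row (1\<^sub>m (2 * Suc m) :: 'a mat)" "j < dim_col (1\<^sub>m (2 * Suc m) :: 'a mat)"
  then show "embed m (1\<^sub>m (2 * m)) $$ (i, j) = (1\<^sub>m (2 * Suc m) :: 'a mat) $$ (i, j)"
    by (auto simp: embed_def)
qed (auto simp: embed_def)

text \<open>The element of the unipotent radical of the stabiliser of the last coordinate line which
  sends the first basis vector to \<open>y\<close>, where \<open>y 0 = 1\<close>.\<close>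

definition col_unip :: "nat \<Rightarrow> (nat \<Rightarrow> 'k::field) \<Rightarrow> 'k mat" where
  "col_unip m y = mat (2 * Suc m) (2 * Suc m) (\<lambda>(i, j).
     if j = 0 then y i
     else if i = Suc (2 * m) then if j = Suc (2 * m) then 1 else ssgn (Suc m) j * y (opp (Suc m) j)
     else if i = j then 1 else 0)"

lemma col_unip_index:
  "i < 2 * Suc m \<Longrightarrow> col_unip m y $$ (i, 0) = y i"
  "i < 2 * m \<Longrightarrow> j < 2 * m \<Longrightarrow> col_unip m y $$ (Suc i, Suc j) = (if i = j then 1 else 0)"
  "j < 2 * Suc m \<Longrightarrow> col_unip m y $$ (0, j) = (if j = 0 then y 0 else 0)"
  "i < 2 * Suc m \<Longrightarrow> col_unip m y $$ (i, Suc (2 * m)) = (if i = Suc (2 * m) then 1 else 0)"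
  "j < 2 * m \<Longrightarrow> col_unip m y $$ (Suc (2*m), Suc j) = ssgn m j * y (Suc (opp m j))"
  by (auto simp: col_unip_def opp_Suc ssgn_def)

lemma col_unip_carrier: "col_unip m y \<in> carrier_mat (2 * Suc m) (2 * Suc m)"
  by (simp add: col_unip_def)

lemma col_unip_closed:
  assumes "y 0 = 1"
  shows "col_unip m y \<in> carrier (Sp (Suc m))"
proof (rule SpI[OF col_unip_carrier])
  let ?u = "col_unip m y"
  have cong: "bform m (\<lambda>k. ?u $$ (Suc k, Suc i)) x = bform m (unit_fun i) x"
    "bform m x (\<lambda>k. ?u $$ (Suc k, Suc i)) = bform m x (unit_fun i)" if "i < 2 * m" for i x
    using that by (auto intro!: bform_cong simp: col_unip_index unit_fun_def)
  have z0: "?u $$ (Suc (opp m k), Suc (2*m)) = 0" if "k < 2 * m" for k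
    using opp_less[OF that] by (auto simp: col_unip_index)
  have last: "bform m (\<lambda>k. ?u $$ (Suc k, Suc (2*m))) x = 0"
    "bform m x (\<lambda>k. ?u $$ (Suc k, Suc (2*m))) = 0" for x
    by (auto simp: bform_alt col_unip_index z0)
  have first: "bform m (\<lambda>k. ?u $$ (Suc k, 0)) x = bform m (\<lambda>k. y (Suc k)) x"
    "bform m x (\<lambda>k. ?u $$ (Suc k, 0)) = bform m x (\<lambda>k. y (Suc k))" for x
    by (auto intro!: bform_cong simp: col_unip_index)
  fix i j assume i: "i < 2 * Suc m" and j: "j < 2 * Suc m"
  from i show "bform (Suc m) (mcol ?u i) (mcol ?u j) = symp_form (Suc m) $$ (i, j)"
    by (cases rule: index_cases; use j in \<open>cases rule: index_cases\<close>)
      (simp_all add: assms bform_Suc cong last first col_unip_index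
          bform_unit_left bform_unit_right symp_form_index opp_Suc ssgn_def unit_fun_apply
          eq_commute[of "opp m _"])
qed

text \<open>The symplectic transvection x \<mapsto> x + s B(x, v) v. Its entries are linear in
  \<open>s\<close>, so for fixed \<open>v\<close> it is a curve through the identity on which
  regular functions become polynomials in \<open>s\<close>.\<close>

definition transvection :: "nat \<Rightarrow> 'k::field \<Rightarrow> (nat \<Rightarrow> 'k) \<Rightarrow> 'k mat" where
  "transvection m s v = mat (2 * m) (2 * m)
     (\<lambda>(i, j). unit_fun j i + s * (bform m (unit_fun j) v * v i))"

lemma transvection_carrier: "transvection m s v \<in> carrier_mat (2 * m) (2 * m)"
  by (simp add: transvection_def)

lemma transvection_closed: "transvection m s v \<in> carrier (Sp m)"
proof (rule SpI[OF transvection_carrier])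
  fix i j assume ij: "i < 2 * m" "j < 2 * m"
  have "bform m (mcol (transvection m s v) i) (mcol (transvection m s v) j)
    = bform m (\<lambda>k. unit_fun i k + s * (bform m (unit_fun i) v * v k))
              (\<lambda>k. unit_fun j k + s * (bform m (unit_fun j) v * v k))"
    using ij by (intro bform_cong) (auto simp: transvection_def)
  also have "\<dots> = symp_form m $$ (i, j)"
    using ij bform_flip[of m v "unit_fun j"] by (simp add: bform_linear bform_unit_unit)
  finally show "bform m (mcol (transvection m s v) i) (mcol (transvection m s v) j)
    = symp_form m $$ (i, j)" .
qed

lemma transvection_mult_index:
  assumes g: "g \<in> carrier (Sp m)" and ij: "i < 2 * m" "j < 2 * m"
  shows "(transvection m s v * g) $$ (i, j) = g $$ (i, j) + s * (v i * bform m (mcol g j) v)"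
proof -
  have "(transvection m s v * g) $$ (i, j)
      = (\<Sum>k<2*m. (if k = i then g $$ (k, j) else 0) + s * v i * (ssgn m k * g $$ (k, j) * v (opp m k)))"
    unfolding Sp_mult_index[OF transvection_closed g ij] using ij
    by (intro sum.cong)
      (auto simp: transvection_def bform_unit_left algebra_simps, auto simp: unit_fun_def)
  then show ?thesis
    using ij by (simp add: sum.distrib bform_alt sum_distrib_left mult.assoc)
qed

section \<open>Semi-invariant functions and the big cell\<close>

text \<open>The condition defining the induced module, without the extension by zero outside the
  group. Translates and restrictions then need no truncation.\<close>

definition semi_inv :: "nat \<Rightarrow> (nat \<Rightarrow> int) \<Rightarrow> ('k::field mat \<Rightarrow> 'k) \<Rightarrow> bool" where
  "semi_inv m \<mu> f \<longleftrightarrow> (\<exists>q \<in> entry_polys (2 * m). \<forall>g \<in> carrier (Sp m). f g = q g) \<and>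
     (\<forall>g \<in> carrier (Sp m). \<forall>b \<in> borel_Sp m. f (g * b) = weight_char m \<mu> b * f g)"

lemma semi_inv_poly: "semi_inv m \<mu> f \<Longrightarrow> \<exists>q \<in> entry_polys (2 * m). \<forall>g \<in> carrier (Sp m). f g = q g"
  and semi_inv_borel: "semi_inv m \<mu> f \<Longrightarrow> g \<in> carrier (Sp m) \<Longrightarrow> b \<in> borel_Sp m \<Longrightarrow>
    f (g * b) = weight_char m \<mu> b * f g"
  by (simp_all add: semi_inv_def)

lemma entry_poly_left_translate:
  assumes q: "q \<in> entry_polys (2 * m)" and a: "a \<in> carrier (Sp m)"
  shows "\<exists>q'\<in>entry_polys (2 * m). \<forall>g\<in>carrier (Sp m). q (a * g) = q' g"
  using q
proof (rule entry_polys_subst_entry_polys)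
  fix i j assume ij: "i < 2 * m" "j < 2 * m"
  show "\<exists>p\<in>entry_polys (2 * m). \<forall>g\<in>carrier (Sp m). (a * g) $$ (i, j) = p g"
  proof (rule bexI)
    show "\<forall>g\<in>carrier (Sp m). (a * g) $$ (i, j) = (\<Sum>k<2*m. a $$ (i, k) * g $$ (k, j))"
      by (intro ballI Sp_mult_index[OF a _ ij])
    show "(\<lambda>g. \<Sum>k<2*m. a $$ (i, k) * g $$ (k, j)) \<in> entry_polys (2 * m)"
      using ij by (intro entry_polys_sum entry_polys_cmult entry_polys.entry) simp_all
  qed
qed

lemma semi_inv_translate:
  assumes f: "semi_inv m \<mu> f" and a: "a \<in> carrier (Sp m)"
  shows "semi_inv m \<mu> (\<lambda>g. f (a * g))"
  unfolding semi_inv_def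
proof
  obtain q where q: "q \<in> entry_polys (2 * m)" "\<forall>g\<in>carrier (Sp m). f g = q g"
    using semi_inv_poly[OF f] by blast
  obtain q' where q': "q' \<in> entry_polys (2 * m)" "\<forall>g\<in>carrier (Sp m). q (a * g) = q' g"
    using entry_poly_left_translate[OF q(1) a] by blast
  have "\<forall>g\<in>carrier (Sp m). f (a * g) = q' g"
    using q(2) q'(2) Sp_mult_closed[OF a] by simp
  then show "\<exists>q\<in>entry_polys (2 * m). \<forall>g\<in>carrier (Sp m). f (a * g) = q g"
    using q'(1) by (intro bexI)
  show "\<forall>g\<in>carrier (Sp m). \<forall>b\<in>borel_Sp m. f (a * (g * b)) = weight_char m \<mu> b * f (a * g)"
  proof (intro ballI)
    fix g b :: "'a mat" assume g: "g \<in> carrier (Sp m)" and b: "b \<in> borel_Sp m"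
    have "b \<in> carrier (Sp m)" using b by (simp add: borel_Sp_def)
    then have "f (a * (g * b)) = f (a * g * b)" by (simp only: Sp_assoc[OF a g])
    then show "f (a * (g * b)) = weight_char m \<mu> b * f (a * g)"
      by (simp only: semi_inv_borel[OF f Sp_mult_closed[OF a g] b])
  qed
qed

lemma mult_embed_index:
  assumes u: "u \<in> carrier_mat (2 * Suc m) (2 * Suc m)" and i: "i < 2 * Suc m"
  shows "(u * embed m h) $$ (i, 0) = u $$ (i, 0)"
    and "j < 2 * m \<Longrightarrow> (u * embed m h) $$ (i, Suc j) = (\<Sum>k<2*m. u $$ (i, Suc k) * h $$ (k, j))"
    and "(u * embed m h) $$ (i, Suc (2 * m)) = u $$ (i, Suc (2 * m))"
proof -
  have eq: "(u * embed m h) $$ (i, j)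
      = u $$ (i, 0) * embed m h $$ (0, j)
        + ((\<Sum>k<2*m. u $$ (i, Suc k) * embed m h $$ (Suc k, j))
        + u $$ (i, Suc (2 * m)) * embed m h $$ (Suc (2 * m), j))" if j: "j < 2 * Suc m" for j
    using mult_mat_index[OF u embed_carrier i j] by (simp only: sum_Suc_middle)
  show "(u * embed m h) $$ (i, 0) = u $$ (i, 0)"
    by (subst eq) simp_all
  show "(u * embed m h) $$ (i, Suc (2 * m)) = u $$ (i, Suc (2 * m))"
    by (subst eq) simp_all
  show "(u * embed m h) $$ (i, Suc j) = (\<Sum>k<2*m. u $$ (i, Suc k) * h $$ (k, j))" if "j < 2 * m"
    using that by (subst eq) simp_all
qed

lemma embed_borel:
  assumes "b \<in> borel_Sp m"
  shows "embed m b \<in> borel_Sp (Suc m)"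
    and "weight_char (Suc m) \<mu> (embed m b) = weight_char m (\<lambda>i. \<mu> (Suc i)) b"
proof -
  have b: "b \<in> carrier (Sp m)" "\<And>i j. i < 2 * m \<Longrightarrow> j < i \<Longrightarrow> b $$ (i, j) = 0"
    using assms Sp_carrier_mat[of b m] by (auto simp: borel_Sp_def upper_triangular_def)
  have "embed m b $$ (i, j) = 0" if "i < 2 * Suc m" "j < i" for i j
    using that b(2)[of "i - 1" "j - 1"] by (auto simp: embed_def)
  then show "embed m b \<in> borel_Sp (Suc m)"
    using embed_closed[OF b(1)] by (auto simp: borel_Sp_def upper_triangular_def embed_def)
  show "weight_char (Suc m) \<mu> (embed m b) = weight_char m (\<lambda>i. \<mu> (Suc i)) b"
    unfolding weight_char_def by (subst prod.lessThan_Suc_shift) simp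
qed

text \<open>The embedded Borel subgroup lies in the larger one, and its first diagonal entry is 1,
  so the weight just loses its first coordinate. This makes induction on the rank possible.\<close>

lemma semi_inv_embed:
  assumes f: "semi_inv (Suc m) \<mu> f" and u: "u \<in> carrier (Sp (Suc m))"
  shows "semi_inv m (\<lambda>i. \<mu> (Suc i)) (\<lambda>h. f (u * embed m h))"
  unfolding semi_inv_def
proof
  note uc = Sp_carrier_mat[OF u]
  obtain q where q: "q \<in> entry_polys (2 * Suc m)" "\<forall>g\<in>carrier (Sp (Suc m)). f g = q g"
    using semi_inv_poly[OF f] by blast
  have "\<exists>q'\<in>entry_polys (2 * m). \<forall>h\<in>carrier (Sp m). q (u * embed m h) = q' h"
    using q(1)
  proof (rule entry_polys_subst_entry_polys)
    fix i j assume i: "i < 2 * Suc m" and j: "j < 2 * Suc m"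
    from j show "\<exists>p\<in>entry_polys (2 * m). \<forall>h\<in>carrier (Sp m). (u * embed m h) $$ (i, j) = p h"
    proof (cases rule: index_cases)
      case 1
      then show ?thesis
        by (intro bexI[OF _ entry_polys.const[of "u $$ (i, 0)"]]) (simp add: mult_embed_index[OF uc i])
    next
      case (2 j')
      have "(\<lambda>h. \<Sum>k<2*m. u $$ (i, Suc k) * h $$ (k, j')) \<in> entry_polys (2 * m)"
        using 2 by (intro entry_polys_sum entry_polys_cmult entry_polys.entry) simp_all
      then show ?thesis
        by (rule bexI[rotated]) (simp add: mult_embed_index[OF uc i] 2)
    next
      case 3
      then show ?thesis
        by (intro bexI[OF _ entry_polys.const[of "u $$ (i, Suc (2*m))"]])
          (simp add: mult_embed_index[OF uc i])
    qed
  qed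
  then obtain q' where q': "q' \<in> entry_polys (2 * m)" "\<forall>h\<in>carrier (Sp m). q (u * embed m h) = q' h"
    by blast
  have "\<forall>h\<in>carrier (Sp m). f (u * embed m h) = q' h"
    using q(2) q'(2) Sp_mult_closed[OF u embed_closed] by simp
  then show "\<exists>q\<in>entry_polys (2 * m). \<forall>h\<in>carrier (Sp m). f (u * embed m h) = q h"
    using q'(1) by (intro bexI)
  show "\<forall>g\<in>carrier (Sp m). \<forall>b\<in>borel_Sp m.
      f (u * embed m (g * b)) = weight_char m (\<lambda>i. \<mu> (Suc i)) b * f (u * embed m g)"
  proof (intro ballI)
    fix g b :: "'a mat" assume g: "g \<in> carrier (Sp m)" and b: "b \<in> borel_Sp m"
    then have bS: "b \<in> carrier (Sp m)" by (simp add: borel_Sp_def)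
    have "u * embed m (g * b) = u * embed m g * embed m b"
      by (simp only: embed_mult[OF g bS] Sp_assoc[OF u embed_closed[OF g] embed_closed[OF bS]])
    then show "f (u * embed m (g * b)) = weight_char m (\<lambda>i. \<mu> (Suc i)) b * f (u * embed m g)"
      using semi_inv_borel[OF f Sp_mult_closed[OF u embed_closed[OF g]] embed_borel(1)[OF b]]
      by (simp only: embed_borel(2)[OF b])
  qed
qed

text \<open>If \<open>g\<close> is symplectic with upper left entry 1, clearing its first column with
  \<^const>\<open>col_unip\<close> also clears its last row, and leaves an embedded element times an element
  of the Borel subgroup.\<close>

lemma pivot_decomposition:
  fixes g :: "'k::field mat"
  assumes g: "g \<in> carrier (Sp (Suc m))" and g0: "g $$ (0, 0) = 1"
  obtains y h b where "y 0 = 1" "h \<in> carrier (Sp m)" "b \<in> borel_Sp (Suc m)"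
    "g = col_unip m y * embed m h * b"
proof -
  define y where "y = mcol g 0"
  define u where "u = col_unip m y"
  define p where "p = symp_inverse (Suc m) u * g"
  have y0: "y 0 = 1" by (simp add: y_def g0)
  have u: "u \<in> carrier (Sp (Suc m))" unfolding u_def using y0 by (rule col_unip_closed)
  note ui = symp_inverse_closed(1)[OF u]
  have p: "p \<in> carrier (Sp (Suc m))" unfolding p_def using ui g by (rule Sp_mult_closed)
  have up: "u * p = g"
    unfolding p_def Sp_assoc[OF u ui g, symmetric] symp_inverse_closed(2)[OF u]
    using Sp_carrier_mat[OF g] by (rule left_mult_one_mat)
  have pcol: "p $$ (i, 0) = (if i = 0 then 1 else 0)" if i: "i < 2 * Suc m" for i
  proof -
    have "p $$ (i, 0) = (\<Sum>k<2 * Suc m. symp_inverse (Suc m) u $$ (i, k) * g $$ (k, 0))"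
      unfolding p_def by (rule Sp_mult_index[OF ui g i]) simp
    also have "\<dots> = (\<Sum>k<2 * Suc m. symp_inverse (Suc m) u $$ (i, k) * u $$ (k, 0))"
      by (intro sum.cong refl) (simp add: u_def col_unip_index y_def)
    also have "\<dots> = (symp_inverse (Suc m) u * u) $$ (i, 0)"
      by (rule Sp_mult_index[OF ui u i, symmetric]) simp
    finally show ?thesis using i by (simp add: symp_inverse_left[OF u])
  qed
  have iso: "bform (Suc m) (mcol p i) (mcol p j) = symp_form (Suc m) $$ (i, j)"
    if "i < 2 * Suc m" "j < 2 * Suc m" for i j
    using p that unfolding Sp_iff by blast
  \<comment> \<open>The first column of \<open>p\<close> is the first unit vector, and pairing it
    with column \<open>j\<close> reads off the last entry of that column.\<close>
  have prow: "p $$ (Suc (2 * m), j) = (if j = Suc (2 * m) then 1 else 0)" if j: "j < 2 * Suc m" for j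
  proof -
    have "bform (Suc m) (mcol p 0) (mcol p j) = bform (Suc m) (unit_fun 0) (mcol p j)"
      by (intro bform_cong) (simp_all add: pcol unit_fun_apply)
    also have "\<dots> = p $$ (Suc (2 * m), j)"
      by (simp add: bform_unit_left ssgn_def opp_Suc)
    finally show ?thesis
      using iso[OF _ j, of 0] symp_form_edges(1)[OF j] by (metis zero_less_Suc mult_pos_pos zero_less_numeral)
  qed
  define h where "h = mat (2 * m) (2 * m) (\<lambda>(i, j). p $$ (Suc i, Suc j))"
  have hi: "h $$ (i, j) = p $$ (Suc i, Suc j)" if "i < 2 * m" "j < 2 * m" for i j
    using that by (simp add: h_def)
  have h: "h \<in> carrier (Sp m)"
  proof (rule SpI)
    fix i j assume ij: "i < 2 * m" "j < 2 * m"
    have "bform m (mcol h i) (mcol h j) = bform m (\<lambda>k. p $$ (Suc k, Suc i)) (\<lambda>k. p $$ (Suc k, Suc j))"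
      using ij by (intro bform_cong) (simp_all add: hi)
    also have "\<dots> = bform (Suc m) (mcol p (Suc i)) (mcol p (Suc j))"
      using ij by (simp add: bform_Suc prow)
    also have "\<dots> = symp_form m $$ (i, j)"
      using ij by (simp add: iso symp_form_Suc)
    finally show "bform m (mcol h i) (mcol h j) = symp_form m $$ (i, j)" .
  qed (simp add: h_def)
  note hinv = symp_inverse_closed[OF h]
  note eh = embed_closed[OF h] and ehi = embed_closed[OF hinv(1)]
  \<comment> \<open>Its first column, last row and middle block are those of the identity, so
    \<open>b\<close> is upper triangular.\<close>
  define b where "b = embed m (symp_inverse m h) * p"
  have b: "b \<in> carrier (Sp (Suc m))" unfolding b_def using ehi p by (rule Sp_mult_closed)
  have "embed m h * b = embed m h * embed m (symp_inverse m h) * p"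
    unfolding b_def by (simp only: Sp_assoc[OF eh ehi p])
  also have "\<dots> = p"
    unfolding embed_mult[OF h hinv(1), symmetric] hinv(2) embed_one
    using Sp_carrier_mat[OF p] by (rule left_mult_one_mat)
  finally have hb: "embed m h * b = p" .
  have bi: "b $$ (i, j) = embed m (symp_inverse m h) $$ (i, 0) * p $$ (0, j)
      + ((\<Sum>k<2*m. embed m (symp_inverse m h) $$ (i, Suc k) * p $$ (Suc k, j))
      + embed m (symp_inverse m h) $$ (i, Suc (2 * m)) * p $$ (Suc (2 * m), j))"
    if "i < 2 * Suc m" "j < 2 * Suc m" for i j
    unfolding b_def Sp_mult_index[OF ehi p that] by (rule sum_Suc_middle)
  have "b $$ (i, j) = 0" if i: "i < 2 * Suc m" and ji: "j < i" for i j
  proof -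
    have j: "j < 2 * Suc m" using i ji by simp
    from i show ?thesis
    proof (cases rule: index_cases)
      case 1
      then show ?thesis using ji by simp
    next
      case (2 i')
      have bi': "b $$ (i, j) = (\<Sum>k<2*m. symp_inverse m h $$ (i', k) * p $$ (Suc k, j))"
        unfolding bi[OF i j] using 2 by simp
      show ?thesis
      proof (cases j)
        case 0
        then show ?thesis unfolding bi' by (simp add: pcol)
      next
        case (Suc j')
        have j': "j' < 2 * m" using Suc 2 ji by simp
        have "b $$ (i, j) = (\<Sum>k<2*m. symp_inverse m h $$ (i', k) * h $$ (k, j'))"
          unfolding bi' by (intro sum.cong refl) (use j' in \<open>simp add: hi Suc\<close>)
        also have "\<dots> = (symp_inverse m h * h) $$ (i', j')"
          by (rule Sp_mult_index[OF hinv(1) h 2(2) j', symmetric])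
        finally show ?thesis using 2 j' ji Suc by (simp add: symp_inverse_left[OF h])
      qed
    next
      case 3
      then show ?thesis unfolding bi[OF i j] using ji by (simp add: prow)
    qed
  qed
  then have "b \<in> borel_Sp (Suc m)"
    using b Sp_carrier_mat[OF b] by (simp add: borel_Sp_def upper_triangular_def)
  moreover have "g = col_unip m y * embed m h * b"
    unfolding u_def[symmetric] Sp_assoc[OF u eh b] hb up ..
  ultimately show ?thesis using that y0 h by blast
qed

text \<open>A nonzero pivot \<open>g $$ (0, 0)\<close> is scaled to 1 by the torus, and then the
  pivot decomposition applies. An element with pivot 0 lies on a curve of transvects whose other
  members have nonzero pivot, so \<open>f\<close> vanishes there too by continuation of a polynomial
  identity.\<close>

lemma semi_inv_eq_zero_step:
  fixes f :: "'k::field mat \<Rightarrow> 'k"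
  assumes inf: "infinite (UNIV :: 'k set)" and f: "semi_inv (Suc m) \<mu> f"
    and zero: "\<And>y h. y 0 = 1 \<Longrightarrow> h \<in> carrier (Sp m) \<Longrightarrow> f (col_unip m y * embed m h) = 0"
    and g: "g \<in> carrier (Sp (Suc m))"
  shows "f g = 0"
proof -
  have one: "f g = 0" if g: "g \<in> carrier (Sp (Suc m))" "g $$ (0, 0) = 1" for g
  proof -
    obtain y h b where *: "y 0 = 1" "h \<in> carrier (Sp m)" "b \<in> borel_Sp (Suc m)"
      "g = col_unip m y * embed m h * b"
      using pivot_decomposition[OF g] by blast
    have "f g = weight_char (Suc m) \<mu> b * f (col_unip m y * embed m h)"
      unfolding *(4)
      by (rule semi_inv_borel[OF f Sp_mult_closed[OF col_unip_closed[where y = y, OF *(1)] embed_closed[OF *(2)]] *(3)])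
    then show ?thesis using zero[where y = y, OF *(1,2)] by simp
  qed
  have nonzero: "f g = 0" if g: "g \<in> carrier (Sp (Suc m))" and nz: "g $$ (0, 0) \<noteq> 0" for g
  proof -
    define t where "t i = (if i = 0 then inverse (g $$ (0, 0)) else 1)" for i :: nat
    have t: "\<And>i. t i \<noteq> 0" using nz by (simp add: t_def)
    have "(g * torus_mat (Suc m) t) $$ (0, 0) = 1"
      using torus_mat_right[OF Sp_carrier_mat[OF g], of 0 0 t] nz by (simp add: tor_entry_def t_def)
    then have "f (g * torus_mat (Suc m) t) = 0"
      by (rule one[OF Sp_mult_closed[OF g torus_mat_closed[OF t]]])
    then have "tchar (Suc m) \<mu> t * f g = 0"
      by (simp only: semi_inv_borel[OF f g torus_mat_borel[OF t]] weight_char_torus_mat)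
    then show ?thesis using tchar_nz[OF t] by simp
  qed
  show ?thesis
  proof (cases "g $$ (0, 0) = 0")
    case True
    define y where "y = mcol g 0"
    have "\<exists>k<2 * Suc m. y k \<noteq> 0"
    proof (rule ccontr)
      assume "\<not> ?thesis"
      then have "bform (Suc m) (mcol g 0) (mcol g (Suc (2*m))) = 0"
        unfolding bform_alt by (intro sum.neutral) (simp add: y_def)
      moreover have "bform (Suc m) (mcol g 0) (mcol g (Suc (2*m))) = symp_form (Suc m) $$ (0, Suc (2*m))"
        using g unfolding Sp_iff by simp
      ultimately show False by (simp add: symp_form_edges)
    qed
    then obtain k where k: "k < 2 * Suc m" "y k \<noteq> 0" by blast
    \<comment> \<open>For such \<open>v\<close> the pivot of the transvected element is
      \<open>s * bform (Suc m) y v\<close>, which is nonzero whenever \<open>s\<close> is. The first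
      unit vector works if the last entry of \<open>y\<close> is nonzero; otherwise a second unit
      vector, dual to a nonzero entry of \<open>y\<close>, is added.\<close>
    have "\<exists>v. v 0 = 1 \<and> bform (Suc m) y v \<noteq> 0"
    proof (cases "y (Suc (2 * m)) = 0")
      case False
      then show ?thesis
        by (intro exI[of _ "unit_fun 0"]) (simp add: unit_fun_apply bform_unit_right opp_Suc)
    next
      case y: True
      have k': "opp (Suc m) k < 2 * Suc m" using k(1) by (rule opp_less)
      have "k \<noteq> Suc (2 * m)" using k(2) y by (intro notI) simp
      then have "opp (Suc m) k \<noteq> 0" using k(1) by (simp add: opp_def)
      moreover have "bform (Suc m) y (\<lambda>i. unit_fun 0 i + unit_fun (opp (Suc m) k) i)
          = - ssgn (Suc m) (opp (Suc m) k) * y k"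
        using k k' y by (simp add: bform_linear bform_unit_right opp_Suc)
      ultimately show ?thesis using k
        by (intro exI[of _ "\<lambda>i. unit_fun 0 i + unit_fun (opp (Suc m) k) i"]) (simp add: unit_fun_apply)
    qed
    then obtain v where v: "v 0 = 1" "bform (Suc m) y v \<noteq> 0" by blast
    have T: "f (transvection (Suc m) s v * g) = 0" if s: "s \<noteq> 0" for s
    proof (rule nonzero[OF Sp_mult_closed[OF transvection_closed g]])
      show "(transvection (Suc m) s v * g) $$ (0, 0) \<noteq> 0"
        using transvection_mult_index[OF g, of 0 0 s v] s v True by (simp add: y_def)
    qed
    obtain q where q: "q \<in> entry_polys (2 * Suc m)" "\<forall>g\<in>carrier (Sp (Suc m)). f g = q g"
      using semi_inv_poly[OF f] by blast
    have "\<exists>P. \<forall>s. q (transvection (Suc m) s v * g) = poly P s"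
    proof (rule entry_polys_subst_poly[OF q(1)])
      fix i j assume "i < 2 * Suc m" "j < 2 * Suc m"
      then show "\<exists>p. \<forall>s. (transvection (Suc m) s v * g) $$ (i, j) = poly p s"
        using transvection_mult_index[OF g]
        by (intro exI[of _ "[:g $$ (i, j), v i * bform (Suc m) (mcol g j) v:]"]) simp
    qed
    then obtain P where P: "\<And>s. q (transvection (Suc m) s v * g) = poly P s" by blast
    have fP: "f (transvection (Suc m) s v * g) = poly P s" for s
      using q(2) Sp_mult_closed[OF transvection_closed g] P by simp
    \<comment> \<open>Along the curve \<open>f\<close> is a polynomial in \<open>s\<close> that
      vanishes off 0; the field is infinite, so it vanishes at 0 as well.\<close>
    have "UNIV - {0} \<subseteq> {s. poly P s = 0}"
      using T by (auto simp: fP)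
    moreover have "infinite (UNIV - {0 :: 'k})" using inf by simp
    ultimately have "P = 0"
      using poly_roots_finite finite_subset by blast
    moreover have "transvection (Suc m) 0 v * g = g"
      using Sp_carrier_mat[OF g] transvection_carrier[of "Suc m" 0 v]
      by (intro eq_matI) (auto simp: transvection_mult_index[OF g] simp del: index_mult_mat(1))
    ultimately show ?thesis using fP[of 0] by simp
  next
    case False
    then show ?thesis by (rule nonzero[OF g])
  qed
qed

text \<open>The unipotent radical of a parabolic subgroup containing the lower triangular matrices,
  with Levi factor a torus of rank \<open>r\<close> times the group of rank \<open>m - r\<close>.
  For \<open>r = m\<close> the middle block is empty and all lower unitriangular elements are
  allowed.\<close>

definition unip :: "nat \<Rightarrow> nat \<Rightarrow> 'k::field mat set" where
  "unip m r = {u \<in> carrier (Sp m). (\<forall>i<2*m. u $$ (i, i) = 1) \<and> (\<forall>i<2*m. \<forall>j<2*m. i < j \<longrightarrow> u $$ (i, j) = 0) \<and>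
     (\<forall>i<2*m-r. \<forall>j<2*m-r. r \<le> i \<longrightarrow> r \<le> j \<longrightarrow> i \<noteq> j \<longrightarrow> u $$ (i, j) = 0)}"

lemma unip_step:
  assumes y: "y 0 = 1" and u: "u \<in> unip m r"
  shows "col_unip m y * embed m u \<in> unip (Suc m) (Suc r)"
proof -
  have uS: "u \<in> carrier (Sp m)" using u by (simp add: unip_def)
  let ?g = "col_unip m y * embed m u"
  have col0: "?g $$ (i, 0) = y i" if "i < 2 * Suc m" for i
    using that by (simp add: mult_embed_index[OF col_unip_carrier that] col_unip_index)
  have last: "?g $$ (i, Suc (2 * m)) = (if i = Suc (2 * m) then 1 else 0)" if "i < 2 * Suc m" for i
    using that by (simp add: mult_embed_index[OF col_unip_carrier that] col_unip_index)
  have row0: "?g $$ (0, Suc j) = 0" if "j < 2 * m" for j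
    using that by (simp add: mult_embed_index[OF col_unip_carrier] col_unip_index)
  have mid: "?g $$ (Suc i, Suc j) = u $$ (i, j)" if ij: "i < 2 * m" "j < 2 * m" for i j
  proof -
    have "?g $$ (Suc i, Suc j) = (\<Sum>k<2*m. col_unip m y $$ (Suc i, Suc k) * u $$ (k, j))"
      using ij by (intro mult_embed_index[OF col_unip_carrier]) simp_all
    also have "\<dots> = (\<Sum>k<2*m. if k = i then u $$ (k, j) else 0)"
      using ij by (intro sum.cong refl) (simp add: col_unip_index)
    finally show ?thesis using ij by simp
  qed
  have diag: "?g $$ (i, i) = 1" if i: "i < 2 * Suc m" for i
    using i by (cases rule: index_cases) (use u y in \<open>simp_all add: col0 last mid unip_def\<close>)
  have upper: "?g $$ (i, j) = 0" if i: "i < 2 * Suc m" and j: "j < 2 * Suc m" and "i < j" for i j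
    using i
    by (cases rule: index_cases; use j in \<open>cases rule: index_cases\<close>)
      (use u \<open>i < j\<close> in \<open>simp_all add: row0 last mid unip_def\<close>)
  have middle: "?g $$ (i, j) = 0"
    if ij: "i < 2 * Suc m - Suc r" "j < 2 * Suc m - Suc r" "Suc r \<le> i" "Suc r \<le> j" "i \<noteq> j" for i j
  proof -
    obtain i' j' where "i = Suc i'" "j = Suc j'" using ij by (metis Suc_le_D)
    then show ?thesis using ij u by (simp add: mid unip_def)
  qed
  have "?g \<in> carrier (Sp (Suc m))"
    by (rule Sp_mult_closed[OF col_unip_closed[where y = y, OF y] embed_closed[OF uS]])
  then show ?thesis using diag upper middle unfolding unip_def by blast
qed

text \<open>The induction hypothesis is a premise because two inductions share this step: one runs
  down to rank 0, the other stops after as many steps as the fundamental weight has nonzero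
  coordinates.\<close>

lemma vanish_on_unip_step:
  fixes f :: "'k::field mat \<Rightarrow> 'k"
  assumes inf: "infinite (UNIV :: 'k set)"
    and IH: "\<And>f :: 'k mat \<Rightarrow> 'k. \<lbrakk>semi_inv m (\<lambda>i. \<mu> (Suc i)) f; \<And>u. u \<in> unip m r \<Longrightarrow> f u = 0\<rbrakk>
      \<Longrightarrow> \<forall>h\<in>carrier (Sp m). f h = 0"
    and f: "semi_inv (Suc m) \<mu> f" and zero: "\<And>u. u \<in> unip (Suc m) (Suc r) \<Longrightarrow> f u = 0"
    and g: "g \<in> carrier (Sp (Suc m))"
  shows "f g = 0"
proof (rule semi_inv_eq_zero_step[OF inf f _ g])
  fix y :: "nat \<Rightarrow> 'k" and h :: "'k mat" assume y: "y 0 = 1" and h: "h \<in> carrier (Sp m)"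
  have "\<forall>h\<in>carrier (Sp m). f (col_unip m y * embed m h) = 0"
    by (rule IH[OF semi_inv_embed[OF f col_unip_closed[where y = y, OF y]]])
      (rule zero[OF unip_step[where y = y, OF y]])
  then show "f (col_unip m y * embed m h) = 0" using h by blast
qed

text \<open>In effect the density of the big cell: a semi-invariant function that vanishes on the
  lower unipotent part vanishes on its product with the Borel subgroup, and so everywhere.\<close>

lemma vanish_on_unip_full:
  fixes f :: "'k::field mat \<Rightarrow> 'k"
  assumes inf: "infinite (UNIV :: 'k set)"
    and f: "semi_inv m \<mu> f" and zero: "\<And>u. u \<in> unip m m \<Longrightarrow> f u = 0"
    and g: "g \<in> carrier (Sp m)"
  shows "f g = 0"
  using f zero g
proof (induction m arbitrary: \<mu> f g)
  case 0
  then have "g \<in> unip 0 0" by (simp add: unip_def)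
  then show ?case using 0 by blast
next
  case (Suc m)
  show ?case
    by (rule vanish_on_unip_step[OF inf _ Suc.prems]) (use Suc.IH in blast)
qed

section \<open>Weight decomposition\<close>

text \<open>The weight of the coordinate vector number \<open>i\<close> in the natural
  module.\<close>

definition eps :: "nat \<Rightarrow> nat \<Rightarrow> nat \<Rightarrow> int" where
  "eps m i = (\<lambda>k. if i < m then if k = i then 1 else 0 else if k = opp m i then - 1 else 0)"

text \<open>Left translation by a torus element scales rows, so only row indices enter.\<close>

definition row_wt :: "nat \<Rightarrow> (nat \<times> nat) list \<Rightarrow> nat \<Rightarrow> int" where
  "row_wt m xs = (\<lambda>k. \<Sum>(i, j)\<leftarrow>xs. eps m i k)"

text \<open>The weight for conjugation by the torus. A position below the diagonal contributes a
  negative root.\<close>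

definition conj_wt :: "nat \<Rightarrow> (nat \<times> nat) list \<Rightarrow> nat \<Rightarrow> int" where
  "conj_wt m xs = (\<lambda>k. \<Sum>(i, j)\<leftarrow>xs. eps m i k - eps m j k)"

lemma eps_weights: "i < 2 * m \<Longrightarrow> eps m i \<in> weights m"
  by (auto simp: eps_def weights_def opp_def)

lemma wt_Nil [simp]: "row_wt m [] = (\<lambda>_. 0)" "conj_wt m [] = (\<lambda>_. 0)"
  by (simp_all add: row_wt_def conj_wt_def)

lemma wt_Cons:
  "row_wt m ((i, j) # xs) = (\<lambda>k. eps m i k + row_wt m xs k)"
  "conj_wt m ((i, j) # xs) = (\<lambda>k. eps m i k - eps m j k + conj_wt m xs k)"
  by (simp_all add: row_wt_def conj_wt_def)

lemma row_wt_weights: "set xs \<subseteq> {..<2*m} \<times> {..<2*m} \<Longrightarrow> row_wt m xs \<in> weights m"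
proof (induction xs)
  case (Cons p xs)
  obtain i j where "p = (i, j)" by force
  then show ?case using Cons eps_weights[of i m] by (simp add: wt_Cons weights_def)
qed (simp add: weights_def)

lemma conj_wt_weights: "set xs \<subseteq> {..<2*m} \<times> {..<2*m} \<Longrightarrow> conj_wt m xs \<in> weights m"
proof (induction xs)
  case (Cons p xs)
  obtain i j where "p = (i, j)" by force
  then show ?case using Cons eps_weights[of i m] eps_weights[of j m] by (simp add: wt_Cons weights_def)
qed (simp add: weights_def)

lemma tchar_add:
  assumes "\<And>i. t i \<noteq> 0"
  shows "tchar m (\<lambda>k. \<mu> k + \<nu> k) t = tchar m \<mu> t * tchar m \<nu> t"
    and "tchar m (\<lambda>k. \<mu> k - \<nu> k) t = tchar m \<mu> t * inverse (tchar m \<nu> t)"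
  unfolding tchar_def prod_inversef[symmetric] prod.distrib[symmetric] comp_def
  using assms by (auto intro!: prod.cong simp: power_int_add power_int_diff divide_inverse)

lemma tchar_zero [simp]: "tchar m (\<lambda>_. 0) t = 1"
  by (simp add: tchar_def)

lemma tchar_eps:
  assumes "i < 2 * m"
  shows "tchar m (eps m i) t = tor_entry m t i"
proof -
  have "(\<Prod>k<m. t k powi eps m i k) = (\<Prod>k<m. if k = (if i < m then i else opp m i) then tor_entry m t i else 1)"
    using assms by (intro prod.cong refl) (auto simp: eps_def tor_entry_def power_int_minus)
  also have "\<dots> = tor_entry m t i"
    using assms opp_less_half[of i m] by (cases "i < m") simp_all
  finally show ?thesis by (simp add: tchar_def)
qed

lemma monom_fun_Cons: "monom_fun (p # xs) A = A $$ p * monom_fun xs A"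
  by (simp add: monom_fun_def)

lemma monom_fun_torus:
  assumes t: "\<And>i. t i \<noteq> 0" and g: "g \<in> carrier_mat (2 * m) (2 * m)"
  shows "set xs \<subseteq> {..<2*m} \<times> {..<2*m} \<Longrightarrow>
    monom_fun xs (torus_mat m t * g) = tchar m (row_wt m xs) t * monom_fun xs g"
proof (induction xs)
  case (Cons p xs)
  obtain i j where p: "p = (i, j)" by force
  show ?case
    using Cons torus_mat_left[OF g, of i j t] tchar_eps[of i m t]
    by (simp add: p monom_fun_Cons wt_Cons tchar_add[OF t] del: index_mult_mat)
qed (simp add: monom_fun_def)

definition torus_conj :: "nat \<Rightarrow> (nat \<Rightarrow> 'k::field) \<Rightarrow> 'k mat \<Rightarrow> 'k mat" where
  "torus_conj m t g = torus_mat m t * g * torus_mat m (\<lambda>i. inverse (t i))"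

lemma torus_conj_index:
  assumes "g \<in> carrier_mat (2 * m) (2 * m)" "i < 2 * m" "j < 2 * m"
  shows "torus_conj m t g $$ (i, j) = tor_entry m t i * g $$ (i, j) * inverse (tor_entry m t j)"
proof -
  have "torus_mat m t * g \<in> carrier_mat (2 * m) (2 * m)"
    using torus_mat_carrier assms(1) by (rule mult_carrier_mat)
  from torus_mat_right[OF this assms(2,3), of "\<lambda>i. inverse (t i)"]
  show ?thesis
    unfolding torus_conj_def torus_mat_left[OF assms] by (simp add: tor_entry_def)
qed

lemma monom_fun_torus_conj:
  assumes t: "\<And>i. t i \<noteq> 0" and g: "g \<in> carrier_mat (2 * m) (2 * m)"
  shows "set xs \<subseteq> {..<2*m} \<times> {..<2*m} \<Longrightarrow>
    monom_fun xs (torus_conj m t g) = tchar m (conj_wt m xs) t * monom_fun xs g"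
proof (induction xs)
  case (Cons p xs)
  obtain i j where p: "p = (i, j)" by force
  show ?case
    using Cons torus_conj_index[OF g, of i j t] tchar_eps[of i m t] tchar_eps[of j m t]
    by (simp add: p monom_fun_Cons wt_Cons tchar_add[OF t])
qed (simp add: monom_fun_def)

lemma terms_fun_scale:
  "(\<And>c xs. (c, xs) \<in> set l \<Longrightarrow> monom_fun xs A = a * monom_fun xs B) \<Longrightarrow>
    terms_fun l A = a * terms_fun l B"
proof (induction l)
  case (Cons p l)
  obtain c xs where p: "p = (c, xs)" by force
  have "terms_fun l A = a * terms_fun l B" by (rule Cons.IH, erule Cons.prems[OF list.set_intros(2)])
  moreover have "monom_fun xs A = a * monom_fun xs B" using Cons.prems[of c xs] p by simp
  ultimately show ?case by (simp add: p algebra_simps)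
qed simp

lemma terms_fun_group:
  assumes "finite \<Lambda>"
  shows "(\<And>c xs. (c, xs) \<in> set l \<Longrightarrow> w xs \<in> \<Lambda>) \<Longrightarrow>
    (\<Sum>\<nu>\<in>\<Lambda>. terms_fun (filter (\<lambda>(c, xs). w xs = \<nu>) l) A) = terms_fun l A"
proof (induction l)
  case (Cons p l)
  obtain c xs where p: "p = (c, xs)" by force
  have "(\<Sum>\<nu>\<in>\<Lambda>. terms_fun (filter (\<lambda>(c, xs). w xs = \<nu>) (p # l)) A)
    = (\<Sum>\<nu>\<in>\<Lambda>. (if w xs = \<nu> then c * monom_fun xs A else 0)
         + terms_fun (filter (\<lambda>(c, xs). w xs = \<nu>) l) A)"
    by (intro sum.cong refl) (simp add: p)
  also have "\<dots> = c * monom_fun xs A + terms_fun l A"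
  proof -
    have "(\<Sum>\<nu>\<in>\<Lambda>. terms_fun (filter (\<lambda>(c, xs). w xs = \<nu>) l) A) = terms_fun l A"
      by (rule Cons.IH, erule Cons.prems[OF list.set_intros(2)])
    moreover have "w xs \<in> \<Lambda>" using Cons.prems[of c xs] p by simp
    ultimately show ?thesis using assms by (simp add: sum.distrib)
  qed
  finally show ?case by (simp add: p)
qed simp

text \<open>The induced module acts through inverses, so this is weight \<open>- \<nu>\<close>
  there. With this sign the weights are dominated by the inducing weight, and the leading minor has
  that weight itself.\<close>

definition has_weight :: "nat \<Rightarrow> (nat \<Rightarrow> int) \<Rightarrow> ('k::field mat \<Rightarrow> 'k) \<Rightarrow> bool" where
  "has_weight m \<nu> f \<longleftrightarrow> (\<forall>t. (\<forall>i. t i \<noteq> 0) \<longrightarrow>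
     (\<forall>g\<in>carrier (Sp m). f (torus_mat m t * g) = tchar m \<nu> t * f g))"

lemma has_weightD:
  "has_weight m \<nu> f \<Longrightarrow> (\<And>i. t i \<noteq> 0) \<Longrightarrow> g \<in> carrier (Sp m) \<Longrightarrow>
    f (torus_mat m t * g) = tchar m \<nu> t * f g"
  by (simp add: has_weight_def)

text \<open>The monomials of a polynomial representing \<open>f\<close> are grouped by row weight.
  The representative need not be semi-invariant as a polynomial, yet each group is so on the
  symplectic group, by independence of characters.\<close>

lemma weight_decomposition:
  fixes f :: "'k::field mat \<Rightarrow> 'k"
  assumes inf: "infinite (UNIV :: 'k set)" and f: "semi_inv m \<mu> f"
  obtains \<Lambda> F where "finite \<Lambda>" "\<Lambda> \<subseteq> weights m" "\<And>\<nu>. \<nu> \<in> \<Lambda> \<Longrightarrow> semi_inv m \<mu> (F \<nu>)"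
    "\<And>\<nu>. \<nu> \<in> \<Lambda> \<Longrightarrow> has_weight m \<nu> (F \<nu>)" "\<And>g. g \<in> carrier (Sp m) \<Longrightarrow> f g = (\<Sum>\<nu>\<in>\<Lambda>. F \<nu> g)"
proof -
  obtain q where "q \<in> entry_polys (2 * m)" and fq: "\<forall>g\<in>carrier (Sp m). f g = q g"
    using semi_inv_poly[OF f] by blast
  then obtain l where l: "\<forall>(c, xs)\<in>set l. set xs \<subseteq> {..<2*m} \<times> {..<2*m}"
    and ql: "\<forall>A. q A = terms_fun l A"
    using entry_polys_imp_terms by blast
  define \<Lambda> where "\<Lambda> = (\<lambda>(c, xs). row_wt m xs) ` set l"
  define F where "F \<nu> = terms_fun (filter (\<lambda>(c, xs). row_wt m xs = \<nu>) l)" for \<nu>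
  have fin: "finite \<Lambda>" by (simp add: \<Lambda>_def)
  have sub: "\<Lambda> \<subseteq> weights m" using l row_wt_weights by (fastforce simp: \<Lambda>_def)
  have sum: "f g = (\<Sum>\<nu>\<in>\<Lambda>. F \<nu> g)" if "g \<in> carrier (Sp m)" for g
  proof -
    have "(\<Sum>\<nu>\<in>\<Lambda>. F \<nu> g) = terms_fun l g"
      unfolding F_def by (rule terms_fun_group[OF fin]) (force simp: \<Lambda>_def)
    then show ?thesis using fq ql that by simp
  qed
  have wt: "has_weight m \<nu> (F \<nu>)" for \<nu>
    unfolding has_weight_def
  proof (intro allI impI ballI)
    fix t :: "nat \<Rightarrow> 'k" and g :: "'k mat" assume t: "\<forall>i. t i \<noteq> 0" and g: "g \<in> carrier (Sp m)"
    show "F \<nu> (torus_mat m t * g) = tchar m \<nu> t * F \<nu> g"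
      unfolding F_def
    proof (rule terms_fun_scale)
      fix c xs assume "(c, xs) \<in> set (filter (\<lambda>(c, xs). row_wt m xs = \<nu>) l)"
      then have "row_wt m xs = \<nu>" "set xs \<subseteq> {..<2*m} \<times> {..<2*m}" using l by auto
      then show "monom_fun xs (torus_mat m t * g) = tchar m \<nu> t * monom_fun xs g"
        using monom_fun_torus[of t g m xs] t Sp_carrier_mat[OF g] by simp
    qed
  qed
  have semi: "semi_inv m \<mu> (F \<nu>)" if \<nu>: "\<nu> \<in> \<Lambda>" for \<nu>
    unfolding semi_inv_def
  proof
    have "\<forall>(c, xs)\<in>set (filter (\<lambda>(c, xs). row_wt m xs = \<nu>) l). set xs \<subseteq> {..<2*m} \<times> {..<2*m}"
      using l by auto
    then have "F \<nu> \<in> entry_polys (2 * m)"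
      unfolding F_def by (rule terms_fun_entry_polys)
    then show "\<exists>q\<in>entry_polys (2 * m). \<forall>g\<in>carrier (Sp m). F \<nu> g = q g" by blast
    show "\<forall>g\<in>carrier (Sp m). \<forall>b\<in>borel_Sp m. F \<nu> (g * b) = weight_char m \<mu> b * F \<nu> g"
    proof (intro ballI)
      fix g b :: "'k mat" assume g: "g \<in> carrier (Sp m)" and b: "b \<in> borel_Sp m"
      have bS: "b \<in> carrier (Sp m)" using b by (simp add: borel_Sp_def)
      \<comment> \<open>The defects of the components are the coefficients of a combination of
        characters whose value at \<open>t\<close> is the defect of \<open>f\<close> at the
        translate of \<open>g\<close> by \<open>t\<close>, which is 0.\<close>
      have "F \<nu> (g * b) - weight_char m \<mu> b * F \<nu> g = 0"
      proof (rule characters_independent[OF inf fin sub _ \<nu>])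
        fix t :: "nat \<Rightarrow> 'k" assume t: "\<And>i. t i \<noteq> 0"
        note T = torus_mat_closed[where t = t and m = m, OF t]
        have "(\<Sum>\<nu>\<in>\<Lambda>. (F \<nu> (g * b) - weight_char m \<mu> b * F \<nu> g) * tchar m \<nu> t)
          = (\<Sum>\<nu>\<in>\<Lambda>. F \<nu> (torus_mat m t * (g * b)) - weight_char m \<mu> b * F \<nu> (torus_mat m t * g))"
          using has_weightD[OF wt, where t = t, OF t] g Sp_mult_closed[OF g bS]
          by (intro sum.cong refl) (simp add: algebra_simps)
        also have "\<dots> = f (torus_mat m t * (g * b)) - weight_char m \<mu> b * f (torus_mat m t * g)"
          by (simp add: sum_subtractf sum_distrib_left sum T g bS Sp_mult_closed)
        also have "torus_mat m t * (g * b) = torus_mat m t * g * b"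
          by (simp only: Sp_assoc[OF T g bS])
        finally show "(\<Sum>\<nu>\<in>\<Lambda>. (F \<nu> (g * b) - weight_char m \<mu> b * F \<nu> g) * tchar m \<nu> t) = 0"
          using semi_inv_borel[OF f Sp_mult_closed[OF T g] b] by simp
      qed
      then show "F \<nu> (g * b) = weight_char m \<mu> b * F \<nu> g" by simp
    qed
  qed
  show ?thesis using that[OF fin sub semi wt sum] .
qed

section \<open>Restriction of weight vectors to the unipotent radical\<close>

definition lower_pairs :: "nat \<Rightarrow> nat \<Rightarrow> (nat \<times> nat) set" where
  "lower_pairs m r = {(i, j). j < i \<and> i < 2 * m \<and> \<not> (r \<le> j \<and> i < 2 * m - r)}"

lemma torus_conj_unip:
  assumes t: "\<And>i. t i \<noteq> 0" and u: "u \<in> unip m r"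
  shows "torus_conj m t u \<in> unip m r"
proof -
  have uS: "u \<in> carrier (Sp m)" using u by (simp add: unip_def)
  have "torus_conj m t u \<in> carrier (Sp m)"
    unfolding torus_conj_def using t by (intro Sp_mult_closed torus_mat_closed uS) simp_all
  moreover have "tor_entry m t i \<noteq> 0" for i using t by (simp add: tor_entry_def)
  ultimately show ?thesis
    using u by (simp add: unip_def torus_conj_index[OF Sp_carrier_mat[OF uS]])
qed

lemma monom_fun_unip:
  assumes u: "u \<in> unip m r"
  shows "set xs \<subseteq> {..<2*m} \<times> {..<2*m} \<Longrightarrow> monom_fun xs u =
    (if \<forall>(i, j)\<in>set xs. i = j \<or> (i, j) \<in> lower_pairs m r then monom_fun (filter (\<lambda>(i, j). i \<noteq> j) xs) u else 0)"
proof (induction xs)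
  case (Cons p xs)
  obtain i j where p: "p = (i, j)" by force
  have ij: "i < 2 * m" "j < 2 * m" using Cons.prems by (auto simp: p)
  consider "i = j" | "i \<noteq> j" "(i, j) \<in> lower_pairs m r" | "i \<noteq> j" "(i, j) \<notin> lower_pairs m r" by blast
  then show ?case
  proof cases
    case 1
    then have "u $$ p = 1" using u ij by (simp add: unip_def p)
    then show ?thesis using Cons 1 by (simp add: p monom_fun_Cons)
  next
    case 2
    then show ?thesis using Cons by (simp add: p monom_fun_Cons)
  next
    case 3
    then have "u $$ (i, j) = 0"
      using u ij unfolding unip_def lower_pairs_def by (cases "i < j") auto
    then show ?thesis using 3 by (simp add: p monom_fun_Cons)
  qed
qed (simp add: monom_fun_def)

text \<open>In f(t u t^-1) the left factor contributes \<open>tchar m \<nu> t\<close> and the right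
  factor the inverse of \<open>tchar m \<mu> t\<close>. Comparing characters of t leaves only the
  monomials of conjugation weight \<open>\<nu> - \<mu>\<close>.\<close>

lemma restrict_to_unip:
  fixes f :: "'k::field mat \<Rightarrow> 'k"
  assumes inf: "infinite (UNIV :: 'k set)" and f: "semi_inv m \<mu> f" and wt: "has_weight m \<nu> f"
    and \<mu>: "\<mu> \<in> weights m" and \<nu>: "\<nu> \<in> weights m"
  obtains l where "\<And>c xs. (c, xs) \<in> set l \<Longrightarrow> set xs \<subseteq> lower_pairs m r \<and> conj_wt m xs = (\<lambda>k. \<nu> k - \<mu> k)"
    "\<And>u. u \<in> unip m r \<Longrightarrow> f u = terms_fun l u"
proof -
  obtain q where "q \<in> entry_polys (2 * m)" and fq: "\<forall>g\<in>carrier (Sp m). f g = q g"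
    using semi_inv_poly[OF f] by blast
  then obtain l0 where l0: "\<forall>(c, xs)\<in>set l0. set xs \<subseteq> {..<2*m} \<times> {..<2*m}"
    and ql: "\<forall>A. q A = terms_fun l0 A"
    using entry_polys_imp_terms by blast
  define good where "good xs \<longleftrightarrow> (\<forall>(i, j)\<in>set xs. i = j \<or> (i, j) \<in> lower_pairs m r)" for xs
  define l1 where "l1 = map (\<lambda>(c, xs). (c, filter (\<lambda>(i, j). i \<noteq> j) xs)) (filter (\<lambda>(c, xs). good xs) l0)"
  have l1: "set xs \<subseteq> lower_pairs m r" if "(c, xs) \<in> set l1" for c xs
    using that by (fastforce simp: l1_def good_def)
  have lp: "lower_pairs m r \<subseteq> {..<2*m} \<times> {..<2*m}"
    by (auto simp: lower_pairs_def)
  have t1: "f u = terms_fun l1 u" if u: "u \<in> unip m r" for u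
  proof -
    have "terms_fun l0 u = terms_fun l1 u"
      using l0 unfolding l1_def
    proof (induction l0)
      case (Cons p l0)
      obtain c xs where p: "p = (c, xs)" by force
      show ?case using Cons monom_fun_unip[OF u, of xs] by (auto simp: p good_def)
    qed simp
    then show ?thesis using u fq ql by (simp add: unip_def)
  qed
  define \<kappa> where "\<kappa> = (\<lambda>k. \<nu> k - \<mu> k)"
  \<comment> \<open>The weight \<open>\<kappa>\<close> is inserted because no monomial need have it;
    in that case the comparison gives \<open>f u = 0\<close>.\<close>
  define \<Lambda> where "\<Lambda> = insert \<kappa> ((\<lambda>(c, xs). conj_wt m xs) ` set l1)"
  define G where "G \<kappa>' = terms_fun (filter (\<lambda>(c, xs). conj_wt m xs = \<kappa>') l1)" for \<kappa>'
  have fin: "finite \<Lambda>" by (simp add: \<Lambda>_def)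
  have sub: "\<Lambda> \<subseteq> weights m"
    using conj_wt_weights l1 lp \<mu> \<nu> by (fastforce simp: \<Lambda>_def \<kappa>_def weights_def)
  have "f u = G \<kappa> u" if u: "u \<in> unip m r" for u
  proof -
    have uS: "u \<in> carrier (Sp m)" using u by (simp add: unip_def)
    have "G \<kappa> u - (if \<kappa> = \<kappa> then f u else 0) = 0"
    proof (rule characters_independent[OF inf fin sub, of "\<lambda>\<kappa>'. G \<kappa>' u - (if \<kappa>' = \<kappa> then f u else 0)"])
      fix t :: "nat \<Rightarrow> 'k" assume t: "\<And>i. t i \<noteq> 0"
      have t': "\<And>i. inverse (t i) \<noteq> 0" using t by simp
      note T = torus_mat_closed[where t = t and m = m, OF t]
      have G: "G \<kappa>' (torus_conj m t u) = tchar m \<kappa>' t * G \<kappa>' u" for \<kappa>'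
        unfolding G_def
      proof (rule terms_fun_scale)
        fix c xs assume "(c, xs) \<in> set (filter (\<lambda>(c, xs). conj_wt m xs = \<kappa>') l1)"
        then have "conj_wt m xs = \<kappa>'" "set xs \<subseteq> {..<2*m} \<times> {..<2*m}" using l1[of c xs] lp by auto
        then show "monom_fun xs (torus_conj m t u) = tchar m \<kappa>' t * monom_fun xs u"
          using monom_fun_torus_conj[of t u m xs] t Sp_carrier_mat[OF uS] by simp
      qed
      have "f (torus_conj m t u) = weight_char m \<mu> (torus_mat m (\<lambda>i. inverse (t i))) * f (torus_mat m t * u)"
        unfolding torus_conj_def
        by (rule semi_inv_borel[OF f Sp_mult_closed[OF T uS] torus_mat_borel[OF t']])
      also have "weight_char m \<mu> (torus_mat m (\<lambda>i. inverse (t i))) = inverse (tchar m \<mu> t)"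
        unfolding weight_char_torus_mat by (simp add: tchar_def power_int_inverse prod_inversef[symmetric] comp_def)
      also have "f (torus_mat m t * u) = tchar m \<nu> t * f u"
        by (rule has_weightD[OF wt t uS])
      finally have ft: "f (torus_conj m t u) = tchar m \<kappa> t * f u"
        unfolding \<kappa>_def tchar_add(2)[where t = t, OF t] by simp
      have "(\<Sum>\<kappa>'\<in>\<Lambda>. G \<kappa>' (torus_conj m t u)) = terms_fun l1 (torus_conj m t u)"
        unfolding G_def by (rule terms_fun_group[OF fin]) (force simp: \<Lambda>_def)
      also have "\<dots> = tchar m \<kappa> t * f u"
        using t1[OF torus_conj_unip[where t = t, OF t u]] ft by simp
      finally have "(\<Sum>\<kappa>'\<in>\<Lambda>. G \<kappa>' u * tchar m \<kappa>' t) = f u * tchar m \<kappa> t"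
        by (simp add: G mult.commute)
      moreover have "(\<Sum>\<kappa>'\<in>\<Lambda>. (if \<kappa>' = \<kappa> then f u else 0) * tchar m \<kappa>' t) = f u * tchar m \<kappa> t"
      proof -
        have "(\<Sum>\<kappa>'\<in>\<Lambda>. (if \<kappa>' = \<kappa> then f u else 0) * tchar m \<kappa>' t)
            = (\<Sum>\<kappa>'\<in>\<Lambda>. if \<kappa>' = \<kappa> then f u * tchar m \<kappa>' t else 0)"
          by (intro sum.cong) auto
        then show ?thesis using fin by (simp add: \<Lambda>_def)
      qed
      ultimately show "(\<Sum>\<kappa>'\<in>\<Lambda>. (G \<kappa>' u - (if \<kappa>' = \<kappa> then f u else 0)) * tchar m \<kappa>' t) = 0"
        by (simp add: left_diff_distrib sum_subtractf)
    qed (simp add: \<Lambda>_def)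
    then show ?thesis by simp
  qed
  then show ?thesis
    using that[of "filter (\<lambda>(c, xs). conj_wt m xs = \<kappa>) l1"] l1 unfolding G_def \<kappa>_def by auto
qed

section \<open>Weights of the induced module\<close>

text \<open>The pairing of a weight with a cocharacter \<open>l\<close>. Dominance enters only
  through such pairings, and each bound below comes from a suitable \<open>l\<close>.\<close>

definition wt_val :: "nat \<Rightarrow> (nat \<Rightarrow> int) \<Rightarrow> (nat \<Rightarrow> int) \<Rightarrow> int" where
  "wt_val m l \<nu> = (\<Sum>k<m. l k * \<nu> k)"

definition ext_wt :: "nat \<Rightarrow> (nat \<Rightarrow> int) \<Rightarrow> nat \<Rightarrow> int" where
  "ext_wt m l i = (if i < m then l i else - l (opp m i))"

lemma wt_val_eps:
  assumes "i < 2 * m"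
  shows "wt_val m l (eps m i) = ext_wt m l i"
proof -
  have "(\<Sum>k<m. l k * eps m i k) = (\<Sum>k<m. if k = (if i < m then i else opp m i) then ext_wt m l i else 0)"
    using assms by (intro sum.cong refl) (auto simp: eps_def ext_wt_def)
  also have "\<dots> = ext_wt m l i"
    using assms opp_less_half[of i m] by (cases "i < m") simp_all
  finally show ?thesis by (simp add: wt_val_def)
qed

lemma wt_val_add:
  "wt_val m l (\<lambda>k. \<mu> k + \<nu> k) = wt_val m l \<mu> + wt_val m l \<nu>"
  "wt_val m l (\<lambda>k. \<mu> k - \<nu> k) = wt_val m l \<mu> - wt_val m l \<nu>"
  by (simp_all add: wt_val_def algebra_simps sum.distrib sum_subtractf)

lemma wt_val_conj:
  "set xs \<subseteq> {..<2*m} \<times> {..<2*m} \<Longrightarrow>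
    wt_val m l (conj_wt m xs) = (\<Sum>(i, j)\<leftarrow>xs. ext_wt m l i - ext_wt m l j)"
proof (induction xs)
  case (Cons p xs)
  obtain i j where "p = (i, j)" by force
  then show ?case using Cons by (simp add: wt_Cons wt_val_add wt_val_eps)
qed (simp add: wt_val_def)

text \<open>For dominant \<open>l\<close> the values l 0, ..., l (m - 1), - l (m - 1), ..., - l 0
  form a weakly decreasing sequence.\<close>

lemma ext_wt_antimono:
  assumes "\<And>i j. i \<le> j \<Longrightarrow> j < m \<Longrightarrow> l j \<le> l i" "\<And>i. i < m \<Longrightarrow> 0 \<le> l i" "j < i" "i < 2 * m"
  shows "ext_wt m l i \<le> ext_wt m l j"
proof (cases "j < m")
  case True
  then show ?thesis
    using assms(1)[of j i] assms(2)[of j] assms(2)[of "opp m i"] assms(3,4) opp_less_half[of i m]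
    by (cases "i < m") (simp_all add: ext_wt_def)
next
  case False
  then have "opp m i \<le> opp m j" "opp m j < m"
    using assms(3,4) by (auto simp: opp_def)
  then show ?thesis using assms(1)[of "opp m i" "opp m j"] False assms(3) by (simp add: ext_wt_def)
qed

lemma lower_pairs_subset: "lower_pairs m r \<subseteq> {..<2*m} \<times> {..<2*m}"
  by (auto simp: lower_pairs_def)

lemma sum_list_le_const:
  "(\<And>x. x \<in> set xs \<Longrightarrow> f x \<le> c) \<Longrightarrow> (\<Sum>x\<leftarrow>xs. f x) \<le> c * int (length xs)"
  by (induction xs) (auto simp: algebra_simps intro: add_mono)

lemma wt_val_conj_nonpos:
  assumes "set xs \<subseteq> lower_pairs m r" "\<And>i j. i \<le> j \<Longrightarrow> j < m \<Longrightarrow> l j \<le> l i" "\<And>i. i < m \<Longrightarrow> 0 \<le> l i"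
  shows "wt_val m l (conj_wt m xs) \<le> 0"
proof -
  have xs: "set xs \<subseteq> {..<2*m} \<times> {..<2*m}" using assms(1) lower_pairs_subset by blast
  have "(\<Sum>p\<leftarrow>xs. case p of (i, j) \<Rightarrow> ext_wt m l i - ext_wt m l j) \<le> 0 * int (length xs)"
  proof (rule sum_list_le_const)
    fix p assume "p \<in> set xs"
    then have "p \<in> lower_pairs m r" using assms(1) by blast
    then show "(case p of (i, j) \<Rightarrow> ext_wt m l i - ext_wt m l j) \<le> 0"
      using ext_wt_antimono[of m l, OF assms(2,3)] by (auto simp: lower_pairs_def)
  qed
  then show ?thesis by (simp add: wt_val_conj[OF xs])
qed

text \<open>A nonzero function survives on the lower unipotent elements, so some monomial in lower
  positions has conjugation weight \<open>\<nu> - \<mu>\<close>. This difference is a sum of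
  negative roots, on which a dominant \<open>l\<close> is nonpositive.\<close>

lemma dominance:
  fixes f :: "'k::field mat \<Rightarrow> 'k"
  assumes inf: "infinite (UNIV :: 'k set)" and f: "semi_inv m \<mu> f" and wt: "has_weight m \<nu> f"
    and \<mu>: "\<mu> \<in> weights m" and \<nu>: "\<nu> \<in> weights m"
    and g: "g \<in> carrier (Sp m)" "f g \<noteq> 0"
    and l: "\<And>i j. i \<le> j \<Longrightarrow> j < m \<Longrightarrow> l j \<le> l i" "\<And>i. i < m \<Longrightarrow> 0 \<le> l i"
  shows "wt_val m l \<nu> \<le> wt_val m l \<mu>"
proof -
  obtain u where u: "u \<in> unip m m" "f u \<noteq> 0"
    using vanish_on_unip_full[OF inf f _ g(1)] g(2) by blast
  obtain T where T: "\<And>c xs. (c, xs) \<in> set T \<Longrightarrow> set xs \<subseteq> lower_pairs m m \<and> conj_wt m xs = (\<lambda>k. \<nu> k - \<mu> k)"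
    "\<And>u. u \<in> unip m m \<Longrightarrow> f u = terms_fun T u"
    using restrict_to_unip[OF inf f wt \<mu> \<nu>, of m] by blast
  have "T \<noteq> []" using T(2)[OF u(1)] u(2) by auto
  then obtain c xs where "(c, xs) \<in> set T" by (cases T) auto
  from T(1)[OF this] have "wt_val m l (\<lambda>k. \<nu> k - \<mu> k) \<le> 0"
    using wt_val_conj_nonpos[of xs m m l, OF _ l] by simp
  then show ?thesis by (simp add: wt_val_add)
qed

section \<open>The Weyl group acting on weights\<close>

lemma torus_mat_cong:
  assumes "\<And>i. i < m \<Longrightarrow> t i = t' i"
  shows "torus_mat m t = torus_mat m t'"
proof -
  have "tor_entry m t i = tor_entry m t' i" if "i < 2 * m" for i
    using that assms[of i] assms[of "opp m i"] by (simp add: tor_entry_def)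
  then show ?thesis unfolding torus_mat_def by (intro cong_mat) auto
qed

lemma tchar_cong: "(\<And>i. i < m \<Longrightarrow> t i = t' i) \<Longrightarrow> tchar m \<nu> t = tchar m \<nu> t'"
  by (simp add: tchar_def)

text \<open>The weight that \<open>\<nu>\<close> becomes when a function is translated by
  \<open>sperm_mat m \<pi> P\<close>, as \<open>has_weight_sperm\<close> shows.\<close>

definition perm_wt :: "nat \<Rightarrow> (nat \<Rightarrow> nat) \<Rightarrow> nat set \<Rightarrow> (nat \<Rightarrow> int) \<Rightarrow> nat \<Rightarrow> int" where
  "perm_wt m \<pi> P \<nu> = (\<lambda>i. if i < m then if i \<in> P then - \<nu> (\<pi> i) else \<nu> (\<pi> i) else 0)"

lemma perm_wt_weights: "perm_wt m \<pi> P \<nu> \<in> weights m"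
  by (simp add: perm_wt_def weights_def)

lemma perm_wt_tchar:
  assumes perm: "bij_betw \<pi> {..<m} {..<m}" and t: "\<And>i. t i \<noteq> 0"
  obtains s where "\<And>i. s i \<noteq> 0" "torus_mat m s * sperm_mat m \<pi> P = sperm_mat m \<pi> P * torus_mat m t"
    "tchar m \<nu> s = tchar m (perm_wt m \<pi> P \<nu>) t"
proof -
  \<comment> \<open>The torus element that conjugation by the signed permutation matrix turns into
    \<open>t\<close>.\<close>
  define s where "s k = (let i = inv_into {..<m} \<pi> k in if i \<in> P then inverse (t i) else t i)" for k
  have s: "(if i \<in> P then inverse (s (\<pi> i)) else s (\<pi> i)) = t i" if "i < m" for i
    using inv_into_f_f[OF bij_betw_imp_inj_on[OF perm], of i] that by (simp add: s_def Let_def)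
  have "torus_mat m s * sperm_mat m \<pi> P = sperm_mat m \<pi> P * torus_mat m t"
    unfolding torus_mat_sperm_mat[OF perm] by (intro arg_cong2[of _ _ _ _ "(*)"] refl torus_mat_cong s)
  moreover have "tchar m \<nu> s = tchar m (perm_wt m \<pi> P \<nu>) t"
    unfolding tchar_signed_perm[OF perm, of P \<nu> s, symmetric] perm_wt_def by (rule tchar_cong) (rule s)
  moreover have "s k \<noteq> 0" for k using t by (simp add: s_def Let_def)
  ultimately show ?thesis using that by blast
qed

lemma has_weight_sperm:
  assumes perm: "bij_betw \<pi> {..<m} {..<m}" and wt: "has_weight m \<nu> f"
  shows "has_weight m (perm_wt m \<pi> P \<nu>) (\<lambda>g. f (sperm_mat m \<pi> P * g))"
  unfolding has_weight_def
proof (intro allI impI ballI)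
  fix t :: "nat \<Rightarrow> 'a" and g :: "'a mat" assume t: "\<forall>i. t i \<noteq> 0" and g: "g \<in> carrier (Sp m)"
  have t0: "\<And>i. t i \<noteq> 0" using t by blast
  obtain s where s: "\<And>i. s i \<noteq> 0" "torus_mat m s * sperm_mat m \<pi> P = sperm_mat m \<pi> P * torus_mat m t"
    "tchar m \<nu> s = tchar m (perm_wt m \<pi> P \<nu>) t"
    using perm_wt_tchar[where t = t and P = P and \<nu> = \<nu>, OF perm t0] by blast
  note N = sperm_mat_closed[OF perm, of P, where ?'a = 'a]
  have "sperm_mat m \<pi> P * (torus_mat m t * g) = torus_mat m s * (sperm_mat m \<pi> P * g)"
    using Sp_assoc[OF N torus_mat_closed[where t = t, OF t0] g] Sp_assoc[OF torus_mat_closed[where t = s, OF s(1)] N g]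
    by (simp only: s(2))
  then show "f (sperm_mat m \<pi> P * (torus_mat m t * g)) = tchar m (perm_wt m \<pi> P \<nu>) t * f (sperm_mat m \<pi> P * g)"
    using has_weightD[where t = s, OF wt s(1) Sp_mult_closed[OF N g]] by (simp only: s(3))
qed

lemma left_cancel_inverse:
  assumes a: "a \<in> carrier (Sp m)" and g: "g \<in> carrier (Sp m)"
  shows "a * (symp_inverse m a * g) = g" "symp_inverse m a * (a * g) = g"
  using Sp_assoc[OF a symp_inverse_closed(1)[OF a] g] Sp_assoc[OF symp_inverse_closed(1)[OF a] a g]
    symp_inverse_closed(2)[OF a] symp_inverse_left[OF a] left_mult_one_mat[OF Sp_carrier_mat[OF g]]
  by simp_all

text \<open>Semi-invariance is a condition on the right, so it survives left translation by a signed
  permutation matrix. Thus dominance holds for every Weyl conjugate of the weight.\<close>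

lemma dominance_sperm:
  fixes f :: "'k::field mat \<Rightarrow> 'k"
  assumes inf: "infinite (UNIV :: 'k set)" and f: "semi_inv m \<mu> f" and wt: "has_weight m \<nu> f"
    and \<mu>: "\<mu> \<in> weights m" and g: "g \<in> carrier (Sp m)" "f g \<noteq> 0"
    and perm: "bij_betw \<pi> {..<m} {..<m}"
    and l: "\<And>i j. i \<le> j \<Longrightarrow> j < m \<Longrightarrow> l j \<le> l i" "\<And>i. i < m \<Longrightarrow> 0 \<le> l i"
  shows "wt_val m l (perm_wt m \<pi> P \<nu>) \<le> wt_val m l \<mu>"
proof -
  note N = sperm_mat_closed[OF perm, of P, where ?'a = 'k]
  show ?thesis
  proof (rule dominance[OF inf semi_inv_translate[OF f N] has_weight_sperm[OF perm wt] \<mu> perm_wt_weights _ _ l])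
    show "symp_inverse m (sperm_mat m \<pi> P) * g \<in> carrier (Sp m)"
      by (rule Sp_mult_closed[OF symp_inverse_closed(1)[OF N] g(1)])
    show "f (sperm_mat m \<pi> P * (symp_inverse m (sperm_mat m \<pi> P) * g)) \<noteq> 0"
      unfolding left_cancel_inverse[OF N g(1)] by (rule g(2))
  qed
qed

lemma wt_val_abs:
  "wt_val m l (perm_wt m (\<lambda>i. i) {i. \<nu> i < 0} \<nu>) = (\<Sum>k<m. l k * \<bar>\<nu> k\<bar>)"
  unfolding wt_val_def perm_wt_def by (intro sum.cong) auto

lemma bij_betw_id_fun: "bij_betw (\<lambda>i. i) A A"
  using bij_betw_id[of A] by (simp add: id_def)

lemma one_in_unip: "1\<^sub>m (2 * m) \<in> unip m r"
  by (auto simp: unip_def)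

text \<open>A function invariant under right translation by the Borel subgroup has only the weight 0,
  as a nonzero weight has a conjugate which is not dominated by 0.\<close>

lemma semi_inv_zero_const:
  fixes f :: "'k::field mat \<Rightarrow> 'k"
  assumes inf: "infinite (UNIV :: 'k set)" and f: "semi_inv m (\<lambda>_. 0) f" and f1: "f (1\<^sub>m (2 * m)) = 0"
    and g: "g \<in> carrier (Sp m)"
  shows "f g = 0"
proof -
  have z: "(\<lambda>_. 0) \<in> weights m" by (simp add: weights_def)
  obtain \<Lambda> F where \<Lambda>: "finite \<Lambda>" "\<Lambda> \<subseteq> weights m" and F: "\<And>\<nu>. \<nu> \<in> \<Lambda> \<Longrightarrow> semi_inv m (\<lambda>_. 0) (F \<nu>)"
    "\<And>\<nu>. \<nu> \<in> \<Lambda> \<Longrightarrow> has_weight m \<nu> (F \<nu>)" and sum: "\<And>g. g \<in> carrier (Sp m) \<Longrightarrow> f g = (\<Sum>\<nu>\<in>\<Lambda>. F \<nu> g)"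
    using weight_decomposition[OF inf f] by blast
  have nz: "F \<nu> g = 0" if \<nu>: "\<nu> \<in> \<Lambda>" "\<nu> \<noteq> (\<lambda>_. 0)" and g: "g \<in> carrier (Sp m)" for \<nu> g
  proof (rule ccontr)
    assume "F \<nu> g \<noteq> 0"
    then have "wt_val m (\<lambda>_. 1) (perm_wt m (\<lambda>i. i) {i. \<nu> i < 0} \<nu>) \<le> wt_val m (\<lambda>_. 1) (\<lambda>_. 0)"
      by (intro dominance_sperm[OF inf F[OF \<nu>(1)] z g _ bij_betw_id_fun]) simp_all
    then have "(\<Sum>k<m. \<bar>\<nu> k\<bar>) \<le> 0"
      unfolding wt_val_abs by (simp add: wt_val_def)
    then have "(\<Sum>k<m. \<bar>\<nu> k\<bar>) = 0"
      by (intro antisym) (simp_all add: sum_nonneg)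
    then have "\<And>k. k < m \<Longrightarrow> \<nu> k = 0"
      by (subst (asm) sum_nonneg_eq_0_iff) simp_all
    then have "\<nu> = (\<lambda>_. 0)"
      using \<nu>(1) \<Lambda>(2) z by (intro weights_eqI[of _ m]) auto
    then show False using \<nu>(2) by simp
  qed
  have f0: "f g = (if (\<lambda>_. 0) \<in> \<Lambda> then F (\<lambda>_. 0) g else 0)" if g: "g \<in> carrier (Sp m)" for g
  proof -
    have "f g = (\<Sum>\<nu>\<in>\<Lambda>. if \<nu> = (\<lambda>_. 0) then F \<nu> g else 0)"
      unfolding sum[OF g] by (intro sum.cong refl) (simp add: nz[OF _ _ g])
    then show ?thesis using \<Lambda>(1) by simp
  qed
  have wt: "has_weight m (\<lambda>_. 0) f"
    unfolding has_weight_def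
  proof (intro allI impI ballI)
    fix t :: "nat \<Rightarrow> 'k" and g :: "'k mat" assume t: "\<forall>i. t i \<noteq> 0" and g: "g \<in> carrier (Sp m)"
    then show "f (torus_mat m t * g) = tchar m (\<lambda>_. 0) t * f g"
      using has_weightD[OF F(2), of "\<lambda>_. 0" t g] f0[OF g] f0[OF Sp_mult_closed[OF torus_mat_closed g], of t]
      by auto
  qed
  show ?thesis
  proof (rule vanish_on_unip_full[OF inf f _ g])
    fix u :: "'k mat" assume u: "u \<in> unip m m"
    obtain T where T: "\<And>c xs. (c, xs) \<in> set T \<Longrightarrow> set xs \<subseteq> lower_pairs m m \<and> conj_wt m xs = (\<lambda>k. 0 - 0)"
      "\<And>u. u \<in> unip m m \<Longrightarrow> f u = terms_fun T u"
      using restrict_to_unip[OF inf f wt z z, of m] by blast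
    have Nil: "xs = []" if "(c, xs) \<in> set T" for c xs
    proof -
      \<comment> \<open>A strictly dominant choice: every position below the diagonal lowers the
        pairing by at least 1, so a monomial of weight 0 is empty.\<close>
      define l where "l k = int m - int k" for k
      have xs: "set xs \<subseteq> lower_pairs m m" "conj_wt m xs = (\<lambda>k. 0)" using T(1)[OF that] by auto
      have "(\<Sum>p\<leftarrow>xs. case p of (i, j) \<Rightarrow> ext_wt m l i - ext_wt m l j) \<le> (- 1) * int (length xs)"
      proof (rule sum_list_le_const)
        fix p assume "p \<in> set xs"
        then have "p \<in> lower_pairs m m" using xs by blast
        then show "(case p of (i, j) \<Rightarrow> ext_wt m l i - ext_wt m l j) \<le> - 1"
          by (auto simp: lower_pairs_def ext_wt_def l_def opp_def)
      qed
      moreover have "wt_val m l (conj_wt m xs) = 0" by (simp add: xs(2) wt_val_def)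
      moreover have "set xs \<subseteq> {..<2*m} \<times> {..<2*m}" using xs(1) lower_pairs_subset by blast
      ultimately show ?thesis by (simp add: wt_val_conj)
    qed
    have "terms_fun T u = 1 * terms_fun T (1\<^sub>m (2 * m))"
    proof (rule terms_fun_scale)
      fix c xs assume "(c, xs) \<in> set T"
      then show "monom_fun xs u = 1 * monom_fun xs (1\<^sub>m (2 * m))" using Nil[of c xs] by (simp add: monom_fun_def)
    qed
    then show "f u = 0" using T(2)[OF u] T(2)[OF one_in_unip] f1 by simp
  qed
qed

lemma fund_weight_weights: "r \<le> m \<Longrightarrow> fund_weight r \<in> weights m"
  by (simp add: fund_weight_def weights_def)

text \<open>After \<open>r\<close> steps the remaining weight is 0 and the function on the group of
  rank \<open>m - r\<close> is constant, so its value at the identity suffices. This is why the test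
  set \<open>unip m r\<close> has a trivial middle block.\<close>

lemma vanish_on_unip_fund_weight:
  fixes f :: "'k::field mat \<Rightarrow> 'k"
  assumes inf: "infinite (UNIV :: 'k set)" and "r \<le> m"
    and f: "semi_inv m (fund_weight r) f" and zero: "\<And>u. u \<in> unip m r \<Longrightarrow> f u = 0"
    and g: "g \<in> carrier (Sp m)"
  shows "f g = 0"
  using assms(2) f zero g
proof (induction r arbitrary: m f g)
  case 0
  then show ?case
    using semi_inv_zero_const[OF inf _ _ 0(4)] one_in_unip by (auto simp: fund_weight_def)
next
  case (Suc r)
  obtain m' where m: "m = Suc m'" using Suc.prems(1) by (cases m) auto
  have shift: "(\<lambda>i. fund_weight (Suc r) (Suc i)) = fund_weight r"
    by (auto simp: fund_weight_def)
  show ?case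
  proof (rule vanish_on_unip_step[OF inf _ Suc.prems(2,3,4)[unfolded m]])
    fix f :: "'k mat \<Rightarrow> 'k"
    assume "semi_inv m' (\<lambda>i. fund_weight (Suc r) (Suc i)) f" "\<And>u. u \<in> unip m' r \<Longrightarrow> f u = 0"
    then show "\<forall>h\<in>carrier (Sp m'). f h = 0"
      using Suc.IH[of m' f] Suc.prems(1) m unfolding shift by blast
  qed
qed

text \<open>The first bound pairs with (1, ..., 1) after all signs of \<open>\<nu>\<close> are made
  nonnegative. The second pairs with (1, 0, ..., 0) after coordinate \<open>i\<close> is moved to
  the front with nonnegative sign.\<close>

lemma weight_bounds:
  fixes f :: "'k::field mat \<Rightarrow> 'k"
  assumes inf: "infinite (UNIV :: 'k set)" and r: "r \<le> m"
    and f: "semi_inv m (fund_weight r) f" and wt: "has_weight m \<nu> f"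
    and g: "g \<in> carrier (Sp m)" "f g \<noteq> 0"
  shows "(\<Sum>k<m. \<bar>\<nu> k\<bar>) \<le> int r" and "i < m \<Longrightarrow> \<bar>\<nu> i\<bar> \<le> 1"
proof -
  note \<mu> = fund_weight_weights[OF r]
  have "wt_val m (\<lambda>_. 1) (perm_wt m (\<lambda>i. i) {i. \<nu> i < 0} \<nu>) \<le> wt_val m (\<lambda>_. 1) (fund_weight r)"
    by (rule dominance_sperm[OF inf f wt \<mu> g bij_betw_id_fun]) simp_all
  also have "\<dots> = (\<Sum>k\<in>{..<r}. 1)"
    unfolding wt_val_def fund_weight_def using r by (intro sum.mono_neutral_cong_right) auto
  finally show "(\<Sum>k<m. \<bar>\<nu> k\<bar>) \<le> int r" unfolding wt_val_abs by simp
  assume i: "i < m"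
  define \<pi> where "\<pi> = Transposition.transpose 0 i"
  have perm: "bij_betw \<pi> {..<m} {..<m}"
    unfolding \<pi>_def using i by (intro bij_betw_transpose_iff) auto
  define l :: "nat \<Rightarrow> int" where "l k = (if k = 0 then 1 else 0)" for k
  have 0: "{..<m} = insert 0 {1..<m}" using i by auto
  have wt_l: "wt_val m l \<rho> = \<rho> 0" for \<rho>
    unfolding wt_val_def 0 by (subst sum.insert) (auto simp: l_def intro!: sum.neutral)
  have "wt_val m l (perm_wt m \<pi> {k. \<nu> (\<pi> k) < 0} \<nu>) \<le> wt_val m l (fund_weight r)"
    by (rule dominance_sperm[OF inf f wt \<mu> g perm]) (auto simp: l_def)
  then show "\<bar>\<nu> i\<bar> \<le> 1"
    unfolding wt_l using i by (auto simp: perm_wt_def \<pi>_def fund_weight_def split: if_splits)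
qed

text \<open>For \<open>j \<le> m\<close> this is the Weyl orbit of the fundamental weight number
  \<open>j\<close>, described by coordinates so that it can be counted; it is empty
  otherwise.\<close>

definition unit_weights :: "nat \<Rightarrow> nat \<Rightarrow> (nat \<Rightarrow> int) set" where
  "unit_weights m j = {\<nu> \<in> weights m. (\<forall>i<m. \<bar>\<nu> i\<bar> \<le> 1) \<and> (\<Sum>i<m. \<bar>\<nu> i\<bar>) = int j}"

lemma unit_weights_supp:
  assumes "\<nu> \<in> unit_weights m j"
  shows "card {i. i < m \<and> \<nu> i \<noteq> 0} = j"
proof -
  have "(\<Sum>i<m. \<bar>\<nu> i\<bar>) = (\<Sum>i<m. if \<nu> i \<noteq> 0 then 1 else 0)"
    using assms by (intro sum.cong refl) (force simp: unit_weights_def)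
  also have "\<dots> = int (card {i. i < m \<and> \<nu> i \<noteq> 0})"
    by (simp add: sum.If_cases Int_def)
  finally show ?thesis using assms by (simp add: unit_weights_def)
qed

lemma bij_unit_weights:
  "bij_betw (\<lambda>(S, P) i. if i \<in> P then - 1 else if i \<in> S then 1 else (0::int))
     (Sigma {S. S \<subseteq> {..<m} \<and> card S = j} Pow) (unit_weights m j)"
  (is "bij_betw ?F ?A _")
proof (rule bij_betw_byWitness[where f' = "\<lambda>\<nu>. ({i. \<nu> i \<noteq> 0}, {i. \<nu> i < 0})"])
  show "\<forall>x\<in>?A. ({i. ?F x i \<noteq> 0}, {i. ?F x i < 0}) = x" by auto
  have *: "\<nu> i = -1 \<or> \<nu> i = 0 \<or> \<nu> i = 1" if "\<nu> \<in> unit_weights m j" for \<nu> i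
  proof (cases "i < m")
    case True
    then have "\<bar>\<nu> i\<bar> \<le> 1" using that by (simp add: unit_weights_def)
    then show ?thesis by arith
  next
    case False then show ?thesis using that by (simp add: unit_weights_def weights_def)
  qed
  show "\<forall>\<nu>\<in>unit_weights m j. ?F ({i. \<nu> i \<noteq> 0}, {i. \<nu> i < 0}) = \<nu>"
  proof (intro ballI ext)
    fix \<nu> i assume "\<nu> \<in> unit_weights m j"
    from *[OF this, of i] show "?F ({i. \<nu> i \<noteq> 0}, {i. \<nu> i < 0}) i = \<nu> i" by auto
  qed
  show "?F ` ?A \<subseteq> unit_weights m j"
  proof
    fix \<nu> assume "\<nu> \<in> ?F ` ?A"
    then obtain S P where SP: "S \<subseteq> {..<m}" "card S = j" "P \<subseteq> S" and \<nu>: "\<nu> = ?F (S, P)" by auto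
    have "(\<Sum>i<m. \<bar>\<nu> i\<bar>) = (\<Sum>i<m. if i \<in> S then 1 else 0)"
      using SP by (intro sum.cong refl) (auto simp: \<nu>)
    also have "\<dots> = int j"
      using SP by (simp add: sum.If_cases Int_absorb1)
    finally show "\<nu> \<in> unit_weights m j"
      using SP by (auto simp: unit_weights_def weights_def \<nu>)
  qed
  show "(\<lambda>\<nu>. ({i. \<nu> i \<noteq> 0}, {i. \<nu> i < 0})) ` unit_weights m j \<subseteq> ?A"
  proof
    fix x assume "x \<in> (\<lambda>\<nu>. ({i. \<nu> i \<noteq> 0}, {i. \<nu> i < 0})) ` unit_weights m j"
    then obtain \<nu> :: "nat \<Rightarrow> int" where \<nu>: "\<nu> \<in> unit_weights m j" "x = ({i. \<nu> i \<noteq> 0}, {i. \<nu> i < 0})"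
      by blast
    have "{i. \<nu> i \<noteq> 0} = {i. i < m \<and> \<nu> i \<noteq> 0}"
      using \<nu>(1) by (auto simp: unit_weights_def weights_def) (metis not_le)
    then have "card {i. \<nu> i \<noteq> 0} = j" using unit_weights_supp[OF \<nu>(1)] by (simp only:)
    moreover have "{i. \<nu> i \<noteq> 0} \<subseteq> {..<m}"
      using \<nu>(1) by (auto simp: unit_weights_def weights_def) (metis not_le)
    ultimately show "x \<in> ?A" unfolding \<nu>(2) by auto
  qed
qed

lemma card_unit_weights: "finite (unit_weights m j)" "card (unit_weights m j) = 2 ^ j * (m choose j)"
proof -
  let ?S = "{S. S \<subseteq> {..<m} \<and> card S = j}"
  have fin: "finite ?S" by simp
  have "card (Sigma ?S Pow) = (\<Sum>S\<in>?S. card (Pow S))"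
    using fin finite_subset by (intro card_SigmaI) (auto intro: finite_subset)
  also have "\<dots> = (\<Sum>S\<in>?S. 2 ^ j)"
    by (intro sum.cong refl) (auto simp: card_Pow finite_subset)
  also have "\<dots> = 2 ^ j * (m choose j)"
    using n_subsets[of "{..<m}" j] by simp
  finally show "card (unit_weights m j) = 2 ^ j * (m choose j)"
    unfolding bij_betw_same_card[OF bij_unit_weights, symmetric] .
  have "finite (Sigma ?S Pow)"
    using fin by (intro finite_SigmaI) (auto intro: finite_subset)
  then show "finite (unit_weights m j)"
    using bij_betw_finite[OF bij_unit_weights] by blast
qed

text \<open>\<open>\<pi>\<close> carries the first \<open>j\<close> indices onto the support and the
  others onto its complement; \<open>P\<close> records where a sign has to be changed.\<close>

lemma unit_weight_conjugate:
  assumes \<nu>: "\<nu> \<in> unit_weights m j"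
  obtains \<pi> P where "bij_betw \<pi> {..<m} {..<m}" "perm_wt m \<pi> P \<nu> = fund_weight j" "j \<le> m"
proof -
  define S where "S = {i. i < m \<and> \<nu> i \<noteq> 0}"
  have S: "S \<subseteq> {..<m}" "card S = j" using unit_weights_supp[OF \<nu>] by (auto simp: S_def)
  have finS: "finite S" using S(1) finite_subset by blast
  have jm: "j \<le> m" using card_mono[OF _ S(1)] S(2) by simp
  obtain p1 where p1: "bij_betw p1 {..<j} S"
    using ex_bij_betw_nat_finite[OF finS] S(2) by (auto simp: atLeast0LessThan)
  have "card {j..<m} = card ({..<m} - S)"
    using S finS by (simp add: card_Diff_subset)
  then obtain p2 where p2: "bij_betw p2 {j..<m} ({..<m} - S)"
    using finite_same_card_bij[of "{j..<m}" "{..<m} - S"] by auto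
  define \<pi> where "\<pi> i = (if i \<in> {..<j} then p1 i else p2 i)" for i
  have "bij_betw \<pi> ({..<j} \<union> {j..<m}) (S \<union> ({..<m} - S))"
    unfolding \<pi>_def by (rule bij_betw_disjoint_Un[OF p1 p2]) auto
  moreover have "{..<j} \<union> {j..<m} = {..<m}" "S \<union> ({..<m} - S) = {..<m}" using jm S by auto
  ultimately have \<pi>: "bij_betw \<pi> {..<m} {..<m}" by simp
  have "perm_wt m \<pi> {i. \<nu> (\<pi> i) < 0} \<nu> i = fund_weight j i" for i
  proof (cases "i < m")
    case True
    then have pm: "\<pi> i < m" using \<pi> by (auto simp: bij_betw_def)
    have "\<pi> i \<in> S \<longleftrightarrow> i < j"
      using True bij_betw_apply[OF p1, of i] bij_betw_apply[OF p2, of i]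
      by (cases "i < j") (simp_all add: \<pi>_def)
    then have "\<nu> (\<pi> i) \<noteq> 0 \<longleftrightarrow> i < j" using pm by (simp add: S_def)
    moreover have "\<bar>\<nu> (\<pi> i)\<bar> \<le> 1" using \<nu> pm by (simp add: unit_weights_def)
    ultimately show ?thesis using True by (auto simp: perm_wt_def fund_weight_def)
  next
    case False
    then show ?thesis using jm by (simp add: perm_wt_def fund_weight_def)
  qed
  then show ?thesis using that[OF \<pi> _ jm] by blast
qed

section \<open>Counting monomials of a given weight\<close>

text \<open>The monomials left over by \<open>restrict_to_unip\<close> for a vector of weight
  \<open>fund_weight j\<close> in the module induced from \<open>fund_weight r\<close>.\<close>

definition weight_lists :: "nat \<Rightarrow> nat \<Rightarrow> nat \<Rightarrow> (nat \<times> nat) list set" where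
  "weight_lists m r j = {xs. set xs \<subseteq> lower_pairs m r \<and>
     conj_wt m xs = (\<lambda>k. fund_weight j k - fund_weight r k)}"

text \<open>The number of lists of length at most \<open>2 * r * r\<close> whose entries are pairs
  from a set of \<open>4 * r\<close> indices. The two numbers come from
  \<open>weight_lists_length\<close> and \<open>card_index_box\<close>.\<close>

definition list_const :: "nat \<Rightarrow> nat" where
  "list_const r = (\<Sum>i\<le>2 * r * r. ((4 * r) * (4 * r)) ^ i)"

lemma wt_val_fund_weight:
  assumes "r \<le> m"
  shows "wt_val m l (fund_weight r) = (\<Sum>k<r. l k)"
  unfolding wt_val_def fund_weight_def using assms by (intro sum.mono_neutral_cong_right) auto

lemma weight_lists_sum:
  assumes "xs \<in> weight_lists m r j" "j \<le> r" "r \<le> m"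
  shows "(\<Sum>p\<leftarrow>xs. case p of (a, b) \<Rightarrow> ext_wt m l a - ext_wt m l b) = (\<Sum>k<j. l k) - (\<Sum>k<r. l k)"
proof -
  have "set xs \<subseteq> {..<2*m} \<times> {..<2*m}"
    using assms(1) lower_pairs_subset unfolding weight_lists_def by blast
  from wt_val_conj[OF this, of l] show ?thesis
    using assms by (simp add: weight_lists_def wt_val_add wt_val_fund_weight)
qed

text \<open>The cocharacter \<open>l\<close> is strictly decreasing and positive on the first
  \<open>r\<close> coordinates and 0 on the middle ones. Pairs inside the middle block being
  excluded, each position still lowers the pairing by at least 1, so the length is at most the total
  drop, whatever \<open>m\<close> is.\<close>

lemma weight_lists_length:
  assumes "xs \<in> weight_lists m r j" "j \<le> r" "r \<le> m"
  shows "length xs \<le> 2 * r * r" and "j = r \<Longrightarrow> xs = []"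
proof -
  define l where "l k = (if k < r then 2 * int r - int k else 0)" for k
  have "(\<Sum>p\<leftarrow>xs. case p of (a, b) \<Rightarrow> ext_wt m l a - ext_wt m l b) \<le> (- 1) * int (length xs)"
  proof (rule sum_list_le_const)
    fix p assume "p \<in> set xs"
    then have "p \<in> lower_pairs m r" using assms(1) by (auto simp: weight_lists_def)
    then show "(case p of (a, b) \<Rightarrow> ext_wt m l a - ext_wt m l b) \<le> - 1"
      using assms(3) by (auto simp: lower_pairs_def ext_wt_def l_def opp_def)
  qed
  then have len: "int (length xs) \<le> (\<Sum>k<r. l k) - (\<Sum>k<j. l k)"
    unfolding weight_lists_sum[OF assms] by simp
  show "xs = []" if "j = r" using len that by simp
  have "(\<Sum>k<r. l k) \<le> (\<Sum>k<r. 2 * int r)" by (intro sum_mono) (simp add: l_def)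
  moreover have "0 \<le> (\<Sum>k<j. l k)" using assms(2) by (intro sum_nonneg) (simp add: l_def)
  ultimately have "int (length xs) \<le> int (2 * r * r)" using len by simp
  then show "length xs \<le> 2 * r * r" by linarith
qed

definition mid_support :: "nat \<Rightarrow> nat \<Rightarrow> (nat \<times> nat) list \<Rightarrow> nat set" where
  "mid_support m r xs = {k \<in> {r..<m}. \<exists>(a, b)\<in>set xs. eps m a k - eps m b k \<noteq> 0}"

text \<open>The entries other than one chosen occurrence of \<open>x\<close> sum to
  \<open>- x\<close>, so they contribute at least \<open>\<bar>x\<bar>\<close> again.\<close>

lemma sum_list_abs_ge_two:
  fixes xs :: "int list"
  assumes "sum_list xs = 0" "x \<in> set xs" "x \<noteq> 0"
  shows "2 \<le> (\<Sum>x\<leftarrow>xs. \<bar>x\<bar>)"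
proof -
  obtain ys zs where xs: "xs = ys @ x # zs" using assms(2) by (meson split_list)
  have "\<bar>sum_list (ys @ zs)\<bar> \<le> (\<Sum>x\<leftarrow>ys @ zs. \<bar>x\<bar>)" by (rule sum_list_abs)
  moreover have "sum_list (ys @ zs) = - x" using assms(1) by (simp add: xs)
  ultimately show ?thesis using assms(3) by (simp add: xs)
qed

text \<open>An index outside the first \<open>r\<close> coordinates has total weight 0, so it must occur twice, while
  each of its occurrences lowers the sum of the first \<open>r\<close> coordinates.\<close>

lemma card_mid_support:
  assumes xs: "xs \<in> weight_lists m r j" and jr: "j \<le> r" "r \<le> m"
  shows "2 * card (mid_support m r xs) \<le> r - j"
proof -
  let ?A = "mid_support m r xs"
  define l :: "nat \<Rightarrow> int" where "l k = (if k < r then 1 else 0)" for k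
  define c where "c k p = (case p of (a, b) \<Rightarrow> eps m a k - eps m b k)" for k p
  have fin: "finite ?A" by (simp add: mid_support_def)
  have two: "2 \<le> (\<Sum>p\<leftarrow>xs. \<bar>c k p\<bar>)" if k: "k \<in> ?A" for k
  proof -
    have "conj_wt m xs k = 0"
      using k xs jr by (simp add: weight_lists_def mid_support_def fund_weight_def)
    then have "sum_list (map (c k) xs) = 0"
      by (simp add: conj_wt_def c_def[abs_def])
    moreover obtain p where "p \<in> set xs" "c k p \<noteq> 0"
      using k by (force simp: mid_support_def c_def)
    ultimately show ?thesis
      using sum_list_abs_ge_two[of "map (c k) xs" "c k p"] by (simp add: comp_def)
  qed
  have swap: "(\<Sum>k\<in>?A. \<Sum>p\<leftarrow>zs. \<bar>c k p\<bar>) = (\<Sum>p\<leftarrow>zs. \<Sum>k\<in>?A. \<bar>c k p\<bar>)" for zs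
    by (induction zs) (simp_all add: sum.distrib)
  have one: "(\<Sum>k\<in>?A. if k = a then 1 else 0 :: int) \<le> 1" for a
    using fin by simp
  \<comment> \<open>A position has at most one index in the middle range. If it has one, its other
    index is an outer one and the pairing with \<open>l\<close> drops by exactly 1; if it has none,
    it contributes nothing to the middle support.\<close>
  have pair: "(\<Sum>k\<in>?A. \<bar>c k p\<bar>) \<le> (case p of (a, b) \<Rightarrow> - (ext_wt m l a - ext_wt m l b))"
    if p: "p \<in> set xs" for p
  proof -
    obtain a b where ab: "p = (a, b)" by force
    have lp: "b < a" "a < 2 * m" "\<not> (r \<le> b \<and> a < 2 * m - r)"
      using p xs by (auto simp: weight_lists_def lower_pairs_def ab)
    have kA: "r \<le> k" "k < m" if "k \<in> ?A" for k using that by (auto simp: mid_support_def)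
    have out: "eps m i k = 0" if "k \<in> ?A" "i < r \<or> 2 * m - r \<le> i" "i < 2 * m" for i k
      using kA[OF that(1)] that(2,3) jr by (auto simp: eps_def opp_def)
    have abs_eps: "\<bar>eps m i k\<bar> \<le> (if k = (if i < m then i else opp m i) then 1 else 0)" for i k
      by (simp add: eps_def)
    have sum_eps: "(\<Sum>k\<in>?A. \<bar>eps m i k\<bar>) \<le> 1" for i
      by (rule order_trans[OF sum_mono[OF abs_eps] one])
    consider "r \<le> a" "a < 2 * m - r" "b < r" | "2 * m - r \<le> a" "r \<le> b" "b < 2 * m - r"
      | "a < r \<or> 2 * m - r \<le> a" "b < r \<or> 2 * m - r \<le> b"
      using lp by linarith
    then show ?thesis
    proof cases
      case 1
      have "(\<Sum>k\<in>?A. \<bar>c k p\<bar>) = (\<Sum>k\<in>?A. \<bar>eps m a k\<bar>)"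
        using out[of _ b] 1 lp by (intro sum.cong refl) (simp add: c_def ab)
      moreover have "ext_wt m l a = 0" "ext_wt m l b = 1"
        using 1 lp jr by (auto simp: ext_wt_def l_def opp_def)
      ultimately show ?thesis using sum_eps[of a] by (simp add: ab)
    next
      case 2
      have "(\<Sum>k\<in>?A. \<bar>c k p\<bar>) = (\<Sum>k\<in>?A. \<bar>eps m b k\<bar>)"
        using out[of _ a] 2 lp by (intro sum.cong refl) (simp add: c_def ab)
      moreover have "ext_wt m l a = - 1" "ext_wt m l b = 0"
        using 2 lp jr by (auto simp: ext_wt_def l_def opp_def)
      ultimately show ?thesis using sum_eps[of b] by (simp add: ab)
    next
      case 3
      have "(\<Sum>k\<in>?A. \<bar>c k p\<bar>) = 0"
        using out[of _ a] out[of _ b] 3 lp by (intro sum.neutral ballI) (simp add: c_def ab)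
      moreover have "ext_wt m l a \<le> ext_wt m l b"
        using lp by (intro ext_wt_antimono) (auto simp: l_def)
      ultimately show ?thesis by (simp add: ab)
    qed
  qed
  have "2 * int (card ?A) \<le> (\<Sum>k\<in>?A. \<Sum>p\<leftarrow>xs. \<bar>c k p\<bar>)"
    using sum_mono[of ?A "\<lambda>_. 2" "\<lambda>k. \<Sum>p\<leftarrow>xs. \<bar>c k p\<bar>"] two by simp
  also have "\<dots> \<le> (\<Sum>p\<leftarrow>xs. case p of (a, b) \<Rightarrow> - (ext_wt m l a - ext_wt m l b))"
    unfolding swap by (rule sum_list_mono) (rule pair)
  also have "\<dots> = - (\<Sum>p\<leftarrow>xs. case p of (a, b) \<Rightarrow> ext_wt m l a - ext_wt m l b)"
    by (induction xs) auto
  also have "\<dots> = int r - int j"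
    unfolding weight_lists_sum[OF xs jr] using jr by (simp add: l_def)
  finally show ?thesis using jr by linarith
qed

text \<open>The outer indices are always allowed; of the middle ones only those listed in
  \<open>ys\<close>, up to opposites. With \<open>ys\<close> given, the number of available indices
  is bounded independently of \<open>m\<close>.\<close>

definition index_box :: "nat \<Rightarrow> nat \<Rightarrow> nat list \<Rightarrow> nat set" where
  "index_box m r ys = {..<r} \<union> {2 * m - r..<2 * m} \<union> set ys \<union> opp m ` set ys"

lemma weight_lists_box:
  assumes xs: "xs \<in> weight_lists m r j" and jr: "j \<le> r" "r \<le> m"
  obtains ys where "set ys \<subseteq> {..m}" "length ys = (r - j) div 2"
    "set xs \<subseteq> index_box m r ys \<times> index_box m r ys"
proof -
  let ?A = "mid_support m r xs"
  have fin: "finite ?A" by (simp add: mid_support_def)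
  \<comment> \<open>Padding with the dummy value \<open>m\<close> gives all the lists the same
    length, so they are counted as lists of fixed length over \<open>m + 1\<close> values. Extra
    indices only enlarge the box.\<close>
  define ys where "ys = sorted_list_of_set ?A @ replicate ((r - j) div 2 - card ?A) m"
  have card: "card ?A \<le> (r - j) div 2" using card_mid_support[OF assms] by simp
  have len: "length ys = (r - j) div 2" using card by (simp add: ys_def)
  have sub: "set ys \<subseteq> {..m}" using fin by (auto simp: ys_def mid_support_def)
  have A: "?A \<subseteq> set ys" using fin by (simp add: ys_def)
  have box: "i \<in> index_box m r ys"
    if i: "i < 2 * m" and mid: "r \<le> i \<Longrightarrow> i < 2 * m - r \<Longrightarrow> (if i < m then i else opp m i) \<in> ?A" for i
  proof (cases "r \<le> i \<and> i < 2 * m - r")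
    case True
    then have *: "(if i < m then i else opp m i) \<in> set ys" using mid A by blast
    show ?thesis
    proof (cases "i < m")
      case True then show ?thesis using * by (simp add: index_box_def)
    next
      case False
      then have "opp m i \<in> set ys" using * by simp
      then have "opp m (opp m i) \<in> opp m ` set ys" by blast
      then show ?thesis using i by (simp add: index_box_def)
    qed
  next
    case False
    then show ?thesis using i by (auto simp: index_box_def)
  qed
  have "p \<in> index_box m r ys \<times> index_box m r ys" if p: "p \<in> set xs" for p
  proof -
    obtain a b where ab: "p = (a, b)" by force
    have lp: "b < a" "a < 2 * m" "\<not> (r \<le> b \<and> a < 2 * m - r)"
      using p xs by (auto simp: weight_lists_def lower_pairs_def ab)
    have a: "(if a < m then a else opp m a) \<in> ?A" if "r \<le> a" "a < 2 * m - r"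
    proof -
      have "b < r" using lp that by simp
      then have "eps m a (if a < m then a else opp m a) - eps m b (if a < m then a else opp m a) \<noteq> 0"
        "(if a < m then a else opp m a) \<in> {r..<m}"
        using that jr lp by (auto simp: eps_def opp_def)
      then show ?thesis using p unfolding mid_support_def ab by blast
    qed
    have b: "(if b < m then b else opp m b) \<in> ?A" if "r \<le> b" "b < 2 * m - r"
    proof -
      have "2 * m - r \<le> a" using lp that by simp
      then have "eps m a (if b < m then b else opp m b) - eps m b (if b < m then b else opp m b) \<noteq> 0"
        "(if b < m then b else opp m b) \<in> {r..<m}"
        using that jr lp by (auto simp: eps_def opp_def)
      then show ?thesis using p unfolding mid_support_def ab by blast
    qed
    show ?thesis using box[OF lp(2) a] box[OF _ b] lp by (simp add: ab)
  qed
  then show ?thesis using that[OF sub len] by blast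
qed

lemma card_index_box:
  assumes "2 * length ys \<le> 2 * r" "r \<le> m"
  shows "finite (index_box m r ys)" "card (index_box m r ys) \<le> 4 * r"
proof -
  show "finite (index_box m r ys)" by (simp add: index_box_def)
  have "card (index_box m r ys) \<le> card {..<r} + card {2 * m - r..<2 * m} + card (set ys) + card (opp m ` set ys)"
    unfolding index_box_def by (intro order_trans[OF card_Un_le] add_mono order_refl)
  also have "\<dots> \<le> r + r + length ys + length ys"
    using assms card_image_le[of "set ys" "opp m"] card_length[of ys] by (intro add_mono) auto
  finally show "card (index_box m r ys) \<le> 4 * r" using assms by simp
qed

text \<open>The case \<open>j = r\<close> is kept apart because there only the empty monomial is
  left. Its exact multiplicity 1 fixes the leading constant, whereas \<open>list_const r\<close>
  would spoil it.\<close>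

definition mult_bound :: "nat \<Rightarrow> nat \<Rightarrow> nat \<Rightarrow> nat" where
  "mult_bound m r j = (if j = r then 1 else list_const r * (m + 1) ^ ((r - j) div 2))"

lemma card_weight_lists:
  assumes jr: "j \<le> r" "r \<le> m"
  shows "finite (weight_lists m r j)" "card (weight_lists m r j) \<le> mult_bound m r j"
proof -
  define h where "h = (r - j) div 2"
  define Y where "Y = {ys. set ys \<subseteq> {..m} \<and> length ys = h}"
  define X where "X ys = {xs. set xs \<subseteq> index_box m r ys \<times> index_box m r ys \<and> length xs \<le> 2 * r * r}" for ys
  have finY: "finite Y" unfolding Y_def by (rule finite_lists_length_eq) simp
  have cardY: "card Y = (m + 1) ^ h" unfolding Y_def by (subst card_lists_length_eq) simp_all
  have X: "finite (X ys)" "card (X ys) \<le> list_const r" if "ys \<in> Y" for ys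
  proof -
    have "2 * length ys \<le> 2 * r" using that by (simp add: Y_def h_def)
    note box = card_index_box[OF this jr(2)]
    have fin: "finite (index_box m r ys \<times> index_box m r ys)" using box by blast
    show "finite (X ys)" unfolding X_def by (rule finite_lists_length_le[OF fin])
    have "card (X ys) = (\<Sum>i\<le>2 * r * r. card (index_box m r ys \<times> index_box m r ys) ^ i)"
      unfolding X_def by (rule card_lists_length_le[OF fin])
    also have "\<dots> \<le> list_const r"
      unfolding list_const_def card_cartesian_product
      using box(2) by (intro sum_mono power_mono mult_mono) simp_all
    finally show "card (X ys) \<le> list_const r" .
  qed
  have sub: "weight_lists m r j \<subseteq> (\<Union>ys\<in>Y. X ys)"
  proof
    fix xs assume xs: "xs \<in> weight_lists m r j"
    obtain ys where "set ys \<subseteq> {..m}" "length ys = h"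
      "set xs \<subseteq> index_box m r ys \<times> index_box m r ys"
      using weight_lists_box[OF xs jr] unfolding h_def by blast
    then show "xs \<in> (\<Union>ys\<in>Y. X ys)"
      using weight_lists_length(1)[OF xs jr] by (auto simp: X_def Y_def)
  qed
  have finU: "finite (\<Union>ys\<in>Y. X ys)" using finY X by blast
  show "finite (weight_lists m r j)" using finite_subset[OF sub finU] .
  show "card (weight_lists m r j) \<le> mult_bound m r j"
  proof (cases "j = r")
    case True
    then have "weight_lists m r j \<subseteq> {[]}" using weight_lists_length(2)[OF _ jr] by blast
    then show ?thesis using card_mono[of "{[]}" "weight_lists m r j"] True by (simp add: mult_bound_def)
  next
    case False
    have "card (weight_lists m r j) \<le> card (\<Union>ys\<in>Y. X ys)" by (rule card_mono[OF finU sub])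
    also have "\<dots> \<le> (\<Sum>ys\<in>Y. card (X ys))" by (rule card_UN_le[OF finY])
    also have "\<dots> \<le> (\<Sum>ys\<in>Y. list_const r)" by (intro sum_mono X)
    also have "\<dots> = list_const r * (m + 1) ^ h" by (simp add: cardY)
    finally show ?thesis using False by (simp add: mult_bound_def h_def)
  qed
qed

section \<open>The dimension of the induced module\<close>

lemma semi_inv_cong:
  assumes eq: "\<And>g. g \<in> carrier (Sp m) \<Longrightarrow> f g = f' g" and f': "semi_inv m \<mu> f'"
  shows "semi_inv m \<mu> f"
  unfolding semi_inv_def
proof
  show "\<exists>q\<in>entry_polys (2 * m). \<forall>g\<in>carrier (Sp m). f g = q g"
    using semi_inv_poly[OF f'] by (simp add: eq)
  show "\<forall>g\<in>carrier (Sp m). \<forall>b\<in>borel_Sp m. f (g * b) = weight_char m \<mu> b * f g"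
  proof (intro ballI)
    fix g b :: "'a mat" assume g: "g \<in> carrier (Sp m)" and b: "b \<in> borel_Sp m"
    have "g * b \<in> carrier (Sp m)" using g b by (intro Sp_mult_closed) (simp_all add: borel_Sp_def)
    then show "f (g * b) = weight_char m \<mu> b * f g"
      using semi_inv_borel[OF f' g b] by (simp add: eq g)
  qed
qed

lemma has_weight_cong:
  assumes eq: "\<And>g. g \<in> carrier (Sp m) \<Longrightarrow> f g = f' g" and f': "has_weight m \<nu> f'"
  shows "has_weight m \<nu> f"
  unfolding has_weight_def
proof (intro allI impI ballI)
  fix t :: "nat \<Rightarrow> 'a" and g :: "'a mat" assume t: "\<forall>i. t i \<noteq> 0" and g: "g \<in> carrier (Sp m)"
  then have "torus_mat m t * g \<in> carrier (Sp m)"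
    by (intro Sp_mult_closed torus_mat_closed) simp_all
  then show "f (torus_mat m t * g) = tchar m \<nu> t * f g"
    using has_weightD[OF f', of t g] t g by (simp add: eq)
qed

definition sp_restrict :: "nat \<Rightarrow> ('k::field mat \<Rightarrow> 'k) \<Rightarrow> 'k mat \<Rightarrow> 'k" where
  "sp_restrict m f = (\<lambda>g. if g \<in> carrier (Sp m) then f g else 0)"

lemma sp_restrict_apply [simp]: "g \<in> carrier (Sp m) \<Longrightarrow> sp_restrict m f g = f g"
  by (simp add: sp_restrict_def)

lemma induced_iff:
  "f \<in> mspace (induced_module m \<mu>) \<longleftrightarrow> semi_inv m \<mu> f \<and> (\<forall>g. g \<notin> carrier (Sp m) \<longrightarrow> f g = 0)"
  by (auto simp: induced_module_def semi_inv_def coord_ring_def)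

lemma sp_restrict_induced: "semi_inv m \<mu> f \<Longrightarrow> sp_restrict m f \<in> mspace (induced_module m \<mu>)"
  unfolding induced_iff using semi_inv_cong[of m "sp_restrict m f" f \<mu>] by (simp add: sp_restrict_def)

lemma semi_inv_add:
  assumes f: "semi_inv m \<mu> f" and g: "semi_inv m \<mu> g"
  shows "semi_inv m \<mu> (\<lambda>x. f x + g x)"
proof -
  obtain p q where "p \<in> entry_polys (2 * m)" "\<forall>x\<in>carrier (Sp m). f x = p x"
    "q \<in> entry_polys (2 * m)" "\<forall>x\<in>carrier (Sp m). g x = q x"
    using semi_inv_poly[OF f] semi_inv_poly[OF g] by blast
  then have "\<exists>q\<in>entry_polys (2 * m). \<forall>x\<in>carrier (Sp m). f x + g x = q x"
    by (intro bexI[of _ "\<lambda>x. p x + q x"] entry_polys.add) simp_all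
  then show ?thesis
    using semi_inv_borel[OF f] semi_inv_borel[OF g] by (simp add: semi_inv_def algebra_simps)
qed

lemma semi_inv_cmult:
  assumes f: "semi_inv m \<mu> f"
  shows "semi_inv m \<mu> (\<lambda>x. c * f x)"
proof -
  obtain p where "p \<in> entry_polys (2 * m)" "\<forall>x\<in>carrier (Sp m). f x = p x"
    using semi_inv_poly[OF f] by blast
  then have "\<exists>q\<in>entry_polys (2 * m). \<forall>x\<in>carrier (Sp m). c * f x = q x"
    by (intro bexI[of _ "\<lambda>x. c * p x"] entry_polys_cmult) simp_all
  then show ?thesis using semi_inv_borel[OF f] by (simp add: semi_inv_def algebra_simps)
qed

lemma semi_inv_zero: "semi_inv m \<mu> (\<lambda>_. 0)"
  unfolding semi_inv_def by (auto intro: bexI[OF _ entry_polys.const[of 0]])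

lemma subspace_induced: "fun_vs.subspace (mspace (induced_module m \<mu>))"
  unfolding fun_vs.subspace_def
  by (auto simp: induced_iff zero_fun_def plus_fun_def fscale_def semi_inv_zero semi_inv_add semi_inv_cmult)

definition weight_space :: "nat \<Rightarrow> (nat \<Rightarrow> int) \<Rightarrow> (nat \<Rightarrow> int) \<Rightarrow> ('k::field mat \<Rightarrow> 'k) set" where
  "weight_space m \<mu> \<nu> = {f \<in> mspace (induced_module m \<mu>). has_weight m \<nu> f}"

lemma has_weight_add_cmult:
  "has_weight m \<nu> f \<Longrightarrow> has_weight m \<nu> g \<Longrightarrow> has_weight m \<nu> (\<lambda>x. f x + g x)"
  "has_weight m \<nu> f \<Longrightarrow> has_weight m \<nu> (\<lambda>x. c * f x)"
  "has_weight m \<nu> (\<lambda>_. 0)"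
  by (simp_all add: has_weight_def algebra_simps)

lemma subspace_weight_space: "fun_vs.subspace (weight_space m \<mu> \<nu>)"
proof -
  note H = fun_subspaceD[OF subspace_induced[of m \<mu>]]
  have "(0 :: 'a mat \<Rightarrow> 'a) \<in> weight_space m \<mu> \<nu>"
    using H(1) by (simp add: weight_space_def zero_fun_def has_weight_add_cmult(3))
  moreover have "f + g \<in> weight_space m \<mu> \<nu>" if "f \<in> weight_space m \<mu> \<nu>" "g \<in> weight_space m \<mu> \<nu>"
    for f g :: "'a mat \<Rightarrow> 'a"
    using that H(2)[of f g] has_weight_add_cmult(1)[of m \<nu> f g] by (simp add: weight_space_def plus_fun_def)
  moreover have "fscale c f \<in> weight_space m \<mu> \<nu>" if "f \<in> weight_space m \<mu> \<nu>"
    for c and f :: "'a mat \<Rightarrow> 'a"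
    using that H(3)[of f c] has_weight_add_cmult(2)[of m \<nu> f c] by (simp add: weight_space_def fscale_def)
  ultimately show ?thesis unfolding fun_vs.subspace_def by blast
qed

lemma terms_fun_in_span:
  "(\<And>c xs. (c, xs) \<in> set l \<Longrightarrow> xs \<in> L) \<Longrightarrow>
    (\<lambda>u. if u \<in> X then terms_fun l u else 0) \<in> fun_vs.span ((\<lambda>xs u. if u \<in> X then monom_fun xs u else 0) ` L)"
proof (induction l)
  case Nil
  let ?t = "\<lambda>l u. if u \<in> X then terms_fun l u else 0"
  have "?t [] = 0" by (simp add: fun_eq_iff)
  then show ?case by (simp only: fun_vs.span_zero)
next
  case (Cons p l)
  let ?t = "\<lambda>l u. if u \<in> X then terms_fun l u else 0"
  let ?m = "\<lambda>xs u. if u \<in> X then monom_fun xs u else 0"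
  obtain c xs where p: "p = (c, xs)" by force
  have "?t (p # l) = fscale c (?m xs) + ?t l"
    by (simp add: fun_eq_iff p)
  moreover have "?t l \<in> fun_vs.span (?m ` L)"
    by (rule Cons.IH, erule Cons.prems[OF list.set_intros(2)])
  moreover have "xs \<in> L" using Cons.prems[of c xs] by (simp add: p)
  then have "fscale c (?m xs) \<in> fun_vs.span (?m ` L)"
    by (intro fun_vs.span_scale fun_vs.span_base imageI)
  ultimately show ?case by (simp only: fun_vs.span_add)
qed

text \<open>Translation by a signed permutation matrix moves \<open>\<nu>\<close> to
  \<open>fund_weight j\<close>. Restriction to \<open>unip m r\<close> is then injective, and its
  image lies in the span of the monomials counted by \<open>weight_lists m r j\<close>.\<close>

lemma weight_space_dim:
  assumes inf: "infinite (UNIV :: 'k::field set)" and \<nu>: "\<nu> \<in> unit_weights m j" and jr: "j \<le> r" "r \<le> m"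
  obtains B :: "('k::field mat \<Rightarrow> 'k) set" where "finite B" "card B \<le> mult_bound m r j"
    "weight_space m (fund_weight r) \<nu> = fun_vs.span B"
proof -
  obtain \<pi> P where perm: "bij_betw \<pi> {..<m} {..<m}" and conj: "perm_wt m \<pi> P \<nu> = fund_weight j"
    using unit_weight_conjugate[OF \<nu>] by blast
  define N where "N = (sperm_mat m \<pi> P :: 'k mat)"
  have N: "N \<in> carrier (Sp m)" unfolding N_def by (rule sperm_mat_closed[OF perm])
  define T where "T f = (\<lambda>u. if u \<in> unip m r then f (N * u) else 0)" for f :: "'k mat \<Rightarrow> 'k"
  define C :: "('k mat \<Rightarrow> 'k) set" where
    "C = (\<lambda>xs u. if u \<in> unip m r then monom_fun xs u else 0) ` weight_lists m r j"
  have finC: "finite C" "card C \<le> mult_bound m r j"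
    using card_weight_lists[OF jr] card_image_le[OF card_weight_lists(1)[OF jr]] order_trans
    unfolding C_def by blast+
  have semi: "semi_inv m (fund_weight r) (\<lambda>g. f (N * g))" if "f \<in> weight_space m (fund_weight r) \<nu>" for f
    using that semi_inv_translate[OF _ N] by (simp add: weight_space_def induced_iff)
  have lin: "Vector_Spaces.linear fscale fscale T"
    by (rule fscale_linearI) (auto simp: T_def fun_eq_iff)
  have inj: "f = 0" if f: "f \<in> weight_space m (fund_weight r) \<nu>" and Tf: "T f = 0" for f
  proof
    fix g show "f g = 0 g"
    proof (cases "g \<in> carrier (Sp m)")
      case True
      have "f (N * u) = 0" if "u \<in> unip m r" for u
        using fun_cong[OF Tf, of u] that by (simp add: T_def)
      then have "f (N * (symp_inverse m N * g)) = 0"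
        using vanish_on_unip_fund_weight[OF inf jr(2) semi[OF f] _
            Sp_mult_closed[OF symp_inverse_closed(1)[OF N] True]] by blast
      then show ?thesis by (simp add: left_cancel_inverse[OF N True])
    next
      case False
      then show ?thesis using f by (simp add: weight_space_def induced_iff)
    qed
  qed
  have image: "T ` weight_space m (fund_weight r) \<nu> \<subseteq> fun_vs.span C"
  proof
    fix h assume "h \<in> T ` weight_space m (fund_weight r) \<nu>"
    then obtain f where f: "f \<in> weight_space m (fund_weight r) \<nu>" "h = T f" by blast
    have "has_weight m (perm_wt m \<pi> P \<nu>) (\<lambda>g. f (N * g))"
      unfolding N_def using f(1) by (intro has_weight_sperm[OF perm]) (simp add: weight_space_def)
    then have wt: "has_weight m (fund_weight j) (\<lambda>g. f (N * g))" by (simp only: conj)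
    have jm: "j \<le> m" using jr by simp
    obtain l where l: "\<And>c xs. (c, xs) \<in> set l \<Longrightarrow> set xs \<subseteq> lower_pairs m r \<and>
        conj_wt m xs = (\<lambda>k. fund_weight j k - fund_weight r k)"
      "\<And>u. u \<in> unip m r \<Longrightarrow> f (N * u) = terms_fun l u"
      using restrict_to_unip[OF inf semi[OF f(1)] wt fund_weight_weights[OF jr(2)] fund_weight_weights[OF jm], of r]
      by blast
    have "h = (\<lambda>u. if u \<in> unip m r then terms_fun l u else 0)"
      by (simp add: f(2) T_def fun_eq_iff l(2))
    then show "h \<in> fun_vs.span C"
      using terms_fun_in_span[of l "weight_lists m r j" "unip m r"] l(1)
      unfolding C_def weight_lists_def by blast
  qed
  show ?thesis
  proof (rule finite_span_if_injective[OF subspace_weight_space lin inj finC(1) image])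
    fix B :: "('k mat \<Rightarrow> 'k) set"
    assume "finite B" "card B \<le> card C" "weight_space m (fund_weight r) \<nu> = fun_vs.span B"
    then show ?thesis by (intro that[of B]) (use finC(2) in simp_all)
  qed
qed

definition induced_dim_bound :: "nat \<Rightarrow> nat \<Rightarrow> nat" where
  "induced_dim_bound m r = (\<Sum>j\<le>r. 2 ^ j * (m choose j) * mult_bound m r j)"

lemma nonzero_weight_unit:
  fixes f :: "'k::field mat \<Rightarrow> 'k"
  assumes inf: "infinite (UNIV :: 'k set)" and r: "r \<le> m"
    and f: "semi_inv m (fund_weight r) f" and wt: "has_weight m \<nu> f" and \<nu>: "\<nu> \<in> weights m"
    and g: "g \<in> carrier (Sp m)" "f g \<noteq> 0"
  obtains j where "j \<le> r" "\<nu> \<in> unit_weights m j"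
proof
  note b = weight_bounds[OF inf r f wt g]
  have nn: "0 \<le> (\<Sum>k<m. \<bar>\<nu> k\<bar>)" by (intro sum_nonneg) simp
  then show "nat (\<Sum>k<m. \<bar>\<nu> k\<bar>) \<le> r" using b(1) by simp
  show "\<nu> \<in> unit_weights m (nat (\<Sum>k<m. \<bar>\<nu> k\<bar>))"
    using \<nu> b(2) nn by (simp add: unit_weights_def)
qed

text \<open>A component whose weight lies in none of the orbits with \<open>j \<le> r\<close>
  vanishes by \<open>nonzero_weight_unit\<close>, so the bases of finitely many weight spaces span
  the whole module.\<close>

lemma induced_dim_le:
  assumes inf: "infinite (UNIV :: 'k::field set)" and r: "r \<le> m"
  obtains B :: "('k::field mat \<Rightarrow> 'k) set" where "finite B" "card B \<le> induced_dim_bound m r"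
    "mspace (induced_module m (fund_weight r)) = fun_vs.span B"
proof -
  let ?H = "mspace (induced_module m (fund_weight r)) :: ('k mat \<Rightarrow> 'k) set"
  have "\<exists>B::('k mat \<Rightarrow> 'k) set. finite B \<and> card B \<le> mult_bound m r j \<and>
      weight_space m (fund_weight r) \<nu> = fun_vs.span B" if "j \<le> r" "\<nu> \<in> unit_weights m j" for j \<nu>
    using weight_space_dim[OF inf that(2,1) r] by metis
  then obtain B :: "nat \<Rightarrow> (nat \<Rightarrow> int) \<Rightarrow> ('k mat \<Rightarrow> 'k) set"
    where B: "\<And>j \<nu>. j \<le> r \<Longrightarrow> \<nu> \<in> unit_weights m j \<Longrightarrow> finite (B j \<nu>) \<and> card (B j \<nu>) \<le> mult_bound m r j \<and>
      weight_space m (fund_weight r) \<nu> = fun_vs.span (B j \<nu>)"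
    by metis
  define U where "U = (\<Union>j\<in>{..r}. \<Union>\<nu>\<in>unit_weights m j. B j \<nu>)"
  have finU: "finite U"
    unfolding U_def using B card_unit_weights(1) by blast
  have "card U \<le> (\<Sum>j\<le>r. card (\<Union>\<nu>\<in>unit_weights m j. B j \<nu>))"
    unfolding U_def by (rule card_UN_le) simp
  also have "\<dots> \<le> (\<Sum>j\<le>r. \<Sum>\<nu>\<in>unit_weights m j. card (B j \<nu>))"
    by (intro sum_mono card_UN_le card_unit_weights)
  also have "\<dots> \<le> (\<Sum>j\<le>r. \<Sum>\<nu>\<in>unit_weights m j. mult_bound m r j)"
    using B by (intro sum_mono) simp
  also have "\<dots> = induced_dim_bound m r"
    by (simp add: card_unit_weights(2) induced_dim_bound_def)
  finally have cardU: "card U \<le> induced_dim_bound m r" .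
  have sub: "U \<subseteq> ?H"
  proof
    fix f assume "f \<in> U"
    then obtain j \<nu> where "j \<le> r" "\<nu> \<in> unit_weights m j" "f \<in> B j \<nu>" by (auto simp: U_def)
    then have "f \<in> weight_space m (fund_weight r) \<nu>" using B fun_vs.span_base by blast
    then show "f \<in> ?H" by (simp add: weight_space_def)
  qed
  have "?H \<subseteq> fun_vs.span U"
  proof
    fix f assume f: "f \<in> ?H"
    then have semi: "semi_inv m (fund_weight r) f" by (simp add: induced_iff)
    obtain \<Lambda> F where \<Lambda>: "finite \<Lambda>" "\<Lambda> \<subseteq> weights m" and F: "\<And>\<nu>. \<nu> \<in> \<Lambda> \<Longrightarrow> semi_inv m (fund_weight r) (F \<nu>)"
      "\<And>\<nu>. \<nu> \<in> \<Lambda> \<Longrightarrow> has_weight m \<nu> (F \<nu>)" and sum: "\<And>g. g \<in> carrier (Sp m) \<Longrightarrow> f g = (\<Sum>\<nu>\<in>\<Lambda>. F \<nu> g)"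
      using weight_decomposition[OF inf semi] by blast
    have "f = (\<Sum>\<nu>\<in>\<Lambda>. sp_restrict m (F \<nu>))"
    proof
      fix g show "f g = (\<Sum>\<nu>\<in>\<Lambda>. sp_restrict m (F \<nu>)) g"
        using sum[of g] f unfolding sum_fun_apply by (cases "g \<in> carrier (Sp m)") (simp_all add: sp_restrict_def induced_iff)
    qed
    also have "\<dots> \<in> fun_vs.span U"
    proof (rule fun_vs.span_sum)
      fix \<nu> assume \<nu>: "\<nu> \<in> \<Lambda>"
      show "sp_restrict m (F \<nu>) \<in> fun_vs.span U"
      proof (cases "\<exists>g\<in>carrier (Sp m). F \<nu> g \<noteq> 0")
        case True
        then obtain g where g: "g \<in> carrier (Sp m)" "F \<nu> g \<noteq> 0" by blast
        have "\<nu> \<in> weights m" using \<nu> \<Lambda>(2) by blast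
        then obtain j where j: "j \<le> r" "\<nu> \<in> unit_weights m j"
          using nonzero_weight_unit[OF inf r F(1)[OF \<nu>] F(2)[OF \<nu>] _ g] by blast
        have "sp_restrict m (F \<nu>) \<in> weight_space m (fund_weight r) \<nu>"
          using sp_restrict_induced[OF F(1)[OF \<nu>]] has_weight_cong[of m "sp_restrict m (F \<nu>)" "F \<nu>" \<nu>] F(2)[OF \<nu>]
          by (simp add: weight_space_def)
        then have "sp_restrict m (F \<nu>) \<in> fun_vs.span (B j \<nu>)" using B[OF j] by blast
        moreover have "B j \<nu> \<subseteq> U" using j by (auto simp: U_def)
        ultimately show ?thesis using fun_vs.span_mono by blast
      next
        case False
        then have "sp_restrict m (F \<nu>) = 0" by (auto simp: sp_restrict_def fun_eq_iff)
        then show ?thesis by (simp only: fun_vs.span_zero)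
      qed
    qed
    finally show "f \<in> fun_vs.span U" .
  qed
  then have "?H = fun_vs.span U"
    using fun_vs.span_minimal[OF sub subspace_induced] by blast
  then show ?thesis using that finU cardU by blast
qed

section \<open>Dimension bounds for simple modules\<close>

lemma rational_moduleD:
  assumes "rational_module m M"
  shows "fun_vs.subspace (mspace M)" "\<exists>B. finite B \<and> mspace M = fun_vs.span B"
    "g \<in> carrier (Sp m) \<Longrightarrow> v \<in> mspace M \<Longrightarrow> maction M g v \<in> mspace M"
    "g \<in> carrier (Sp m) \<Longrightarrow> u \<in> mspace M \<Longrightarrow> v \<in> mspace M \<Longrightarrow>
      maction M g (u + v) = maction M g u + maction M g v"
    "g \<in> carrier (Sp m) \<Longrightarrow> v \<in> mspace M \<Longrightarrow> maction M g (fscale c v) = fscale c (maction M g v)"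
    "v \<in> mspace M \<Longrightarrow> maction M (1\<^sub>m (2 * m)) v = v"
    "g \<in> carrier (Sp m) \<Longrightarrow> h \<in> carrier (Sp m) \<Longrightarrow> v \<in> mspace M \<Longrightarrow>
      maction M (g * h) v = maction M g (maction M h v)"
    "\<phi> \<in> dual_space (mspace M) \<Longrightarrow> v \<in> mspace M \<Longrightarrow>
      (\<lambda>g. if g \<in> carrier (Sp m) then \<phi> (maction M g v) else 0) \<in> coord_ring m"
  using assms unfolding rational_module_def mult_Sp one_Sp by blast+

lemma independent_card_le_dim_span:
  assumes "V = fun_vs.span C" "finite C" "S \<subseteq> V" "fun_vs.independent S"
  shows "card S \<le> fun_vs.dim V"
proof -
  obtain B where B: "B \<subseteq> V" "fun_vs.independent B" "V \<subseteq> fun_vs.span B"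
    using fun_vs.maximal_independent_subset[of V] by blast
  have "finite B" using fun_vs.independent_span_bound[OF assms(2) B(2)] B(1) assms(1) by blast
  then have "card S \<le> card B"
    using fun_vs.independent_span_bound[OF _ assms(4)] assms(3) B(3) by blast
  also have "card B = fun_vs.dim V" by (rule fun_vs.basis_card_eq_dim[OF B(1,3,2)])
  finally show ?thesis .
qed

lemma maction_sum:
  assumes M: "rational_module m M" and g: "g \<in> carrier (Sp m)" and fin: "finite I"
    and w: "\<And>i. i \<in> I \<Longrightarrow> w i \<in> mspace M"
  shows "(\<Sum>i\<in>I. fscale (a i) (w i)) \<in> mspace M \<and>
    maction M g (\<Sum>i\<in>I. fscale (a i) (w i)) = (\<Sum>i\<in>I. fscale (a i) (maction M g (w i)))"
  using fin w
proof (induction I)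
  case empty
  note D = rational_moduleD[OF M]
  have z: "0 \<in> mspace M" using fun_subspaceD(1)[OF D(1)] .
  have "maction M g 0 = maction M g (fscale 0 0)" by (simp only: fun_vs.scale_zero_left)
  also have "\<dots> = fscale 0 (maction M g 0)" by (rule D(5)[OF g z])
  also have "\<dots> = 0" by (simp only: fun_vs.scale_zero_left)
  finally show ?case using z by (simp only: sum.empty simp_thms)
next
  case (insert i I)
  note D = rational_moduleD[OF M]
  have wi: "w i \<in> mspace M" using insert.prems by blast
  have IH: "(\<Sum>i\<in>I. fscale (a i) (w i)) \<in> mspace M"
    "maction M g (\<Sum>i\<in>I. fscale (a i) (w i)) = (\<Sum>i\<in>I. fscale (a i) (maction M g (w i)))"
    using insert.IH insert.prems by blast+
  have sc: "fscale (a i) (w i) \<in> mspace M" by (rule fun_subspaceD(3)[OF D(1) wi])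
  show ?case
    unfolding sum.insert[OF insert.hyps]
    using fun_subspaceD(2)[OF D(1) sc IH(1)] D(4)[OF g sc IH(1)] D(5)[OF g wi] IH(2) by (simp only: simp_thms)
qed

text \<open>A torus element acts on the translate of \<open>v\<close> by a signed permutation matrix
  through its conjugate, so that translate has the conjugate weight.\<close>

lemma highest_weight_conjugate:
  fixes M :: "('k::field, 'i) gmodule"
  assumes M: "rational_module m M" and v: "v \<in> mspace M" "v \<noteq> 0"
    and hw: "\<And>b. b \<in> borel_Sp m \<Longrightarrow> maction M b v = fscale (weight_char m (fund_weight r) b) v"
    and \<nu>: "\<nu> \<in> unit_weights m r"
  shows "\<exists>w\<in>mspace M. w \<noteq> 0 \<and> (\<forall>t. (\<forall>i. t i \<noteq> 0) \<longrightarrow> maction M (torus_mat m t) w = fscale (tchar m \<nu> t) w)"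
proof -
  note D = rational_moduleD[OF M]
  obtain \<pi> P where perm: "bij_betw \<pi> {..<m} {..<m}" and conj: "perm_wt m \<pi> P \<nu> = fund_weight r"
    using unit_weight_conjugate[OF \<nu>] by blast
  define N where "N = (sperm_mat m \<pi> P :: 'k mat)"
  have N: "N \<in> carrier (Sp m)" unfolding N_def by (rule sperm_mat_closed[OF perm])
  define w where "w = maction M N v"
  have w: "w \<in> mspace M" unfolding w_def by (rule D(3)[OF N v(1)])
  have "w \<noteq> 0"
  proof
    assume "w = 0"
    have "v = maction M (symp_inverse m N * N) v"
      by (simp only: symp_inverse_left[OF N] D(6)[OF v(1)])
    also have "\<dots> = maction M (symp_inverse m N) w"
      unfolding w_def by (rule D(7)[OF symp_inverse_closed(1)[OF N] N v(1)])
    also have "w = fscale 0 w" by (simp only: fun_vs.scale_zero_left \<open>w = 0\<close>)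
    also have "maction M (symp_inverse m N) (fscale 0 w) = fscale 0 (maction M (symp_inverse m N) w)"
      by (rule D(5)[OF symp_inverse_closed(1)[OF N] w])
    also have "\<dots> = 0" by (simp only: fun_vs.scale_zero_left)
    finally show False using v(2) by blast
  qed
  moreover have "maction M (torus_mat m t) w = fscale (tchar m \<nu> t) w" if t: "\<forall>i. t i \<noteq> 0" for t
  proof -
    define s where "s i = (if i \<in> P then inverse (t (\<pi> i)) else t (\<pi> i))" for i
    have t0: "\<And>i. t i \<noteq> 0" and s0: "\<And>i. s i \<noteq> 0" using t by (simp_all add: s_def)
    note T = torus_mat_closed[where t = t and m = m, OF t0] and S = torus_mat_closed[where t = s and m = m, OF s0]
    have TN: "torus_mat m t * N = N * torus_mat m s"
      unfolding N_def s_def[abs_def] by (rule torus_mat_sperm_mat[OF perm])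
    have ch: "weight_char m (fund_weight r) (torus_mat m s) = tchar m \<nu> t"
      unfolding weight_char_torus_mat conj[symmetric] perm_wt_def s_def[abs_def] by (rule tchar_signed_perm[OF perm])
    have "maction M (torus_mat m t) w = maction M (torus_mat m t * N) v"
      unfolding w_def by (rule D(7)[OF T N v(1), symmetric])
    also have "\<dots> = maction M N (maction M (torus_mat m s) v)"
      unfolding TN by (rule D(7)[OF N S v(1)])
    also have "maction M (torus_mat m s) v = fscale (tchar m \<nu> t) v"
      unfolding hw[OF torus_mat_borel[where t = s, OF s0]] ch ..
    also have "maction M N (fscale (tchar m \<nu> t) v) = fscale (tchar m \<nu> t) w"
      unfolding w_def by (rule D(5)[OF N v(1)])
    finally show ?thesis .
  qed
  ultimately show ?thesis using w by blast
qed

text \<open>Acting with the powers of one separating torus element turns a linear relation,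
  coordinate by coordinate, into vanishing power sums with distinct nodes.\<close>

lemma torus_eigenvectors_independent:
  fixes M :: "('k::field, 'i) gmodule"
  assumes inf: "infinite (UNIV :: 'k set)" and M: "rational_module m M"
    and \<Lambda>: "finite \<Lambda>" "\<Lambda> \<subseteq> weights m"
    and w: "\<And>\<nu>. \<nu> \<in> \<Lambda> \<Longrightarrow> w \<nu> \<in> mspace M" "\<And>\<nu>. \<nu> \<in> \<Lambda> \<Longrightarrow> w \<nu> \<noteq> 0"
    and eig: "\<And>\<nu> t. \<nu> \<in> \<Lambda> \<Longrightarrow> \<forall>i. t i \<noteq> 0 \<Longrightarrow> maction M (torus_mat m t) (w \<nu>) = fscale (tchar m \<nu> t) (w \<nu>)"
  shows "card \<Lambda> \<le> mdim M"
proof -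
  obtain t :: "nat \<Rightarrow> 'k" where t: "\<And>i. t i \<noteq> 0" "inj_on (\<lambda>\<nu>. tchar m \<nu> t) \<Lambda>"
    using exists_separating_torus_element_weights[OF inf \<Lambda>] by blast
  have scalars: "a \<nu> = 0" if eq: "(\<Sum>\<nu>\<in>\<Lambda>. fscale (a \<nu>) (w \<nu>)) = 0" and \<nu>: "\<nu> \<in> \<Lambda>" for a \<nu>
  proof -
    have pow: "(\<Sum>\<nu>\<in>\<Lambda>. (a \<nu> * w \<nu> z) * tchar m \<nu> t ^ k) = 0" for z k
    proof -
      have tk: "\<And>i. t i ^ k \<noteq> 0" using t(1) by simp
      note T = torus_mat_closed[where t = "\<lambda>i. t i ^ k" and m = m, OF tk]
      have act: "maction M (torus_mat m (\<lambda>i. t i ^ k)) (\<Sum>\<nu>\<in>\<Lambda>. fscale (a \<nu>) (w \<nu>))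
          = (\<Sum>\<nu>\<in>\<Lambda>. fscale (a \<nu>) (maction M (torus_mat m (\<lambda>i. t i ^ k)) (w \<nu>)))"
        using maction_sum[where w = w and a = a, OF M T \<Lambda>(1) w(1)] by blast
      have "maction M (torus_mat m (\<lambda>i. t i ^ k)) 0 = 0"
        using maction_sum[where w = w and a = a, OF M T finite.emptyI] by simp
      then have "(\<Sum>\<nu>\<in>\<Lambda>. fscale (a \<nu>) (maction M (torus_mat m (\<lambda>i. t i ^ k)) (w \<nu>))) = 0"
        using act unfolding eq by (simp only:)
      then have "(\<Sum>\<nu>\<in>\<Lambda>. fscale (a \<nu>) (maction M (torus_mat m (\<lambda>i. t i ^ k)) (w \<nu>))) z = 0"
        by (simp only: zero_fun_apply)
      moreover have "maction M (torus_mat m (\<lambda>i. t i ^ k)) (w \<nu>) = fscale (tchar m \<nu> t ^ k) (w \<nu>)"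
        if "\<nu> \<in> \<Lambda>" for \<nu>
        using eig[OF that, of "\<lambda>i. t i ^ k"] tk unfolding tchar_power by blast
      then have "(\<Sum>\<nu>\<in>\<Lambda>. fscale (a \<nu>) (maction M (torus_mat m (\<lambda>i. t i ^ k)) (w \<nu>))) z
          = (\<Sum>\<nu>\<in>\<Lambda>. (a \<nu> * w \<nu> z) * tchar m \<nu> t ^ k)"
        unfolding sum_fun_apply
        by (intro sum.cong refl) simp
      ultimately show ?thesis by simp
    qed
    obtain z where z: "w \<nu> z \<noteq> 0" using w(2)[OF \<nu>] by (auto simp: fun_eq_iff)
    have "a \<nu> * w \<nu> z = 0"
      by (rule power_sums_zero_imp_coeffs_zero[OF \<Lambda>(1) t(2) pow \<nu>])
    then show ?thesis using z by simp
  qed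
  have inj: "inj_on w \<Lambda>"
  proof (rule inj_onI)
    fix \<nu> \<nu>' assume \<nu>: "\<nu> \<in> \<Lambda>" "\<nu>' \<in> \<Lambda>" and eq: "w \<nu> = w \<nu>'"
    obtain z where z: "w \<nu> z \<noteq> 0" using w(2)[OF \<nu>(1)] by (auto simp: fun_eq_iff)
    have t': "\<forall>i. t i \<noteq> 0" using t(1) by blast
    have "fscale (tchar m \<nu> t) (w \<nu>) = fscale (tchar m \<nu>' t) (w \<nu>)"
      using trans[OF eig[OF \<nu>(1) t', symmetric] eig[OF \<nu>(2) t', folded eq]] .
    then have "fscale (tchar m \<nu> t) (w \<nu>) z = fscale (tchar m \<nu>' t) (w \<nu>) z" by (rule fun_cong)
    then have "tchar m \<nu> t = tchar m \<nu>' t" using z by simp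
    then show "\<nu> = \<nu>'" using t(2) \<nu> by (auto simp: inj_on_def)
  qed
  have "fun_vs.independent (w ` \<Lambda>)"
  proof
    assume "fun_vs.dependent (w ` \<Lambda>)"
    then have "\<exists>f. (\<exists>x\<in>w ` \<Lambda>. f x \<noteq> 0) \<and> (\<Sum>x\<in>w ` \<Lambda>. fscale (f x) x) = 0"
      by (rule iffD1[OF fun_vs.dependent_finite[OF finite_imageI[OF \<Lambda>(1)]]])
    then obtain f where f: "\<exists>x\<in>w ` \<Lambda>. f x \<noteq> 0" "(\<Sum>x\<in>w ` \<Lambda>. fscale (f x) x) = 0"
      by (elim exE conjE)
    have "(\<Sum>\<nu>\<in>\<Lambda>. fscale (f (w \<nu>)) (w \<nu>)) = 0"
      using f(2) unfolding sum.reindex[OF inj] comp_def .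
    then show False using scalars[of "\<lambda>\<nu>. f (w \<nu>)"] f(1) by blast
  qed
  moreover obtain B where "finite B" "mspace M = fun_vs.span B"
    using rational_moduleD(2)[OF M] by blast
  ultimately have "card (w ` \<Lambda>) \<le> mdim M"
    using w(1) by (intro independent_card_le_dim_span[of _ B]) auto
  then show ?thesis by (simp add: card_image[OF inj])
qed

lemma highest_weight_dim_ge:
  fixes M :: "('k::field, 'i) gmodule"
  assumes inf: "infinite (UNIV :: 'k set)" and M: "rational_module m M"
    and hw: "has_highest_weight m (fund_weight r) M"
  shows "2 ^ r * (m choose r) \<le> mdim M"
proof -
  obtain v where v: "v \<in> mspace M" "v \<noteq> 0"
    "\<And>b. b \<in> borel_Sp m \<Longrightarrow> maction M b v = fscale (weight_char m (fund_weight r) b) v"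
    using hw unfolding has_highest_weight_def by blast
  have "\<forall>\<nu>\<in>unit_weights m r. \<exists>w. w \<in> mspace M \<and> w \<noteq> 0 \<and>
      (\<forall>t. (\<forall>i. t i \<noteq> 0) \<longrightarrow> maction M (torus_mat m t) w = fscale (tchar m \<nu> t) w)"
    using highest_weight_conjugate[OF M v] by blast
  then obtain w where w: "\<forall>\<nu>\<in>unit_weights m r. w \<nu> \<in> mspace M \<and> w \<nu> \<noteq> 0 \<and>
      (\<forall>t. (\<forall>i. t i \<noteq> 0) \<longrightarrow> maction M (torus_mat m t) (w \<nu>) = fscale (tchar m \<nu> t) (w \<nu>))"
    by (rule bchoice[THEN exE])
  have "card (unit_weights m r) \<le> mdim M"
    by (rule torus_eigenvectors_independent[where w = w, OF inf M card_unit_weights(1)])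
      (use w in \<open>auto simp: unit_weights_def\<close>)
  then show ?thesis by (simp only: card_unit_weights(2))
qed

lemma simple_module_generated:
  assumes M: "simple_module m M" and v: "v \<in> mspace M" "v \<noteq> 0"
  shows "mspace M = fun_vs.span ((\<lambda>g. maction M g v) ` carrier (Sp m))"
proof -
  have R: "rational_module m M" using M by (simp add: simple_module_def)
  note D = rational_moduleD[OF R]
  let ?G = "(\<lambda>g. maction M g v) ` carrier (Sp m)"
  have sub: "fun_vs.span ?G \<subseteq> mspace M"
    by (rule fun_vs.span_minimal) (use D v in auto)
  have stable: "maction M g x \<in> fun_vs.span ?G" if g: "g \<in> carrier (Sp m)" and x: "x \<in> fun_vs.span ?G" for g x
  proof -
    let ?S = "{x \<in> mspace M. maction M g x \<in> fun_vs.span ?G}"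
    have "fun_vs.subspace ?S"
      unfolding fun_vs.subspace_def
    proof (intro conjI ballI allI)
      have "maction M g 0 = 0"
        using maction_sum[where w = "\<lambda>_. v", OF R g finite.emptyI] by simp
      then show "0 \<in> ?S" using fun_subspaceD(1)[OF D(1)] by (simp add: fun_vs.span_zero)
    next
      fix x y assume "x \<in> ?S" "y \<in> ?S"
      then show "x + y \<in> ?S" using fun_subspaceD(2)[OF D(1)] D(4)[OF g] by (simp add: fun_vs.span_add)
    next
      fix c x assume "x \<in> ?S"
      then show "fscale c x \<in> ?S" using fun_subspaceD(3)[OF D(1)] D(5)[OF g] by (simp add: fun_vs.span_scale)
    qed
    moreover have "?G \<subseteq> ?S"
    proof
      fix y assume "y \<in> ?G"
      then obtain h where h: "h \<in> carrier (Sp m)" "y = maction M h v" by blast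
      then have "maction M g y = maction M (g * h) v" using D(7)[OF g h(1) v(1)] by simp
      then have "maction M g y \<in> fun_vs.span ?G"
        by (simp only:) (intro fun_vs.span_base imageI Sp_mult_closed[OF g h(1)])
      then show "y \<in> ?S" using h D(3)[OF h(1) v(1)] by simp
    qed
    ultimately have "fun_vs.span ?G \<subseteq> ?S" using fun_vs.span_minimal by blast
    then show ?thesis using x by blast
  qed
  have "v \<in> fun_vs.span ?G"
  proof (rule fun_vs.span_base)
    show "v \<in> ?G" using D(6)[OF v(1)] by (intro image_eqI[of _ _ "1\<^sub>m (2 * m)"]) simp_all
  qed
  then have "fun_vs.span ?G \<noteq> {0}" using v(2) by blast
  moreover have "fun_vs.span ?G = {0} \<or> fun_vs.span ?G = mspace M"
    using M sub stable fun_vs.subspace_span[of ?G] unfolding simple_module_def by blast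
  ultimately show ?thesis by blast
qed

lemma simple_dim_le:
  fixes M :: "('k::field, 'i) gmodule"
  assumes M: "simple_module m M" and hw: "has_highest_weight m \<mu> M"
    and B: "finite (B :: ('k mat \<Rightarrow> 'k) set)" "mspace (induced_module m \<mu>) = fun_vs.span B"
  shows "mdim M \<le> fun_vs.dim (mspace (induced_module m \<mu>) :: ('k mat \<Rightarrow> 'k) set)"
proof -
  have R: "rational_module m M" using M by (simp add: simple_module_def)
  note D = rational_moduleD[OF R]
  obtain v where v: "v \<in> mspace M" "v \<noteq> 0"
    "\<And>b. b \<in> borel_Sp m \<Longrightarrow> maction M b v = fscale (weight_char m \<mu> b) v"
    using hw unfolding has_highest_weight_def by blast
  let ?V = "dual_space (mspace M)"
  define T where "T \<phi> = (\<lambda>g. if g \<in> carrier (Sp m) then \<phi> (maction M g v) else 0)" for \<phi> :: "('i \<Rightarrow> 'k) \<Rightarrow> 'k"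
  obtain C where C: "finite C" "mspace M = fun_vs.span C" using D(2) by blast
  have sub: "fun_vs.subspace ?V"
    unfolding fun_vs.subspace_def dual_space_def by (auto simp: algebra_simps)
  have lin: "Vector_Spaces.linear fscale fscale T"
    by (rule fscale_linearI) (auto simp: T_def fun_eq_iff)
  \<comment> \<open>If the function vanishes, \<open>\<phi>\<close> is zero on the orbit of
    \<open>v\<close>, which spans the simple module.\<close>
  have inj: "\<phi> = 0" if \<phi>: "\<phi> \<in> ?V" and T0: "T \<phi> = 0" for \<phi>
  proof
    fix x
    let ?K = "{x \<in> mspace M. \<phi> x = 0}"
    have "\<phi> 0 = \<phi> (fscale 0 0)" by (simp only: fun_vs.scale_zero_left)
    also have "\<dots> = 0 * \<phi> 0" by (rule dual_spaceD(2)[OF \<phi> fun_subspaceD(1)[OF D(1)]])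
    finally have "0 \<in> ?K" using fun_subspaceD(1)[OF D(1)] by simp
    moreover have "x + y \<in> ?K" if "x \<in> ?K" "y \<in> ?K" for x y
      using that fun_subspaceD(2)[OF D(1)] dual_spaceD(1)[OF \<phi>] by simp
    moreover have "fscale c x \<in> ?K" if "x \<in> ?K" for c x
      using that fun_subspaceD(3)[OF D(1)] dual_spaceD(2)[OF \<phi>] by simp
    ultimately have K: "fun_vs.subspace ?K" unfolding fun_vs.subspace_def by blast
    have "(\<lambda>g. maction M g v) ` carrier (Sp m) \<subseteq> ?K"
    proof
      fix y assume "y \<in> (\<lambda>g. maction M g v) ` carrier (Sp m)"
      then obtain g where g: "g \<in> carrier (Sp m)" "y = maction M g v" by blast
      then show "y \<in> ?K" using D(3)[OF g(1) v(1)] fun_cong[OF T0, of g] by (simp add: T_def)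
    qed
    from fun_vs.span_minimal[OF this K] have "mspace M \<subseteq> ?K"
      using simple_module_generated[OF M v(1,2)] by blast
    then show "\<phi> x = 0 x" using dual_spaceD(3)[OF \<phi>, of x] by (cases "x \<in> mspace M") auto
  qed
  have image: "T ` ?V \<subseteq> fun_vs.span B"
  proof
    fix f assume "f \<in> T ` ?V"
    then obtain \<phi> where \<phi>: "\<phi> \<in> ?V" "f = T \<phi>" by blast
    have "T \<phi> \<in> coord_ring m" unfolding T_def by (rule D(8)[OF \<phi>(1) v(1)])
    moreover have "T \<phi> (g * b) = weight_char m \<mu> b * T \<phi> g" if g: "g \<in> carrier (Sp m)" and b: "b \<in> borel_Sp m" for g b
    proof -
      have bS: "b \<in> carrier (Sp m)" using b by (simp add: borel_Sp_def)
      have "\<phi> (maction M (g * b) v) = \<phi> (fscale (weight_char m \<mu> b) (maction M g v))"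
        using D(7)[OF g bS v(1)] v(3)[OF b] D(5)[OF g v(1)] by (simp only:)
      also have "\<dots> = weight_char m \<mu> b * \<phi> (maction M g v)"
        by (rule dual_spaceD(2)[OF \<phi>(1) D(3)[OF g v(1)]])
      finally show ?thesis using g Sp_mult_closed[OF g bS] by (simp add: T_def)
    qed
    ultimately have "T \<phi> \<in> mspace (induced_module m \<mu>)" by (simp add: induced_module_def)
    then show "f \<in> fun_vs.span B" using B(2) \<phi>(2) by simp
  qed
  have "mdim M = fun_vs.dim ?V" by (rule dual_space_dim(1)[OF D(1) C, symmetric])
  also have "\<dots> \<le> fun_vs.dim (fun_vs.span B)"
    by (rule dim_le_if_injective[OF sub lin inj B(1) image])
  finally show ?thesis using B(2) by simp
qed

lemma Weyl_dim:
  assumes "finite (B :: ('k::field mat \<Rightarrow> 'k) set)" "mspace (induced_module m \<mu>) = fun_vs.span B"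
  shows "mdim (Weyl_module m \<mu> :: ('k, 'k mat \<Rightarrow> 'k) gmodule)
    = fun_vs.dim (mspace (induced_module m \<mu>) :: ('k mat \<Rightarrow> 'k) set)"
  unfolding Weyl_module_def dual_module_def gmodule.simps
  by (rule dual_space_dim(1)[OF subspace_induced assms])

section \<open>Existence of the simple module\<close>

text \<open>A list of pairs stands for an element of the tensor product of two function rings. Only
  the first factors are later required to be polynomial, since regularity is a question about the
  dependence on the first variable.\<close>

definition sep_fun :: "(('k::field mat \<Rightarrow> 'k) \<times> ('k mat \<Rightarrow> 'k)) list \<Rightarrow> 'k mat \<times> 'k mat \<Rightarrow> 'k" where
  "sep_fun l p = (\<Sum>(a, b)\<leftarrow>l. a (fst p) * b (snd p))"

lemma sep_fun_simps [simp]: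
  "sep_fun [] p = 0" "sep_fun ((a, b) # l) p = a (fst p) * b (snd p) + sep_fun l p"
  "sep_fun (l @ l') p = sep_fun l p + sep_fun l' p"
  by (simp_all add: sep_fun_def)

lemma sep_fun_mult:
  "sep_fun l p * sep_fun l' p
    = sep_fun [(\<lambda>g. a g * a' g, \<lambda>x. b x * b' x). (a, b) \<leftarrow> l, (a', b') \<leftarrow> l'] p"
proof (induction l)
  case (Cons ab l)
  obtain a b where ab: "ab = (a, b)" by force
  have "a (fst p) * b (snd p) * sep_fun l' p
      = sep_fun [(\<lambda>g. a g * a' g, \<lambda>x. b x * b' x). (a', b') \<leftarrow> l'] p"
    by (induction l') (auto simp: algebra_simps)
  then show ?case using Cons by (simp add: ab distrib_right)
qed auto

lemma sep_fun_sum: "(\<Sum>k<n. a k (fst p) * b k (snd p)) = sep_fun (map (\<lambda>k. (a k, b k)) [0..<n]) p"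
  by (induction n) (auto simp: add.commute)

text \<open>Each entry of g^-1 x is a sum of products of an entry of g, up to sign, and an entry of
  x, and separated functions form a ring. This is comultiplication combined with the
  antipode.\<close>

lemma entry_poly_separate:
  fixes q :: "'k::field mat \<Rightarrow> 'k"
  assumes q: "q \<in> entry_polys (2 * m)"
  obtains l where "\<forall>(a, b)\<in>set l. a \<in> entry_polys (2 * m)"
    "\<And>g x. g \<in> carrier (Sp m) \<Longrightarrow> x \<in> carrier (Sp m) \<Longrightarrow> q (symp_inverse m g * x) = sep_fun l (g, x)"
proof -
  define R :: "('k mat \<times> 'k mat \<Rightarrow> 'k) set" where
    "R = {F. \<exists>l. (\<forall>(a, b)\<in>set l. a \<in> entry_polys (2 * m)) \<and> (\<forall>p. F p = sep_fun l p)}"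
  have "\<exists>F\<in>R. \<forall>p\<in>carrier (Sp m) \<times> carrier (Sp m). q (symp_inverse m (fst p) * snd p) = F p"
    using q
  proof (rule entry_polys_subst[where \<phi> = "\<lambda>p. symp_inverse m (fst p) * snd p"])
    fix c :: 'k
    have "(\<lambda>_ :: 'k mat. c) \<in> entry_polys (2 * m)" by (rule entry_polys.const)
    then show "(\<lambda>_. c) \<in> R"
      unfolding R_def by (intro CollectI exI[of _ "[(\<lambda>_. c, \<lambda>_. 1)]"]) simp
  next
    fix F G assume "F \<in> R" "G \<in> R"
    then obtain l l' where l: "\<forall>(a, b)\<in>set l. a \<in> entry_polys (2 * m)" "\<forall>p. F p = sep_fun l p"
      "\<forall>(a, b)\<in>set l'. a \<in> entry_polys (2 * m)" "\<forall>p. G p = sep_fun l' p"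
      unfolding R_def by blast
    show "(\<lambda>x. F x + G x) \<in> R"
      unfolding R_def using l by (intro CollectI exI[of _ "l @ l'"]) auto
    show "(\<lambda>x. F x * G x) \<in> R"
      unfolding R_def
      by (intro CollectI exI[of _ "[(\<lambda>g. a g * a' g, \<lambda>x. b x * b' x). (a, b) \<leftarrow> l, (a', b') \<leftarrow> l']"])
        (use l in \<open>auto simp: sep_fun_mult intro!: entry_polys.mult\<close>)
  next
    fix i j assume ij: "i < 2 * m" "j < 2 * m"
    define a where "a k g = ssgn m i * ssgn m k * (g :: 'k mat) $$ (opp m k, opp m i)" for k g
    define b where "b k x = (x :: 'k mat) $$ (k, j)" for k x
    have a: "a k \<in> entry_polys (2 * m)" if "k < 2 * m" for k
      unfolding a_def[abs_def] using that ij by (intro entry_polys_cmult entry_polys.entry) simp_all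
    show "\<exists>F\<in>R. \<forall>p\<in>carrier (Sp m) \<times> carrier (Sp m). (symp_inverse m (fst p) * snd p) $$ (i, j) = F p"
    proof (intro bexI ballI)
      fix p :: "'k mat \<times> 'k mat" assume p: "p \<in> carrier (Sp m) \<times> carrier (Sp m)"
      have "(symp_inverse m (fst p) * snd p) $$ (i, j) = (\<Sum>k<2*m. symp_inverse m (fst p) $$ (i, k) * snd p $$ (k, j))"
        using p ij by (intro Sp_mult_index symp_inverse_closed) auto
      also have "\<dots> = (\<Sum>k<2*m. a k (fst p) * b k (snd p))"
        using ij by (intro sum.cong refl) (simp add: a_def b_def symp_inverse_def)
      also have "\<dots> = sep_fun (map (\<lambda>k. (a k, b k)) [0..<2*m]) p" by (rule sep_fun_sum)
      finally show "(symp_inverse m (fst p) * snd p) $$ (i, j) = sep_fun (map (\<lambda>k. (a k, b k)) [0..<2*m]) p" .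
    next
      show "sep_fun (map (\<lambda>k. (a k, b k)) [0..<2*m]) \<in> R"
        unfolding R_def using a by (intro CollectI exI[of _ "map (\<lambda>k. (a k, b k)) [0..<2*m]"]) auto
    qed
  qed
  then obtain F where F: "F \<in> R" "\<forall>p\<in>carrier (Sp m) \<times> carrier (Sp m). q (symp_inverse m (fst p) * snd p) = F p"
    by blast
  then obtain l where l: "\<forall>(a, b)\<in>set l. a \<in> entry_polys (2 * m)" "\<forall>p. F p = sep_fun l p"
    unfolding R_def by blast
  show ?thesis
  proof (rule that[OF l(1)])
    fix g x :: "'k mat" assume "g \<in> carrier (Sp m)" "x \<in> carrier (Sp m)"
    then show "q (symp_inverse m g * x) = sep_fun l (g, x)"
      using F(2)[rule_format, of "(g, x)"] l(2) by simp
  qed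
qed

section \<open>Rationality of submodules of the induced module\<close>

lemma induced_action:
  assumes "g \<in> carrier (Sp m)"
  shows "maction (induced_module m \<mu>) g f = sp_restrict m (\<lambda>x. f (symp_inverse m g * x))"
  using assms by (simp add: induced_module_def sp_restrict_def Sp_inv fun_eq_iff)

text \<open>When f(g^-1 x) is separated into products, the single factors in x need not lie in the
  submodule \<open>W\<close>. A functional on \<open>W\<close> has to be evaluated on them
  nevertheless.\<close>

lemma linear_functional_extension:
  fixes \<phi> :: "('i \<Rightarrow> 'k::field) \<Rightarrow> 'k"
  assumes \<phi>: "\<phi> \<in> dual_space W" and W: "fun_vs.subspace W"
  obtains \<Phi> where "\<And>u v. \<Phi> (u + v) = \<Phi> u + \<Phi> v" "\<And>c v. \<Phi> (fscale c v) = c * \<Phi> v"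
    "\<And>v. v \<in> W \<Longrightarrow> \<Phi> v = \<phi> v"
proof -
  interpret P: vector_space_pair "fscale :: 'k \<Rightarrow> ('i \<Rightarrow> 'k) \<Rightarrow> 'i \<Rightarrow> 'k" "(*) :: 'k \<Rightarrow> 'k \<Rightarrow> 'k"
    by unfold_locales (auto simp: algebra_simps)
  obtain B where B: "B \<subseteq> W" "fun_vs.independent B" "W \<subseteq> fun_vs.span B"
    using fun_vs.maximal_independent_subset[of W] by blast
  obtain \<Phi> where \<Phi>: "Vector_Spaces.linear fscale (*) \<Phi>" "\<forall>b\<in>B. \<Phi> b = \<phi> b"
    using P.linear_independent_extend[OF B(2), of \<phi>] by blast
  interpret L: Vector_Spaces.linear fscale "(*)" \<Phi> by (rule \<Phi>(1))
  have "\<Phi> v = \<phi> v" if v: "v \<in> W" for v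
  proof -
    let ?K = "{v \<in> W. \<Phi> v = \<phi> v}"
    have "\<phi> 0 = \<phi> (fscale 0 0)" by (simp only: fun_vs.scale_zero_left)
    also have "\<dots> = 0 * \<phi> 0" by (rule dual_spaceD(2)[OF \<phi> fun_subspaceD(1)[OF W]])
    finally have "0 \<in> ?K" using fun_subspaceD(1)[OF W] by (simp add: L.zero)
    moreover have "x + y \<in> ?K" if "x \<in> ?K" "y \<in> ?K" for x y
      using that fun_subspaceD(2)[OF W] dual_spaceD(1)[OF \<phi>] by (simp add: L.add)
    moreover have "fscale c x \<in> ?K" if "x \<in> ?K" for c x
      using that fun_subspaceD(3)[OF W] dual_spaceD(2)[OF \<phi>] by (simp add: L.scale)
    ultimately have "fun_vs.subspace ?K" unfolding fun_vs.subspace_def by blast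
    then have "fun_vs.span B \<subseteq> ?K" using B(1) \<Phi>(2) by (intro fun_vs.span_minimal) auto
    then show ?thesis using v B(3) by blast
  qed
  then show ?thesis using that[of \<Phi>] L.add L.scale by blast
qed

lemma symp_inverse_mult:
  assumes "g \<in> carrier (Sp m)" "h \<in> carrier (Sp m)"
  shows "symp_inverse m (g * h) = symp_inverse m h * symp_inverse m g"
  using group.inv_mult_group[OF Sp_group assms] Sp_inv[OF assms(1)] Sp_inv[OF assms(2)]
    Sp_inv[OF Sp_mult_closed[OF assms]] by simp

lemma symp_inverse_symp_inverse: "g \<in> carrier (Sp m) \<Longrightarrow> symp_inverse m (symp_inverse m g) = g"
  using group.inv_inv[OF Sp_group, of g m] Sp_inv[of g m] Sp_inv[OF symp_inverse_closed(1), of g m] by simp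

lemma symp_inverse_one: "symp_inverse m (1\<^sub>m (2 * m)) = 1\<^sub>m (2 * m)"
  unfolding Sp_inv[OF one_Sp_closed, symmetric]
  unfolding one_Sp[symmetric]
  by (rule monoid.inv_one[OF group.is_monoid[OF Sp_group]])

lemma induced_submodule_rational:
  fixes W :: "('k::field mat \<Rightarrow> 'k) set"
  assumes W: "fun_vs.subspace W" "W \<subseteq> mspace (induced_module m \<mu>)" and B: "finite B" "W = fun_vs.span B"
    and stable: "\<And>g f. g \<in> carrier (Sp m) \<Longrightarrow> f \<in> W \<Longrightarrow> maction (induced_module m \<mu>) g f \<in> W"
  shows "rational_module m \<lparr>mspace = W, maction = maction (induced_module m \<mu>)\<rparr>"
proof -
  let ?act = "maction (induced_module m \<mu>) :: 'k mat \<Rightarrow> ('k mat \<Rightarrow> 'k) \<Rightarrow> 'k mat \<Rightarrow> 'k"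
  have add: "?act g (u + v) = ?act g u + ?act g v" if "g \<in> carrier (Sp m)" for g u v
    unfolding induced_action[OF that] by (simp add: sp_restrict_def fun_eq_iff)
  have scale: "?act g (fscale c v) = fscale c (?act g v)" if "g \<in> carrier (Sp m)" for g c v
    unfolding induced_action[OF that] by (simp add: sp_restrict_def fun_eq_iff)
  have one: "?act (1\<^sub>m (2 * m)) v = v" if v: "v \<in> W" for v
  proof
    fix x
    show "?act (1\<^sub>m (2 * m)) v x = v x"
      unfolding induced_action[OF one_Sp_closed] symp_inverse_one
      using v W(2) left_mult_one_mat[OF Sp_carrier_mat, of x m]
      by (cases "x \<in> carrier (Sp m)") (auto simp: sp_restrict_def induced_iff)
  qed
  have mult: "?act (g * h) v = ?act g (?act h v)" if g: "g \<in> carrier (Sp m)" and h: "h \<in> carrier (Sp m)" for g h v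
  proof
    note gi = symp_inverse_closed(1)[OF g] and hi = symp_inverse_closed(1)[OF h]
    fix x show "?act (g * h) v x = ?act g (?act h v) x"
      unfolding induced_action[OF g] induced_action[OF h] induced_action[OF Sp_mult_closed[OF g h]]
        symp_inverse_mult[OF g h]
      by (cases "x \<in> carrier (Sp m)")
        (simp_all add: sp_restrict_def Sp_mult_closed[OF gi] Sp_assoc[OF hi gi] del: assoc_mult_mat)
  qed
  have coeff: "(\<lambda>g. if g \<in> carrier (Sp m) then \<phi> (?act g v) else 0) \<in> coord_ring m"
    if \<phi>: "\<phi> \<in> dual_space W" and v: "v \<in> W" for \<phi> v
  proof -
    obtain \<Phi> where \<Phi>: "\<And>u v. \<Phi> (u + v) = \<Phi> u + \<Phi> v" "\<And>c v. \<Phi> (fscale c v) = c * \<Phi> v"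
      "\<And>v. v \<in> W \<Longrightarrow> \<Phi> v = \<phi> v"
      using linear_functional_extension[OF \<phi> W(1)] by blast
    have "\<Phi> 0 = \<Phi> (fscale 0 0)" by (simp only: fun_vs.scale_zero_left)
    then have \<Phi>0: "\<Phi> 0 = 0" by (simp only: \<Phi>(2)) simp
    have "semi_inv m \<mu> v" using v W(2) by (auto simp: induced_iff)
    then obtain q where q: "q \<in> entry_polys (2 * m)" "\<forall>g\<in>carrier (Sp m). v g = q g"
      using semi_inv_poly by blast
    obtain l where l: "\<forall>(a, b)\<in>set l. a \<in> entry_polys (2 * m)"
      "\<And>g x. g \<in> carrier (Sp m) \<Longrightarrow> x \<in> carrier (Sp m) \<Longrightarrow> q (symp_inverse m g * x) = sep_fun l (g, x)"
      using entry_poly_separate[OF q(1)] by blast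
    \<comment> \<open>The matrix coefficient as a function of \<open>g\<close>: the functional acts
      on the factors in x and leaves the polynomial factors in g.\<close>
    define Q where "Q l g = (\<Sum>(a, b)\<leftarrow>l. a g * \<Phi> (sp_restrict m b))" for l and g :: "'k mat"
    have QPhi: "\<Phi> (sp_restrict m (\<lambda>x. sep_fun l (g, x))) = Q l g" for l g
    proof (induction l)
      case Nil
      have "sp_restrict m (\<lambda>x. sep_fun [] (g, x)) = 0" by (simp add: sp_restrict_def fun_eq_iff)
      then show ?case by (simp only: \<Phi>0) (simp add: Q_def)
    next
      case (Cons ab l)
      obtain a b where ab: "ab = (a, b)" by force
      have "sp_restrict m (\<lambda>x. sep_fun (ab # l) (g, x))
          = fscale (a g) (sp_restrict m b) + sp_restrict m (\<lambda>x. sep_fun l (g, x))"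
        by (simp add: sp_restrict_def fun_eq_iff ab)
      then show ?case using Cons by (simp only: \<Phi>(1,2)) (simp add: Q_def ab)
    qed
    have Qpoly: "Q l \<in> entry_polys (2 * m)" if "\<forall>(a, b)\<in>set l. a \<in> entry_polys (2 * m)" for l
      using that
    proof (induction l)
      case Nil
      then show ?case unfolding Q_def[abs_def] by (simp add: entry_polys.const)
    next
      case (Cons ab l)
      obtain a b where ab: "ab = (a, b)" by force
      have "Q (ab # l) = (\<lambda>g. a g * \<Phi> (sp_restrict m b) + Q l g)" by (simp add: Q_def ab fun_eq_iff)
      moreover have "a \<in> entry_polys (2 * m)" "Q l \<in> entry_polys (2 * m)" using Cons ab by auto
      ultimately show ?case by (simp only: entry_polys.add entry_polys.mult entry_polys.const)
    qed
    have "\<phi> (?act g v) = Q l g" if g: "g \<in> carrier (Sp m)" for g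
    proof -
      have "?act g v = sp_restrict m (\<lambda>x. sep_fun l (g, x))"
        unfolding induced_action[OF g]
        using q(2) l(2)[OF g] Sp_mult_closed[OF symp_inverse_closed(1)[OF g]]
        by (simp add: sp_restrict_def fun_eq_iff)
      then show ?thesis using \<Phi>(3)[OF stable[OF g v]] QPhi by simp
    qed
    then show ?thesis
      unfolding coord_ring_def using Qpoly[OF l(1)] by (intro CollectI conjI bexI[of _ "Q l"]) simp_all
  qed
  show ?thesis
    unfolding rational_module_def gmodule.simps mult_Sp one_Sp
    using W(1) B stable add scale one mult coeff by blast
qed

section \<open>The leading minor and the simple socle\<close>

definition lead_minor :: "nat \<Rightarrow> 'k::field mat \<Rightarrow> 'k" where
  "lead_minor r A = det (mat r r (\<lambda>(i, j). A $$ (i, j)))"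

lemma lead_minor_mult:
  assumes A: "A \<in> carrier_mat n n" and B: "B \<in> carrier_mat n n" and r: "r \<le> n"
    and zero: "\<And>i j k. i < r \<Longrightarrow> j < r \<Longrightarrow> r \<le> k \<Longrightarrow> k < n \<Longrightarrow> A $$ (i, k) * B $$ (k, j) = 0"
  shows "lead_minor r (A * B) = lead_minor r A * lead_minor r B"
proof -
  let ?t = "\<lambda>A :: 'a mat. mat r r (\<lambda>(i, j). A $$ (i, j))"
  have "?t (A * B) = ?t A * ?t B"
  proof (rule eq_matI)
    fix i j assume "i < dim_row (?t A * ?t B)" "j < dim_col (?t A * ?t B)"
    then have ij: "i < r" "j < r" by auto
    have "(A * B) $$ (i, j) = (\<Sum>k<n. A $$ (i, k) * B $$ (k, j))"
      using A B by (rule mult_mat_index) (use ij r in auto)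
    also have "\<dots> = (\<Sum>k<r. A $$ (i, k) * B $$ (k, j))"
      using r zero ij by (intro sum.mono_neutral_right) auto
    also have "\<dots> = (\<Sum>k<r. ?t A $$ (i, k) * ?t B $$ (k, j))"
      using ij by (intro sum.cong) auto
    also have "\<dots> = (?t A * ?t B) $$ (i, j)"
      using ij by (intro mult_mat_index[symmetric]) auto
    finally show "?t (A * B) $$ (i, j) = (?t A * ?t B) $$ (i, j)" using ij by simp
  qed auto
  then show ?thesis unfolding lead_minor_def by (simp add: det_mult[of _ r])
qed

lemma prod_list_diag:
  "prod_list (diag_mat (mat r r (\<lambda>(i, j). A $$ (i, j)))) = (\<Prod>i<r. A $$ (i, i))"
  unfolding prod_list_diag_prod by (intro prod.cong) (auto simp: atLeast0LessThan)

lemma lead_minor_right: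
  assumes g: "g \<in> carrier_mat n n" and b: "b \<in> carrier_mat n n" and r: "r \<le> n"
    and up: "\<And>i j. i < n \<Longrightarrow> j < i \<Longrightarrow> b $$ (i, j) = 0"
  shows "lead_minor r (g * b) = lead_minor r g * (\<Prod>i<r. b $$ (i, i))"
proof -
  have "lead_minor r b = (\<Prod>i<r. b $$ (i, i))"
    unfolding lead_minor_def prod_list_diag[symmetric]
    using up r by (intro det_upper_triangular[of _ r]) auto
  then show ?thesis using lead_minor_mult[OF g b r] up by simp
qed

lemma lead_minor_left:
  assumes g: "g \<in> carrier_mat n n" and b: "b \<in> carrier_mat n n" and r: "r \<le> n"
    and low: "\<And>i j. j < n \<Longrightarrow> i < j \<Longrightarrow> b $$ (i, j) = 0"
  shows "lead_minor r (b * g) = (\<Prod>i<r. b $$ (i, i)) * lead_minor r g"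
proof -
  have "lead_minor r b = (\<Prod>i<r. b $$ (i, i))"
    unfolding lead_minor_def prod_list_diag[symmetric]
    using low r by (intro det_lower_triangular[of r]) auto
  then show ?thesis using lead_minor_mult[OF b g r] low by simp
qed

lemma lead_minor_one: "r \<le> n \<Longrightarrow> lead_minor r (1\<^sub>m n) = 1"
proof -
  assume "r \<le> n"
  then have "mat r r (\<lambda>(i, j). (1\<^sub>m n :: 'a mat) $$ (i, j)) = 1\<^sub>m r" by (intro eq_matI) auto
  then show ?thesis by (simp add: lead_minor_def)
qed

lemma lead_minor_entry_polys:
  assumes r: "r \<le> n"
  shows "(lead_minor r :: 'k::field mat \<Rightarrow> 'k) \<in> entry_polys n"
proof -
  have "(lead_minor r :: 'k mat \<Rightarrow> 'k)
    = (\<lambda>A. \<Sum>p\<in>{p. p permutes {0..<r}}. signof p * (\<Prod>i\<in>{0..<r}. A $$ (i, p i)))"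
  proof
    fix A :: "'k mat"
    have "lead_minor r A = (\<Sum>p\<in>{p. p permutes {0..<r}}. signof p *
        (\<Prod>i = 0..<r. mat r r (\<lambda>(i, j). A $$ (i, j)) $$ (i, p i)))"
      unfolding lead_minor_def by (rule det_def') simp
    also have "\<dots> = (\<Sum>p\<in>{p. p permutes {0..<r}}. signof p * (\<Prod>i\<in>{0..<r}. A $$ (i, p i)))"
    proof (intro sum.cong refl arg_cong2[of _ _ _ _ "(*)"] prod.cong)
      fix p i assume "p \<in> {p. p permutes {0..<r}}" "i \<in> {0..<r}"
      then have "p i < r" using permutes_in_image[of p "{0..<r}" i] by simp
      then show "mat r r (\<lambda>(i, j). A $$ (i, j)) $$ (i, p i) = A $$ (i, p i)"
        using \<open>i \<in> {0..<r}\<close> by simp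
    qed
    finally show "lead_minor r A = (\<Sum>p\<in>{p. p permutes {0..<r}}. signof p * (\<Prod>i\<in>{0..<r}. A $$ (i, p i)))" .
  qed
  moreover have "(\<lambda>A :: 'k mat. \<Sum>p\<in>{p. p permutes {0..<r}}. signof p * (\<Prod>i\<in>{0..<r}. A $$ (i, p i)))
      \<in> entry_polys n"
  proof (intro entry_polys_sum entry_polys_cmult entry_polys_prod entry_polys.entry)
    fix p i assume "p \<in> {p. p permutes {0..<r}}" "i \<in> {0..<r}"
    then have "i < r" "p i < r" using permutes_in_image[of p "{0..<r}" i] by simp_all
    then show "i < n" "p i < n" using r by linarith+
  qed
  ultimately show ?thesis by simp
qed

lemma weight_char_fund_weight:
  assumes "r \<le> m"
  shows "weight_char m (fund_weight r) b = (\<Prod>i<r. b $$ (i, i))"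
proof -
  have "weight_char m (fund_weight r) b = (\<Prod>i<m. if i < r then b $$ (i, i) else 1)"
    unfolding weight_char_def fund_weight_def by (intro prod.cong) auto
  also have "\<dots> = (\<Prod>i<r. b $$ (i, i))"
    using assms by (intro prod.mono_neutral_cong_right) auto
  finally show ?thesis .
qed

lemma lead_minor_semi_inv:
  assumes r: "r \<le> m"
  shows "semi_inv m (fund_weight r) (lead_minor r :: 'k::field mat \<Rightarrow> 'k)"
proof -
  have "lead_minor r (g * b) = weight_char m (fund_weight r) b * lead_minor r g"
    if g: "g \<in> carrier (Sp m)" and b: "b \<in> borel_Sp m" for g b :: "'k mat"
  proof -
    have bS: "b \<in> carrier (Sp m)" and ut: "upper_triangular b" using b by (simp_all add: borel_Sp_def)
    note bc = Sp_carrier_mat[OF bS]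
    have "lead_minor r (g * b) = lead_minor r g * (\<Prod>i<r. b $$ (i, i))"
      using r ut bc by (intro lead_minor_right[OF Sp_carrier_mat[OF g] bc]) auto
    then show ?thesis by (simp add: weight_char_fund_weight[OF r])
  qed
  moreover have "(lead_minor r :: 'k mat \<Rightarrow> 'k) \<in> entry_polys (2 * m)"
    using r by (intro lead_minor_entry_polys) simp
  ultimately show ?thesis unfolding semi_inv_def by blast
qed

lemma lead_minor_has_weight:
  assumes r: "r \<le> m"
  shows "has_weight m (fund_weight r) (lead_minor r :: 'k::field mat \<Rightarrow> 'k)"
  unfolding has_weight_def
proof (intro allI impI ballI)
  fix t :: "nat \<Rightarrow> 'k" and g :: "'k mat" assume g: "g \<in> carrier (Sp m)"
  have "lead_minor r (torus_mat m t * g) = (\<Prod>i<r. torus_mat m t $$ (i, i)) * lead_minor r g"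
    using r by (intro lead_minor_left[OF Sp_carrier_mat[OF g] torus_mat_carrier]) (auto simp: torus_mat_def)
  then show "lead_minor r (torus_mat m t * g) = tchar m (fund_weight r) t * lead_minor r g"
    by (simp only: weight_char_torus_mat[symmetric] weight_char_fund_weight[OF r])
qed

text \<open>Only the empty monomial has conjugation weight 0 here, so \<open>f\<close> is constant
  on \<open>unip m r\<close> with value \<open>f (1\<^sub>m (2 * m))\<close>. Hence the weight space
  is at most one-dimensional.\<close>

lemma fund_weight_vector_unique:
  fixes f :: "'k::field mat \<Rightarrow> 'k"
  assumes inf: "infinite (UNIV :: 'k set)" and r: "r \<le> m"
    and f: "semi_inv m (fund_weight r) f" and wt: "has_weight m (fund_weight r) f"
    and f1: "f (1\<^sub>m (2 * m)) = 0" and g: "g \<in> carrier (Sp m)"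
  shows "f g = 0"
proof (rule vanish_on_unip_fund_weight[OF inf r f _ g])
  fix u :: "'k mat" assume u: "u \<in> unip m r"
  note \<mu> = fund_weight_weights[OF r]
  obtain T where T: "\<And>c xs. (c, xs) \<in> set T \<Longrightarrow> set xs \<subseteq> lower_pairs m r \<and>
      conj_wt m xs = (\<lambda>k. fund_weight r k - fund_weight r k)"
    "\<And>u. u \<in> unip m r \<Longrightarrow> f u = terms_fun T u"
    using restrict_to_unip[OF inf f wt \<mu> \<mu>, of r] by blast
  have "terms_fun T u = 1 * terms_fun T (1\<^sub>m (2 * m))"
  proof (rule terms_fun_scale)
    fix c xs assume "(c, xs) \<in> set T"
    then have "xs \<in> weight_lists m r r" using T(1) by (simp add: weight_lists_def)
    then have "xs = []" using weight_lists_length(2)[OF _ order_refl r] by blast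
    then show "monom_fun xs u = 1 * monom_fun xs (1\<^sub>m (2 * m))" by (simp add: monom_fun_def)
  qed
  then show "f u = 0" using T(2)[OF u] T(2)[OF one_in_unip] f1 by simp
qed

text \<open>A translate of \<open>f\<close> is nonzero at the identity, and then so is one of its
  weight components. Its weight must be \<open>fund_weight r\<close>, so it is a multiple of the
  leading minor; and it lies in \<open>W\<close>, being a combination of translates by torus
  elements.\<close>

lemma stable_subspace_contains_lead_minor:
  fixes W :: "('k::field mat \<Rightarrow> 'k) set"
  assumes inf: "infinite (UNIV :: 'k set)" and r: "r \<le> m"
    and W: "fun_vs.subspace W" "W \<subseteq> mspace (induced_module m (fund_weight r))"
    and stable: "\<And>g f. g \<in> carrier (Sp m) \<Longrightarrow> f \<in> W \<Longrightarrow> maction (induced_module m (fund_weight r)) g f \<in> W"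
    and f: "f \<in> W" "f \<noteq> 0"
  shows "sp_restrict m (lead_minor r) \<in> W"
proof -
  have translate: "sp_restrict m (\<lambda>x. f (a * x)) \<in> W" if a: "a \<in> carrier (Sp m)" and f: "f \<in> W" for a f
    using stable[OF symp_inverse_closed(1)[OF a] f]
    unfolding induced_action[OF symp_inverse_closed(1)[OF a]] symp_inverse_symp_inverse[OF a] .
  have "f \<in> mspace (induced_module m (fund_weight r))" using f(1) W(2) by blast
  then obtain g where g: "g \<in> carrier (Sp m)" "f g \<noteq> 0"
    using f(2) by (auto simp: induced_iff fun_eq_iff)
  define f1 where "f1 = sp_restrict m (\<lambda>x. f (g * x))"
  have f1: "f1 \<in> W" unfolding f1_def by (rule translate[OF g(1) f(1)])
  have f1_one: "f1 (1\<^sub>m (2 * m)) \<noteq> 0"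
    using g right_mult_one_mat[OF Sp_carrier_mat[OF g(1)]] by (simp add: f1_def)
  have semi: "semi_inv m (fund_weight r) f1" using f1 W(2) by (auto simp: induced_iff)
  obtain \<Lambda> F where \<Lambda>: "finite \<Lambda>" "\<Lambda> \<subseteq> weights m" and F: "\<And>\<nu>. \<nu> \<in> \<Lambda> \<Longrightarrow> semi_inv m (fund_weight r) (F \<nu>)"
    "\<And>\<nu>. \<nu> \<in> \<Lambda> \<Longrightarrow> has_weight m \<nu> (F \<nu>)" and sum: "\<And>g. g \<in> carrier (Sp m) \<Longrightarrow> f1 g = (\<Sum>\<nu>\<in>\<Lambda>. F \<nu> g)"
    using weight_decomposition[OF inf semi] by blast
  have "(\<Sum>\<nu>\<in>\<Lambda>. F \<nu> (1\<^sub>m (2 * m))) \<noteq> 0" using f1_one sum[OF one_Sp_closed] by simp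
  then obtain \<nu> where \<nu>: "\<nu> \<in> \<Lambda>" "F \<nu> (1\<^sub>m (2 * m)) \<noteq> 0" by (meson sum.neutral)
  \<comment> \<open>At the identity, left and right translation by the torus agree. The left weight
    of a component that is nonzero there is therefore the weight of its right
    semi-invariance.\<close>
  have eq: "\<nu> = fund_weight r"
  proof -
    have fin: "finite {\<nu>, fund_weight r}" and sub: "{\<nu>, fund_weight r} \<subseteq> weights m"
      using \<nu>(1) \<Lambda>(2) fund_weight_weights[OF r] by auto
    obtain t :: "nat \<Rightarrow> 'k" where t: "\<And>i. t i \<noteq> 0" "inj_on (\<lambda>\<nu>. tchar m \<nu> t) {\<nu>, fund_weight r}"
      using exists_separating_torus_element_weights[OF inf fin sub] by blast
    have "tchar m \<nu> t * F \<nu> (1\<^sub>m (2 * m)) = F \<nu> (torus_mat m t * 1\<^sub>m (2 * m))"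
      by (rule has_weightD[where t = t, OF F(2)[OF \<nu>(1)] t(1) one_Sp_closed, symmetric])
    also have "torus_mat m t * 1\<^sub>m (2 * m) = 1\<^sub>m (2 * m) * torus_mat m t"
      by (simp only: left_mult_one_mat[OF torus_mat_carrier] right_mult_one_mat[OF torus_mat_carrier])
    also have "F \<nu> (1\<^sub>m (2 * m) * torus_mat m t) = tchar m (fund_weight r) t * F \<nu> (1\<^sub>m (2 * m))"
      unfolding semi_inv_borel[OF F(1)[OF \<nu>(1)] one_Sp_closed torus_mat_borel[where t = t, OF t(1)]]
        weight_char_torus_mat ..
    finally have "tchar m \<nu> t = tchar m (fund_weight r) t" using \<nu>(2) by simp
    then show ?thesis by (rule inj_onD[OF t(2)]) simp_all
  qed
  obtain t :: "nat \<Rightarrow> 'k" where t: "\<And>i. t i \<noteq> 0" "inj_on (\<lambda>\<nu>. tchar m \<nu> t) \<Lambda>"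
    using exists_separating_torus_element_weights[OF inf \<Lambda>] by blast
  obtain n c where c: "\<And>a. (\<Sum>k\<le>n. c k * (\<Sum>\<nu>'\<in>\<Lambda>. a \<nu>' * tchar m \<nu>' t ^ k)) = a \<nu>"
    using exists_power_sum_coeffs[OF \<Lambda>(1) t(2) \<nu>(1)] by blast
  \<comment> \<open>Translates by powers of the separating element. The interpolation coefficients
    \<open>c\<close> combine them to the component \<open>F \<nu>\<close> without leaving
    \<open>W\<close>.\<close>
  define h where "h k = sp_restrict m (\<lambda>x. f1 (torus_mat m (\<lambda>i. t i ^ k) * x))" for k
  have tk: "\<And>i. t i ^ k \<noteq> 0" for k using t(1) by simp
  note Tk = torus_mat_closed[where m = m, OF tk]
  have h: "h k \<in> W" for k unfolding h_def by (rule translate[OF Tk f1])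
  have hx: "h k x = (\<Sum>\<nu>'\<in>\<Lambda>. F \<nu>' x * tchar m \<nu>' t ^ k)" if x: "x \<in> carrier (Sp m)" for k x
  proof -
    have "h k x = (\<Sum>\<nu>'\<in>\<Lambda>. F \<nu>' (torus_mat m (\<lambda>i. t i ^ k) * x))"
      using x sum[OF Sp_mult_closed[OF Tk x]] by (simp add: h_def)
    also have "\<dots> = (\<Sum>\<nu>'\<in>\<Lambda>. F \<nu>' x * tchar m \<nu>' t ^ k)"
      using has_weightD[OF F(2), of _ "\<lambda>i. t i ^ k" x] tk x
      by (intro sum.cong refl) (simp add: tchar_power mult.commute)
    finally show ?thesis .
  qed
  let ?c = "F \<nu> (1\<^sub>m (2 * m))"
  have Fh: "F \<nu> x = (\<Sum>k\<le>n. fscale (c k) (h k)) x" if x: "x \<in> carrier (Sp m)" for x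
    unfolding sum_fun_apply fscale_apply using c[of "\<lambda>\<nu>. F \<nu> x"] by (simp add: hx[OF x])
  have minor: "F \<nu> x - ?c * lead_minor r x = 0" if x: "x \<in> carrier (Sp m)" for x
  proof -
    have s: "semi_inv m (fund_weight r) (\<lambda>x. F \<nu> x + (- ?c) * lead_minor r x)"
      by (intro semi_inv_add semi_inv_cmult F(1)[OF \<nu>(1)] lead_minor_semi_inv[OF r])
    have w: "has_weight m (fund_weight r) (\<lambda>x. F \<nu> x + (- ?c) * lead_minor r x)"
      using F(2)[OF \<nu>(1)] lead_minor_has_weight[OF r] unfolding eq by (intro has_weight_add_cmult)
    have "F \<nu> x + (- ?c) * lead_minor r x = 0"
      by (rule fund_weight_vector_unique[OF inf r s w _ x]) (use r in \<open>simp add: lead_minor_one\<close>)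
    then show ?thesis by simp
  qed
  have "sp_restrict m (lead_minor r) = fscale (inverse ?c) (\<Sum>k\<le>n. fscale (c k) (h k))"
  proof
    fix x show "sp_restrict m (lead_minor r) x = fscale (inverse ?c) (\<Sum>k\<le>n. fscale (c k) (h k)) x"
    proof (cases "x \<in> carrier (Sp m)")
      case True
      then show ?thesis using minor[OF True] \<nu>(2) unfolding fscale_apply Fh[OF True, symmetric] by simp
    next
      case False
      then show ?thesis unfolding fscale_apply sum_fun_apply by (simp add: sp_restrict_def h_def)
    qed
  qed
  moreover have "(\<Sum>k\<le>n. fscale (c k) (h k)) \<in> W"
    by (intro fun_vs.subspace_sum[OF W(1)] fun_subspaceD(3)[OF W(1)] h)
  ultimately show ?thesis using fun_subspaceD(3)[OF W(1)] by (simp only:)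
qed

text \<open>The Gram matrix represents the longest element of the Weyl group; translating by it
  turns the leading minor into an eigenvector of the Borel subgroup.\<close>

lemma symp_form_closed: "symp_form m \<in> carrier (Sp m)"
proof (rule SpI)
  fix i j assume ij: "i < 2 * m" "j < 2 * m"
  let ?J = "symp_form m :: 'a mat"
  have "bform m (mcol ?J i) (mcol ?J j)
      = bform m (\<lambda>k. - ssgn m i * unit_fun (opp m i) k) (\<lambda>k. - ssgn m j * unit_fun (opp m j) k)"
    using ij by (intro bform_cong) (auto simp: symp_form_index unit_fun_apply opp_eq_iff)
  also have "\<dots> = symp_form m $$ (i, j)"
    using ij by (subst bform_cmult_unit) (auto simp: symp_form_index opp_eq_iff ssgn_def)
  finally show "bform m (mcol ?J i) (mcol ?J j) = symp_form m $$ (i, j)" .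
qed simp

text \<open>In the pairing of columns \<open>i\<close> and \<open>opp m i\<close>, upper
  triangularity leaves the single summand \<open>k = i\<close>.\<close>

lemma borel_diag_opp:
  assumes b: "b \<in> borel_Sp m" and i: "i < m"
  shows "b $$ (i, i) * b $$ (opp m i, opp m i) = 1"
proof -
  have bS: "b \<in> carrier (Sp m)" and up: "upper_triangular b" using b by (simp_all add: borel_Sp_def)
  have z: "b $$ (k, l) = 0" if "k < 2 * m" "l < k" for k l
    using up that Sp_carrier_mat[OF bS] by auto
  have i2: "i < 2 * m" and oi: "opp m i < 2 * m" using i by (simp_all add: opp_def)
  have "1 = bform m (mcol b i) (mcol b (opp m i))"
    using bS i2 oi i unfolding Sp_iff by (simp add: symp_form_index ssgn_def)
  also have "\<dots> = (\<Sum>k<2*m. if k = i then b $$ (i, i) * b $$ (opp m i, opp m i) else 0)"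
    unfolding bform_alt
  proof (intro sum.cong refl)
    fix k assume "k \<in> {..<2 * m}"
    then have k: "k < 2 * m" by simp
    consider "k = i" | "i < k" | "k < i" by linarith
    then show "ssgn m k * b $$ (k, i) * b $$ (opp m k, opp m i)
        = (if k = i then b $$ (i, i) * b $$ (opp m i, opp m i) else 0)"
    proof cases
      case 1 then show ?thesis using i by (simp add: ssgn_def)
    next
      case 2 then show ?thesis using z[OF k] by simp
    next
      case 3
      then have "opp m i < opp m k" using i by (simp add: opp_def)
      then show ?thesis using z[OF opp_less[OF k]] 3 by simp
    qed
  qed
  also have "\<dots> = b $$ (i, i) * b $$ (opp m i, opp m i)" using i2 by simp
  finally show ?thesis by simp
qed

text \<open>Conjugation by the Gram matrix makes \<open>b\<close> lower triangular and reverses its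
  diagonal. A lower triangular left factor leaves the leading minor as the product of its first
  \<open>r\<close> diagonal entries, and these are the inverses of those of
  \<open>b\<close>.\<close>

lemma lead_minor_symp_form_borel:
  fixes b :: "'k::field mat"
  assumes r: "r \<le> m" and b: "b \<in> borel_Sp m" and x: "x \<in> carrier (Sp m)"
  shows "lead_minor r (symp_form m * x) = weight_char m (fund_weight r) b * lead_minor r (symp_form m * (b * x))"
proof -
  let ?J = "symp_form m :: 'k mat"
  have bS: "b \<in> carrier (Sp m)" and up: "upper_triangular b" using b by (simp_all add: borel_Sp_def)
  have z: "b $$ (k, l) = 0" if "k < 2 * m" "l < k" for k l
    using up that Sp_carrier_mat[OF bS] by auto
  define l where "l = mat (2 * m) (2 * m) (\<lambda>(i, j). ssgn m i * ssgn m j * b $$ (opp m i, opp m j))"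
  have lc: "l \<in> carrier_mat (2 * m) (2 * m)" by (simp add: l_def)
  note bc = Sp_carrier_mat[OF bS] and xc = Sp_carrier_mat[OF x]
  have Jb: "?J * b = l * ?J"
  proof (rule eq_matI)
    fix i j assume "i < dim_row (l * ?J)" "j < dim_col (l * ?J)"
    then have ij: "i < 2 * m" "j < 2 * m" by (simp_all add: l_def)
    have "(?J * b) $$ (i, j) = (\<Sum>k<2*m. ?J $$ (i, k) * b $$ (k, j))"
      by (rule mult_mat_index[OF symp_form_carrier bc ij])
    also have "\<dots> = (\<Sum>k<2*m. if k = opp m i then ssgn m i * b $$ (opp m i, j) else 0)"
      using ij by (intro sum.cong refl) (simp add: symp_form_index)
    also have "\<dots> = (\<Sum>k<2*m. if k = opp m j then ssgn m i * b $$ (opp m i, j) else 0)"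
      using ij by simp
    also have "\<dots> = (\<Sum>k<2*m. l $$ (i, k) * ?J $$ (k, j))"
    proof (intro sum.cong refl)
      fix k assume "k \<in> {..<2 * m}"
      then have k: "k < 2 * m" by simp
      show "(if k = opp m j then ssgn m i * b $$ (opp m i, j) else 0) = l $$ (i, k) * ?J $$ (k, j)"
        using ij k opp_eq_iff[OF k ij(2)] by (auto simp: symp_form_index l_def mult.assoc ssgn_def)
    qed
    also have "\<dots> = (l * ?J) $$ (i, j)"
      by (rule mult_mat_index[OF lc symp_form_carrier ij, symmetric])
    finally show "(?J * b) $$ (i, j) = (l * ?J) $$ (i, j)" .
  qed (use bc in \<open>simp_all add: l_def\<close>)
  have "?J * (b * x) = ?J * b * x"
    by (simp only: Sp_assoc[OF symp_form_closed bS x])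
  also have "\<dots> = l * (?J * x)"
    unfolding Jb by (rule assoc_mult_mat[OF lc symp_form_carrier xc])
  finally have Jbx: "?J * (b * x) = l * (?J * x)" .
  have "lead_minor r (l * (?J * x)) = (\<Prod>i<r. l $$ (i, i)) * lead_minor r (?J * x)"
  proof (rule lead_minor_left[OF mult_carrier_mat[OF symp_form_carrier xc] lc])
    fix i j assume ij: "j < 2 * m" "i < j"
    then have "opp m j < opp m i" by (simp add: opp_def)
    then show "l $$ (i, j) = 0" using ij z[of "opp m i" "opp m j"] by (simp add: l_def)
  qed (use r in simp)
  moreover have "(\<Prod>i<r. b $$ (i, i)) * (\<Prod>i<r. l $$ (i, i)) = 1"
    unfolding prod.distrib[symmetric]
    by (intro prod.neutral ballI) (use r in \<open>simp add: l_def borel_diag_opp[OF b]\<close>)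
  ultimately show ?thesis
    unfolding Jbx weight_char_fund_weight[OF r] by (simp add: mult.assoc[symmetric])
qed

text \<open>The submodule generated by the leading minor. As every nonzero submodule contains that
  minor, this is the simple socle of the induced module.\<close>

definition orbit_span :: "nat \<Rightarrow> nat \<Rightarrow> ('k::field mat \<Rightarrow> 'k) set" where
  "orbit_span m r = fun_vs.span ((\<lambda>a. sp_restrict m (\<lambda>x. lead_minor r (a * x))) ` carrier (Sp m))"

lemma exists_simple_in_induced:
  assumes inf: "infinite (UNIV :: 'k::field set)" and r: "r \<le> m"
  shows "\<exists>M :: ('k, 'k mat) gmodule. simple_module m M \<and> has_highest_weight m (fund_weight r) M"
proof -
  let ?H = "induced_module m (fund_weight r) :: ('k, 'k mat) gmodule"
  let ?F = "\<lambda>a. sp_restrict m (\<lambda>x. lead_minor r (a * x)) :: 'k mat \<Rightarrow> 'k"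
  define W where "W = (orbit_span m r :: ('k mat \<Rightarrow> 'k) set)"
  define M where "M = \<lparr>mspace = W, maction = maction ?H\<rparr>"
  have F: "?F a \<in> W" if "a \<in> carrier (Sp m)" for a
    unfolding W_def orbit_span_def using that by (intro fun_vs.span_base imageI)
  have sub: "fun_vs.subspace W" unfolding W_def orbit_span_def by (rule fun_vs.subspace_span)
  have gens: "?F ` carrier (Sp m) \<subseteq> mspace ?H"
    using sp_restrict_induced[OF semi_inv_translate[OF lead_minor_semi_inv[OF r]]] by blast
  have WH: "W \<subseteq> mspace ?H"
    unfolding W_def orbit_span_def by (rule fun_vs.span_minimal[OF gens subspace_induced])
  have act_F: "maction ?H g (?F a) = ?F (a * symp_inverse m g)"
    if g: "g \<in> carrier (Sp m)" and a: "a \<in> carrier (Sp m)" for g a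
  proof
    note gi = symp_inverse_closed(1)[OF g]
    fix x show "maction ?H g (?F a) x = ?F (a * symp_inverse m g) x"
      unfolding induced_action[OF g]
      by (cases "x \<in> carrier (Sp m)")
        (simp_all add: sp_restrict_def Sp_mult_closed[OF gi] Sp_assoc[OF a gi] del: assoc_mult_mat)
  qed
  have add: "maction ?H g (u + v) = maction ?H g u + maction ?H g v" if "g \<in> carrier (Sp m)" for g u v
    unfolding induced_action[OF that] by (simp add: sp_restrict_def fun_eq_iff)
  have scale: "maction ?H g (fscale c v) = fscale c (maction ?H g v)" if "g \<in> carrier (Sp m)" for g c v
    unfolding induced_action[OF that] by (simp add: sp_restrict_def fun_eq_iff)
  have zero: "maction ?H g 0 = 0" if "g \<in> carrier (Sp m)" for g
    unfolding induced_action[OF that] by (simp add: sp_restrict_def fun_eq_iff)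
  have stable: "maction ?H g f \<in> W" if g: "g \<in> carrier (Sp m)" and f: "f \<in> W" for g f
  proof -
    let ?S = "{f. maction ?H g f \<in> W}"
    have "fun_vs.subspace ?S"
      unfolding fun_vs.subspace_def
      using fun_subspaceD(1-3)[OF sub] by (simp add: add[OF g] scale[OF g] zero[OF g])
    moreover have "?F ` carrier (Sp m) \<subseteq> ?S"
    proof
      fix f assume "f \<in> ?F ` carrier (Sp m)"
      then obtain a where a: "a \<in> carrier (Sp m)" "f = ?F a" by blast
      show "f \<in> ?S"
        unfolding a(2) mem_Collect_eq act_F[OF g a(1)]
        by (rule F[OF Sp_mult_closed[OF a(1) symp_inverse_closed(1)[OF g]]])
    qed
    ultimately have "W \<subseteq> ?S" unfolding W_def orbit_span_def by (intro fun_vs.span_minimal)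
    then show ?thesis using f by blast
  qed
  obtain B :: "('k mat \<Rightarrow> 'k) set" where B: "finite B" "mspace ?H = fun_vs.span B"
    using induced_dim_le[OF inf r] by metis
  have id: "Vector_Spaces.linear fscale fscale (\<lambda>f :: 'k mat \<Rightarrow> 'k. f)"
    by (rule fscale_linearI) simp_all
  have "\<exists>C. finite C \<and> W = fun_vs.span C"
  proof (rule finite_span_if_injective[OF sub id _ B(1)])
    show "(\<lambda>f. f) ` W \<subseteq> fun_vs.span B" using WH B(2) by simp
    fix C :: "('k mat \<Rightarrow> 'k) set" assume "finite C" "W = fun_vs.span C"
    then show "\<exists>C. finite C \<and> W = fun_vs.span C" by blast
  qed
  then obtain C where C: "finite C" "W = fun_vs.span C" by blast
  have rat: "rational_module m M"
    unfolding M_def by (rule induced_submodule_rational[OF sub WH C stable])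
  have one: "?F (1\<^sub>m (2 * m)) = sp_restrict m (lead_minor r)"
    using left_mult_one_mat[OF Sp_carrier_mat] by (fastforce simp: sp_restrict_def fun_eq_iff)
  have F1: "sp_restrict m (lead_minor r) \<in> W" using F[OF one_Sp_closed] by (simp only: one)
  have "sp_restrict m (lead_minor r) (1\<^sub>m (2 * m)) \<noteq> (0 :: 'k)"
    using r by (simp add: lead_minor_one)
  then have Fnz: "sp_restrict m (lead_minor r) \<noteq> (0 :: 'k mat \<Rightarrow> 'k)" by (metis zero_fun_apply)
  have simple: "simple_module m M"
    unfolding simple_module_def
  proof (intro conjI allI impI rat)
    show "mspace M \<noteq> {0}" using F1 Fnz by (auto simp: M_def)
    fix W' assume W': "W' \<subseteq> mspace M"
      "fun_vs.subspace W' \<and> (\<forall>g\<in>carrier (Sp m). \<forall>v\<in>W'. maction M g v \<in> W')"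
    have stable': "maction ?H g v \<in> W'" if "g \<in> carrier (Sp m)" "v \<in> W'" for g v
      using W'(2) that by (simp add: M_def)
    have sub': "fun_vs.subspace W'" using W'(2) by blast
    have W'H: "W' \<subseteq> mspace ?H" using W'(1) WH by (auto simp: M_def)
    show "W' = {0} \<or> W' = mspace M"
    proof (rule disjCI)
      assume ne: "W' \<noteq> mspace M"
      show "W' = {0}"
      proof (rule ccontr)
        assume "W' \<noteq> {0}"
        then obtain f where f: "f \<in> W'" "f \<noteq> 0" using fun_subspaceD(1)[OF sub'] by blast
        have L: "sp_restrict m (lead_minor r) \<in> W'"
          by (rule stable_subspace_contains_lead_minor[OF inf r sub' W'H stable' f])
        have "?F a \<in> W'" if a: "a \<in> carrier (Sp m)" for a
        proof -
          have "maction ?H (symp_inverse m a) (?F (1\<^sub>m (2 * m))) \<in> W'"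
            unfolding one by (rule stable'[OF symp_inverse_closed(1)[OF a] L])
          then show ?thesis
            unfolding act_F[OF symp_inverse_closed(1)[OF a] one_Sp_closed] symp_inverse_symp_inverse[OF a]
              left_mult_one_mat[OF Sp_carrier_mat[OF a]] .
        qed
        then have "W \<subseteq> W'"
          unfolding W_def orbit_span_def by (intro fun_vs.span_minimal sub') blast
        then show False using ne W'(1) by (auto simp: M_def)
      qed
    qed
  qed
  have "has_highest_weight m (fund_weight r) M"
    unfolding has_highest_weight_def
  proof (intro bexI conjI ballI)
    \<comment> \<open>The leading minor itself is an eigenvector of the lower triangular matrices,
      hence a lowest weight vector; the longest Weyl group element carries it to a highest weight
      vector.\<close>
    let ?v = "?F (symp_form m)"
    show "?v \<in> mspace M" using F[OF symp_form_closed] by (simp add: M_def)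
    show "?v \<noteq> 0"
    proof
      assume v0: "?v = 0"
      have "?v (symp_inverse m (symp_form m)) = lead_minor r (1\<^sub>m (2 * m))"
        unfolding sp_restrict_apply[OF symp_inverse_closed(1)[OF symp_form_closed]]
          symp_inverse_closed(2)[OF symp_form_closed] ..
      then show False unfolding v0 using r by (simp add: lead_minor_one)
    qed
    fix b :: "'k mat" assume b: "b \<in> borel_Sp m"
    have bS: "b \<in> carrier (Sp m)" using b by (simp add: borel_Sp_def)
    note bi = symp_inverse_closed(1)[OF bS]
    have "maction ?H b ?v = fscale (weight_char m (fund_weight r) b) ?v"
    proof
      fix x show "maction ?H b ?v x = fscale (weight_char m (fund_weight r) b) ?v x"
      proof (cases "x \<in> carrier (Sp m)")
        case True
        note bx = Sp_mult_closed[OF bi True]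
        show ?thesis
          unfolding induced_action[OF bS] fscale_apply
          using lead_minor_symp_form_borel[OF r b bx] left_cancel_inverse(1)[OF bS True] True bx
          by (simp del: assoc_mult_mat)
      next
        case False
        then show ?thesis unfolding induced_action[OF bS] by (simp add: sp_restrict_def)
      qed
    qed
    then show "maction M b ?v = fscale (weight_char m (fund_weight r) b) ?v" by (simp add: M_def)
  qed
  then show ?thesis using simple by blast
qed

text \<open>The definition of \<^const>\<open>L_module\<close> chooses among the modules on subspaces of
  \<^typ>\<open>nat \<Rightarrow> 'k\<close>, so the simple module found inside the induced module is moved there.\<close>

lemma transport_simple_module:
  fixes M :: "('k::field, 'i) gmodule"
  assumes M: "simple_module m M" and hw: "has_highest_weight m \<mu> M"
  shows "\<exists>M' :: ('k, nat) gmodule. simple_module m M' \<and> has_highest_weight m \<mu> M'"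
proof -
  have R: "rational_module m M" using M by (simp add: simple_module_def)
  note D = rational_moduleD[OF R]
  define V where "V = mspace M"
  have sub: "fun_vs.subspace V" unfolding V_def by (rule D(1))
  note subD = fun_subspaceD[OF sub]
  obtain C where C: "finite C" "V = fun_vs.span C" using D(2) unfolding V_def by blast
  obtain B where B: "B \<subseteq> V" "fun_vs.independent B" "V \<subseteq> fun_vs.span B"
    using fun_vs.maximal_independent_subset[of V] by blast
  have finB: "finite B" using fun_vs.independent_span_bound[OF C(1) B(2)] B(1) C(2) by blast
  have VB: "V = fun_vs.span B" using B(3) fun_vs.span_minimal[OF B(1) sub] by blast
  define n where "n = card B"
  obtain e where e: "bij_betw e {..<n} B"
    using ex_bij_betw_nat_finite[OF finB] by (auto simp: n_def atLeast0LessThan)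
  have eB: "e k \<in> B" if "k < n" for k using e that by (auto simp: bij_betw_def)
  \<comment> \<open>Transport by coordinates: \<open>\<theta>\<close> forms the linear combination
    of an enumerated basis, and \<open>\<psi>\<close> reads off the coefficients.\<close>
  define \<theta> :: "(nat \<Rightarrow> 'k) \<Rightarrow> 'i \<Rightarrow> 'k" where "\<theta> c = (\<Sum>k<n. fscale (c k) (e k))" for c
  define \<psi> :: "('i \<Rightarrow> 'k) \<Rightarrow> nat \<Rightarrow> 'k" where
    "\<psi> v = (\<lambda>k. if k < n then fun_vs.representation B v (e k) else 0)" for v
  define V' where "V' = {c :: nat \<Rightarrow> 'k. \<forall>k\<ge>n. c k = 0}"
  have \<theta>_V: "\<theta> c \<in> V" for c
    unfolding \<theta>_def using eB B(1) by (intro fun_vs.subspace_sum[OF sub] subD(3)) blast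
  have \<theta>_add: "\<theta> (c + d) = \<theta> c + \<theta> d" for c d
    unfolding \<theta>_def by (auto simp: fun_eq_iff sum_fun_apply distrib_right sum.distrib)
  have \<theta>_scale: "\<theta> (fscale a c) = fscale a (\<theta> c)" for a c
    unfolding \<theta>_def by (auto simp: fun_eq_iff sum_fun_apply sum_distrib_left mult.assoc)
  have \<theta>_0: "\<theta> 0 = 0" unfolding \<theta>_def by (auto simp: fun_eq_iff sum_fun_apply)
  have \<psi>_V': "\<psi> v \<in> V'" for v by (simp add: \<psi>_def V'_def)
  have \<psi>_add: "\<psi> (u + v) = \<psi> u + \<psi> v" if "u \<in> V" "v \<in> V" for u v
  proof
    fix k
    have "fun_vs.representation B (u + v) = (\<lambda>b. fun_vs.representation B u b + fun_vs.representation B v b)"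
      using that VB by (intro fun_vs.representation_add[OF B(2)]) blast+
    then show "\<psi> (u + v) k = (\<psi> u + \<psi> v) k" by (simp add: \<psi>_def)
  qed
  have \<psi>_scale: "\<psi> (fscale c v) = fscale c (\<psi> v)" if "v \<in> V" for c v
  proof
    fix k
    have "fun_vs.representation B (fscale c v) = (\<lambda>b. c * fun_vs.representation B v b)"
      using that VB by (intro fun_vs.representation_scale[OF B(2)]) blast
    then show "\<psi> (fscale c v) k = fscale c (\<psi> v) k" by (simp add: \<psi>_def)
  qed
  have \<theta>\<psi>: "\<theta> (\<psi> v) = v" if v: "v \<in> V" for v
  proof -
    have "\<theta> (\<psi> v) = (\<Sum>k<n. fscale (fun_vs.representation B v (e k)) (e k))"
      unfolding \<theta>_def \<psi>_def by (intro sum.cong refl) simp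
    also have "\<dots> = (\<Sum>b\<in>B. fscale (fun_vs.representation B v b) b)"
      by (rule sum.reindex_bij_betw[OF e])
    also have "\<dots> = v"
      using v VB by (intro fun_vs.sum_representation_eq[OF B(2) _ finB order_refl]) blast
    finally show ?thesis .
  qed
  have \<psi>\<theta>: "\<psi> (\<theta> c) = c" if c: "c \<in> V'" for c
  proof
    fix j
    show "\<psi> (\<theta> c) j = c j"
    proof (cases "j < n")
      case True
      have "fun_vs.representation B (\<theta> c) = (\<lambda>b. \<Sum>k<n. fun_vs.representation B (fscale (c k) (e k)) b)"
        unfolding \<theta>_def using eB by (intro fun_vs.representation_sum[OF B(2)] fun_vs.span_scale fun_vs.span_base) simp
      then have "\<psi> (\<theta> c) j = (\<Sum>k<n. fun_vs.representation B (fscale (c k) (e k)) (e j))"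
        using True by (simp add: \<psi>_def)
      also have "\<dots> = (\<Sum>k<n. if k = j then c j else 0)"
      proof (intro sum.cong refl)
        fix k assume "k \<in> {..<n}"
        then have k: "k < n" by simp
        have "fun_vs.representation B (fscale (c k) (e k)) = (\<lambda>b. c k * fun_vs.representation B (e k) b)"
          by (rule fun_vs.representation_scale[OF B(2) fun_vs.span_base[OF eB[OF k]]])
        moreover have "fun_vs.representation B (e k) = (\<lambda>b. if b = e k then 1 else 0)"
          by (rule fun_vs.representation_basis[OF B(2) eB[OF k]])
        moreover have "e j = e k \<longleftrightarrow> k = j"
          using e True k by (auto simp: bij_betw_def inj_on_def)
        ultimately show "fun_vs.representation B (fscale (c k) (e k)) (e j) = (if k = j then c j else 0)"
          by simp
      qed
      finally show ?thesis using True by simp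
    next
      case False
      then show ?thesis using c by (simp add: \<psi>_def V'_def)
    qed
  qed
  have sub': "fun_vs.subspace V'" unfolding fun_vs.subspace_def V'_def by auto
  define M' where "M' = \<lparr>mspace = V', maction = (\<lambda>g c. \<psi> (maction M g (\<theta> c)))\<rparr>"
  have act: "maction M g (\<theta> c) \<in> V" if "g \<in> carrier (Sp m)" for g c
    using D(3)[OF that] \<theta>_V unfolding V_def by blast
  have lin: "Vector_Spaces.linear fscale fscale \<theta>"
    by (rule fscale_linearI[OF \<theta>_add \<theta>_scale])
  have "\<exists>C'. finite C' \<and> V' = fun_vs.span C'"
  proof (rule finite_span_if_injective[OF sub' lin _ finB])
    fix c assume "c \<in> V'" "\<theta> c = 0"
    then show "c = 0" using \<psi>\<theta>[of c] \<psi>\<theta>[of 0] \<theta>_0 fun_subspaceD(1)[OF sub'] by simp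
  next
    show "\<theta> ` V' \<subseteq> fun_vs.span B" using \<theta>_V VB by blast
    fix C' :: "(nat \<Rightarrow> 'k) set" assume "finite C'" "V' = fun_vs.span C'"
    then show "\<exists>C'. finite C' \<and> V' = fun_vs.span C'" by blast
  qed
  then obtain C' where C': "finite C'" "V' = fun_vs.span C'" by blast
  have rat: "rational_module m M'"
    unfolding rational_module_def M'_def gmodule.simps mult_Sp one_Sp
  proof (intro conjI ballI allI)
    show "fun_vs.subspace V'" by (rule sub')
    show "\<exists>B. finite B \<and> V' = fun_vs.span B" using C' by blast
    show "\<psi> (maction M g (\<theta> v)) \<in> V'" for g v by (rule \<psi>_V')
    show "\<psi> (maction M g (\<theta> (u + v))) = \<psi> (maction M g (\<theta> u)) + \<psi> (maction M g (\<theta> v))"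
      if g: "g \<in> carrier (Sp m)" for g u v
      unfolding \<theta>_add D(4)[OF g \<theta>_V[unfolded V_def] \<theta>_V[unfolded V_def]] by (rule \<psi>_add[OF act[OF g] act[OF g]])
    show "\<psi> (maction M g (\<theta> (fscale c v))) = fscale c (\<psi> (maction M g (\<theta> v)))"
      if g: "g \<in> carrier (Sp m)" for g c v
      unfolding \<theta>_scale D(5)[OF g \<theta>_V[unfolded V_def]] by (rule \<psi>_scale[OF act[OF g]])
    show "\<psi> (maction M (1\<^sub>m (2 * m)) (\<theta> v)) = v" if "v \<in> V'" for v
      unfolding D(6)[OF \<theta>_V[unfolded V_def]] by (rule \<psi>\<theta>[OF that])
    show "\<psi> (maction M (g * h) (\<theta> v)) = \<psi> (maction M g (\<theta> (\<psi> (maction M h (\<theta> v)))))"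
      if g: "g \<in> carrier (Sp m)" and h: "h \<in> carrier (Sp m)" for g h v
      unfolding \<theta>\<psi>[OF act[OF h]] D(7)[OF g h \<theta>_V[unfolded V_def]] ..
    show "(\<lambda>g. if g \<in> carrier (Sp m) then \<phi> (\<psi> (maction M g (\<theta> v))) else 0) \<in> coord_ring m"
      if \<phi>: "\<phi> \<in> dual_space V'" for \<phi> v
    proof -
      \<comment> \<open>A matrix coefficient of the transported module is one of \<open>M\<close>
        for the pulled-back functional, cut off outside \<open>V\<close> as
        \<open>dual_space\<close> demands.\<close>
      define \<phi>' where "\<phi>' v = (if v \<in> V then \<phi> (\<psi> v) else 0)" for v
      have "\<phi>' \<in> dual_space V"
        unfolding dual_space_def
      proof (intro CollectI conjI ballI allI impI)
        show "\<phi>' (u + v) = \<phi>' u + \<phi>' v" if "u \<in> V" "v \<in> V" for u v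
          using that subD(2)[OF that] \<psi>_add[OF that] dual_spaceD(1)[OF \<phi> \<psi>_V' \<psi>_V'] by (simp add: \<phi>'_def)
        show "\<phi>' (fscale c v) = c * \<phi>' v" if "v \<in> V" for c v
          using that subD(3)[OF that] \<psi>_scale[OF that] dual_spaceD(2)[OF \<phi> \<psi>_V'] by (simp add: \<phi>'_def)
        show "\<phi>' v = 0" if "v \<notin> V" for v using that by (simp add: \<phi>'_def)
      qed
      then have "(\<lambda>g. if g \<in> carrier (Sp m) then \<phi>' (maction M g (\<theta> v)) else 0) \<in> coord_ring m"
        using \<theta>_V[of v] unfolding V_def by (intro D(8))
      moreover have "(\<lambda>g. if g \<in> carrier (Sp m) then \<phi>' (maction M g (\<theta> v)) else 0)
          = (\<lambda>g. if g \<in> carrier (Sp m) then \<phi> (\<psi> (maction M g (\<theta> v))) else 0)"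
        using act by (simp add: \<phi>'_def fun_eq_iff)
      ultimately show ?thesis by (simp only:)
    qed
  qed
  have simple: "simple_module m M'"
    unfolding simple_module_def
  proof (intro conjI allI impI rat)
    obtain v where v: "v \<in> V" "v \<noteq> 0"
      using M subD(1) unfolding simple_module_def V_def by blast
    have "\<psi> v \<noteq> 0"
    proof
      assume "\<psi> v = 0"
      with \<theta>\<psi>[OF v(1)] have "\<theta> 0 = v" by (simp only:)
      with \<theta>_0 have "v = 0" by (rule trans[OF sym, rotated])
      with v(2) show False by contradiction
    qed
    then show "mspace M' \<noteq> {0}" using \<psi>_V'[of v] by (auto simp: M'_def)
    fix W' assume W': "W' \<subseteq> mspace M'"
      "fun_vs.subspace W' \<and> (\<forall>g\<in>carrier (Sp m). \<forall>v\<in>W'. maction M' g v \<in> W')"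
    have W'V': "W' \<subseteq> V'" using W'(1) by (simp add: M'_def)
    have W's: "fun_vs.subspace W'" using W'(2) by blast
    have stable: "\<psi> (maction M g (\<theta> c)) \<in> W'" if "g \<in> carrier (Sp m)" "c \<in> W'" for g c
      using W'(2) that by (simp add: M'_def)
    let ?W = "\<theta> ` W'"
    have Ws: "fun_vs.subspace ?W"
      unfolding fun_vs.subspace_def
    proof (intro conjI ballI allI)
      show "0 \<in> ?W" using fun_subspaceD(1)[OF W's] \<theta>_0 by (metis imageI)
      show "x + y \<in> ?W" if "x \<in> ?W" "y \<in> ?W" for x y
        using that fun_subspaceD(2)[OF W's] by (auto simp flip: \<theta>_add)
      show "fscale c x \<in> ?W" if "x \<in> ?W" for c x
        using that fun_subspaceD(3)[OF W's] by (auto simp flip: \<theta>_scale)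
    qed
    have Wstable: "maction M g x \<in> ?W" if g: "g \<in> carrier (Sp m)" and x: "x \<in> ?W" for g x
    proof -
      obtain c where c: "c \<in> W'" "x = \<theta> c" using x by blast
      have "\<theta> (\<psi> (maction M g (\<theta> c))) \<in> ?W" by (rule imageI[OF stable[OF g c(1)]])
      then show ?thesis unfolding \<theta>\<psi>[OF act[OF g]] c(2) .
    qed
    have WM: "?W \<subseteq> mspace M" using \<theta>_V unfolding V_def by blast
    have "\<forall>W \<subseteq> mspace M. fun_vs.subspace W \<and>
        (\<forall>g \<in> carrier (Sp m). \<forall>v \<in> W. maction M g v \<in> W) \<longrightarrow> W = {0} \<or> W = mspace M"
      using M unfolding simple_module_def by (elim conjE)
    from this[rule_format, OF WM] have "?W = {0} \<or> ?W = V"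
      unfolding V_def using Ws Wstable by simp
    then show "W' = {0} \<or> W' = mspace M'"
    proof
      assume W0: "?W = {0}"
      have "c = 0" if c: "c \<in> W'" for c
      proof -
        have "\<theta> c = 0" using W0 imageI[OF c, of \<theta>] by blast
        then have "\<theta> c = \<theta> 0" unfolding \<theta>_0 .
        then have "\<psi> (\<theta> c) = \<psi> (\<theta> 0)" by (rule arg_cong)
        then show ?thesis
          using \<psi>\<theta>[OF subsetD[OF W'V' c]] \<psi>\<theta>[OF fun_subspaceD(1)[OF sub']] by (simp only:)
      qed
      then show ?thesis using fun_subspaceD(1)[OF W's] by blast
    next
      assume WV: "?W = V"
      have "c \<in> W'" if c: "c \<in> V'" for c
      proof -
        obtain d where d: "d \<in> W'" "\<theta> c = \<theta> d" using \<theta>_V[of c] WV by blast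
        from d(2) have "\<psi> (\<theta> c) = \<psi> (\<theta> d)" by (rule arg_cong)
        then have "c = d" unfolding \<psi>\<theta>[OF c] \<psi>\<theta>[OF subsetD[OF W'V' d(1)]] .
        then show ?thesis using d(1) by simp
      qed
      then show ?thesis using W'V' by (auto simp: M'_def)
    qed
  qed
  have "has_highest_weight m \<mu> M'"
  proof -
    obtain v where v: "v \<in> V" "v \<noteq> 0" "\<And>b. b \<in> borel_Sp m \<Longrightarrow> maction M b v = fscale (weight_char m \<mu> b) v"
      using hw unfolding has_highest_weight_def V_def by blast
    have "\<psi> v \<noteq> 0"
    proof
      assume "\<psi> v = 0"
      with \<theta>\<psi>[OF v(1)] have "\<theta> 0 = v" by (simp only:)
      with \<theta>_0 have "v = 0" by (rule trans[OF sym, rotated])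
      with v(2) show False by contradiction
    qed
    moreover have "maction M' b (\<psi> v) = fscale (weight_char m \<mu> b) (\<psi> v)" if "b \<in> borel_Sp m" for b
      unfolding M'_def gmodule.simps \<theta>\<psi>[OF v(1)] v(3)[OF that] by (rule \<psi>_scale[OF v(1)])
    moreover have "\<psi> v \<in> mspace M'" using \<psi>_V' by (simp add: M'_def)
    ultimately show ?thesis unfolding has_highest_weight_def by blast
  qed
  then show ?thesis using simple by blast
qed

lemma L_module_simple:
  assumes inf: "infinite (UNIV :: 'k::field set)" and r: "r \<le> m"
  shows "simple_module m (L_module m (fund_weight r) :: ('k, nat) gmodule)
    \<and> has_highest_weight m (fund_weight r) (L_module m (fund_weight r) :: ('k, nat) gmodule)"
proof -
  obtain M :: "('k, 'k mat) gmodule" where M: "simple_module m M" "has_highest_weight m (fund_weight r) M"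
    using exists_simple_in_induced[OF inf r] by blast
  have "\<exists>M' :: ('k, nat) gmodule. simple_module m M' \<and> has_highest_weight m (fund_weight r) M'"
    by (rule transport_simple_module[OF M])
  then show ?thesis unfolding L_module_def by (rule someI_ex)
qed

lemma dim_bounds:
  assumes inf: "infinite (UNIV :: 'k::field set)" and r: "r \<le> m"
  shows "2 ^ r * (m choose r) \<le> mdim (L_module m (fund_weight r) :: ('k, nat) gmodule)"
    and "mdim (L_module m (fund_weight r) :: ('k, nat) gmodule)
      \<le> mdim (Weyl_module m (fund_weight r) :: ('k, 'k mat \<Rightarrow> 'k) gmodule)"
    and "mdim (Weyl_module m (fund_weight r) :: ('k, 'k mat \<Rightarrow> 'k) gmodule) \<le> induced_dim_bound m r"
proof -
  let ?L = "L_module m (fund_weight r) :: ('k, nat) gmodule"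
  have L: "simple_module m ?L" "has_highest_weight m (fund_weight r) ?L"
    using L_module_simple[OF inf r] by blast+
  have "rational_module m ?L" using L(1) by (simp add: simple_module_def)
  then show "2 ^ r * (m choose r) \<le> mdim ?L" by (rule highest_weight_dim_ge[OF inf _ L(2)])
  obtain B :: "('k mat \<Rightarrow> 'k) set" where B: "finite B" "card B \<le> induced_dim_bound m r"
    "mspace (induced_module m (fund_weight r)) = fun_vs.span B"
    using induced_dim_le[OF inf r] by metis
  show "mdim ?L \<le> mdim (Weyl_module m (fund_weight r) :: ('k, 'k mat \<Rightarrow> 'k) gmodule)"
    unfolding Weyl_dim[OF B(1,3)] by (rule simple_dim_le[OF L B(1,3)])
  have "fun_vs.dim (fun_vs.span B) \<le> card B"
    by (rule fun_vs.dim_le_card[OF order_refl B(1)])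
  then show "mdim (Weyl_module m (fund_weight r) :: ('k, 'k mat \<Rightarrow> 'k) gmodule) \<le> induced_dim_bound m r"
    unfolding Weyl_dim[OF B(1,3)] B(3) using B(2) by (rule le_trans)
qed

section \<open>Asymptotics\<close>

lemma binomial_ratio_tendsto:
  "(\<lambda>m. real (m choose r) / (real m ^ r / fact r)) \<longlonglongrightarrow> 1"
proof -
  have "(\<lambda>m. \<Prod>i<r. 1 - real i / real m) \<longlonglongrightarrow> (\<Prod>i<r. 1 - 0)"
    by (intro tendsto_prod tendsto_diff tendsto_const lim_const_over_n)
  moreover have "eventually (\<lambda>m. (\<Prod>i<r. 1 - real i / real m) = real (m choose r) / (real m ^ r / fact r)) at_top"
    using eventually_gt_at_top[of 0]
  proof eventually_elim
    case (elim m)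
    have "(\<Prod>i<r. 1 - real i / real m) = (\<Prod>i<r. (real m - real i) / real m)"
      using elim by (intro prod.cong refl) (simp add: field_simps)
    also have "\<dots> = (\<Prod>i<r. real m - real i) / real m ^ r"
      by (simp add: prod_dividef)
    also have "(\<Prod>i<r. real m - real i) = real (m choose r) * fact r"
      by (simp add: binomial_gbinomial gbinomial_prod_rev atLeast0LessThan)
    finally show ?case by (simp add: field_simps)
  qed
  ultimately show ?thesis by (simp add: tendsto_cong)
qed

text \<open>Both sides carry a factor \<open>m\<close> so that the error term can be written with
  m^r. The exponent r - 1 would be distorted by truncated subtraction at r = 0, where the error is
  0.\<close>

lemma induced_dim_bound_le:
  assumes "r \<le> m"
  shows "m * induced_dim_bound m r \<le> m * (2 ^ r * (m choose r)) + r * (2 ^ r * list_const r * 2 ^ r) * m ^ r"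
proof -
  have bnd: "m * (2 ^ j * (m choose j) * mult_bound m r j) \<le> 2 ^ r * list_const r * 2 ^ r * m ^ r"
    if j: "j < r" for j
  proof -
    let ?h = "(r - j) div 2"
    have m0: "m \<ge> 1" using assms j by simp
    \<comment> \<open>The decisive estimate: for \<open>j < r\<close> an orbit of order m^j and a
      multiplicity of order m^h lose at least one power of m against m^r.\<close>
    have h: "?h \<le> r" "Suc (j + ?h) \<le> r" using j by linarith+
    have "m * (2 ^ j * (m choose j) * mult_bound m r j)
        = 2 ^ j * (m choose j) * (list_const r * (m + 1) ^ ?h) * m"
      using j by (simp add: mult_bound_def mult_ac)
    also have "\<dots> \<le> 2 ^ r * m ^ j * (list_const r * (2 * m) ^ ?h) * m"
      using j assms m0 by (intro mult_mono power_mono power_increasing binomial_le_pow) simp_all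
    also have "\<dots> = 2 ^ r * list_const r * 2 ^ ?h * m ^ Suc (j + ?h)"
      by (simp add: power_mult_distrib power_add mult_ac)
    also have "\<dots> \<le> 2 ^ r * list_const r * 2 ^ r * m ^ r"
      using h m0 by (intro mult_mono power_increasing) simp_all
    finally show ?thesis .
  qed
  have "induced_dim_bound m r = 2 ^ r * (m choose r) + (\<Sum>j<r. 2 ^ j * (m choose j) * mult_bound m r j)"
    unfolding induced_dim_bound_def lessThan_Suc_atMost[symmetric] by (simp add: mult_bound_def)
  then have "m * induced_dim_bound m r
      = m * (2 ^ r * (m choose r)) + (\<Sum>j<r. m * (2 ^ j * (m choose j) * mult_bound m r j))"
    by (simp only: distrib_left sum_distrib_left)
  also have "\<dots> \<le> m * (2 ^ r * (m choose r)) + (\<Sum>j<r. 2 ^ r * list_const r * 2 ^ r * m ^ r)"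
    by (intro add_left_mono sum_mono bnd) simp
  finally show ?thesis by simp
qed

lemma asymp_equiv_of_dim_bounds:
  fixes d :: "nat \<Rightarrow> nat"
  assumes lower: "\<And>m. r \<le> m \<Longrightarrow> 2 ^ r * (m choose r) \<le> d m"
    and upper: "\<And>m. r \<le> m \<Longrightarrow> d m \<le> induced_dim_bound m r"
  shows "(\<lambda>m. real (d m)) \<sim>[at_top] (\<lambda>m. 2 ^ r / fact r * real m ^ r)"
proof (rule asymp_equivI')
  define X where "X m = 2 ^ r / fact r * real m ^ r" for m
  define b where "b m = real (2 ^ r * (m choose r)) / X m" for m
  \<comment> \<open>Chosen so that the error term of \<open>induced_dim_bound_le\<close> divided by
    \<open>m * X m\<close> is \<open>K / m\<close>.\<close>
  define K where "K = real (r * (2 ^ r * list_const r * 2 ^ r)) / (2 ^ r / fact r)"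
  have b: "b \<longlonglongrightarrow> 1"
    using binomial_ratio_tendsto[of r] unfolding b_def X_def by simp
  have K: "(\<lambda>m. b m + K / real m) \<longlonglongrightarrow> 1"
    using tendsto_add[OF b lim_const_over_n[of K]] by simp
  show "(\<lambda>m. real (d m) / X m) \<longlonglongrightarrow> 1"
  proof (rule tendsto_sandwich[OF _ _ b K])
    have X: "X m > 0" if "m > 0" for m using that by (simp add: X_def)
    show "eventually (\<lambda>m. b m \<le> real (d m) / X m) at_top"
      using eventually_ge_at_top[of r] eventually_gt_at_top[of 0]
    proof eventually_elim
      case (elim m)
      have "real (2 ^ r * (m choose r)) \<le> real (d m)" using lower[OF elim(1)] by (rule of_nat_mono)
      then show ?case unfolding b_def using X[OF elim(2)] by (intro divide_right_mono) simp_all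
    qed
    show "eventually (\<lambda>m. real (d m) / X m \<le> b m + K / real m) at_top"
      using eventually_ge_at_top[of r] eventually_gt_at_top[of 0]
    proof eventually_elim
      case (elim m)
      have "m * d m \<le> m * induced_dim_bound m r" using upper[OF elim(1)] by simp
      also note induced_dim_bound_le[OF elim(1)]
      finally have "real (m * d m)
          \<le> real (m * (2 ^ r * (m choose r)) + r * (2 ^ r * list_const r * 2 ^ r) * m ^ r)"
        by (rule of_nat_mono)
      then have "real m * real (d m) \<le> real m * (b m * X m) + K * X m"
        using elim(2) X[OF elim(2)] unfolding K_def b_def by (simp add: X_def mult_ac)
      then have "real (d m) \<le> (b m + K / real m) * X m"
        using elim(2) by (simp add: field_simps)
      then show ?case using X[OF elim(2)] by (simp add: divide_le_eq)
    qed
  qed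
qed

theorem proposition4p1:
  fixes p r :: nat
  assumes "prime p" and "CHAR('k::alg_closed_field) = p"
  shows "((\<lambda>m. real (mdim (L_module m (fund_weight r) :: ('k, nat) gmodule)))
           \<sim>[at_top] (\<lambda>m. real (mdim (Weyl_module m (fund_weight r) :: ('k, 'k mat \<Rightarrow> 'k) gmodule))))
       \<and> ((\<lambda>m. real (mdim (Weyl_module m (fund_weight r) :: ('k, 'k mat \<Rightarrow> 'k) gmodule)))
           \<sim>[at_top] (\<lambda>m. 2 ^ r / fact r * real m ^ r))"
proof -
  note bounds = dim_bounds[OF infinite_UNIV_alg_closed_field[where 'k = 'k]]
  have L: "(\<lambda>m. real (mdim (L_module m (fund_weight r) :: ('k, nat) gmodule)))
      \<sim>[at_top] (\<lambda>m. 2 ^ r / fact r * real m ^ r)"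
    by (rule asymp_equiv_of_dim_bounds) (use bounds order_trans in blast)+
  have W: "(\<lambda>m. real (mdim (Weyl_module m (fund_weight r) :: ('k, 'k mat \<Rightarrow> 'k) gmodule)))
      \<sim>[at_top] (\<lambda>m. 2 ^ r / fact r * real m ^ r)"
    by (rule asymp_equiv_of_dim_bounds) (use bounds order_trans in blast)+
  show ?thesis
    using asymp_equiv_trans[OF L asymp_equiv_symI[OF W]] W by blast
qed

end
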